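(* Let $M$ be a simplicial complex on $[m]$ and $N\subseteq M$ a subcomplex regarded on $[m]$; let $K$ be a simplicial complex on a vertex set $[k]'$ disjoint from $[m]$ and $L\subseteq K$ a subcomplex regarded on $[k]'$. Let $Q=(M*L)\cup(N*K)$ (so $(M*L)\cap(N*K)=N*L$), a simplicial complex on $[m]\sqcup[k]'$. Let $\{(X_v,A_v)\}$ be pointed CW-pairs indexed by $[m]\sqcup[k]'$. Let $G$ be the homotopy fibre of $(\underline{X},\underline{A})^N\to(\underline{X},\underline{A})^M$ and $H$ the homotopy fibre of $(\underline{X},\underline{A})^L\to(\underline{X},\underline{A})^K$ (maps induced by inclusion). Then there is a homotopy fibration $$G*H\to(\underline{X},\underline{A})^Q\to(\underline{X},\underline{A})^M\times(\underline{X},\underline{A})^K,$$ where the second map is induced by the inclusion $Q\subseteq M*K$, and it splits after looping, giving a homotopy equivalence $$\Omega(\underline{X},\underline{A})^Q\simeq\Omega(\underline{X},\underline{A})^M\times\Omega(\underline{X},\underline{A})^K\times\Omega(G*H).$$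
   Context: Polyhedral product: for $K$ on vertex set $V$ (ghost vertices, i.e. $v$ with $\{v\}\notin K$, allowed) and pointed CW-pairs $\{(X_v,A_v)\}$, $(\underline{X},\underline{A})^K=\bigcup_{\sigma\in K}\prod_{v\in V}Y_v$, $Y_v=X_v$ if $v\in\sigma$, $A_v$ otherwise. Join of complexes on disjoint vertex sets: $\{\sigma\cup\tau\}$; $(\underline{X},\underline{A})^{K_1*K_2}=(\underline{X},\underline{A})^{K_1}\times(\underline{X},\underline{A})^{K_2}$. $G*H$ is the topological join. *)

theory Defs
  imports "HOL-Analysis.Analysis"
begin

definition simplicial_complex :: "'v set \<Rightarrow> 'v set set \<Rightarrow> bool" where
  "simplicial_complex V K \<longleftrightarrow> finite V \<and> {} \<in> K \<and> (\<forall>\<sigma>\<in>K. \<sigma> \<subseteq> V) \<and>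
     (\<forall>\<sigma>\<in>K. \<forall>\<tau>. \<tau> \<subseteq> \<sigma> \<longrightarrow> \<tau> \<in> K)"

definition join_complex :: "'v set set \<Rightarrow> 'v set set \<Rightarrow> 'v set set" where
  "join_complex K1 K2 = {\<sigma> \<union> \<tau> | \<sigma> \<tau>. \<sigma> \<in> K1 \<and> \<tau> \<in> K2}"

text \<open>Closed n-disc and (n-1)-sphere, inside the first n coordinates of nat => real,
  with the (there Euclidean) product topology.\<close>

definition disc :: "nat \<Rightarrow> (nat \<Rightarrow> real) set" where
  "disc n = {x. (\<forall>i\<ge>n. x i = 0) \<and> (\<Sum>i<n. (x i)\<^sup>2) \<le> 1}"

definition sphere_bd :: "nat \<Rightarrow> (nat \<Rightarrow> real) set" where
  "sphere_bd n = {x. (\<forall>i\<ge>n. x i = 0) \<and> (\<Sum>i<n. (x i)\<^sup>2) = 1}"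

definition RN :: "(nat \<Rightarrow> real) topology" where
  "RN = product_topology (\<lambda>_. euclideanreal) UNIV"

text \<open>A CW structure on X: the open cells C (indexed by themselves), with dimension d
  and characteristic maps phi.\<close>

definition cw_structure ::
  "'a topology \<Rightarrow> 'a set set \<Rightarrow> ('a set \<Rightarrow> nat) \<Rightarrow> ('a set \<Rightarrow> (nat \<Rightarrow> real) \<Rightarrow> 'a) \<Rightarrow> bool" where
  "cw_structure X C d \<phi> \<longleftrightarrow>
     Hausdorff_space X \<and>
     (\<forall>c\<in>C. continuous_map (subtopology RN (disc (d c))) X (\<phi> c)) \<and>
     (\<forall>c\<in>C. \<phi> c ` (disc (d c) - sphere_bd (d c)) = c) \<and>
     (\<forall>c\<in>C. homeomorphic_map (subtopology RN (disc (d c) - sphere_bd (d c)))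
                              (subtopology X c) (\<phi> c)) \<and>
     (\<forall>c\<in>C. \<forall>c'\<in>C. c \<noteq> c' \<longrightarrow> c \<inter> c' = {}) \<and>
     \<Union>C = topspace X \<and>
     (\<forall>c\<in>C. \<phi> c ` sphere_bd (d c) \<subseteq> \<Union>{c'\<in>C. d c' < d c}) \<and>
     (\<forall>c\<in>C. finite {c'\<in>C. c' \<inter> \<phi> c ` disc (d c) \<noteq> {}}) \<and>
     (\<forall>S. S \<subseteq> topspace X \<longrightarrow>
        (closedin X S \<longleftrightarrow>
          (\<forall>c\<in>C. closedin (subtopology X (\<phi> c ` disc (d c))) (S \<inter> \<phi> c ` disc (d c)))))"

definition pointed_cw_pair :: "'a topology \<Rightarrow> 'a set \<Rightarrow> 'a \<Rightarrow> bool" where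
  "pointed_cw_pair X A a \<longleftrightarrow>
     (\<exists>C d \<phi> D. cw_structure X C d \<phi> \<and> D \<subseteq> C \<and> A = \<Union>D \<and> closedin X A \<and>
        {a} \<in> D \<and> d {a} = 0)"

definition polyhedral_product ::
  "'v set \<Rightarrow> 'v set set \<Rightarrow> ('v \<Rightarrow> 'a topology) \<Rightarrow> ('v \<Rightarrow> 'a set) \<Rightarrow> ('v \<Rightarrow> 'a) topology" where
  "polyhedral_product V K X A =
     subtopology (product_topology X V)
       (\<Union>\<sigma>\<in>K. PiE V (\<lambda>v. if v \<in> \<sigma> then topspace (X v) else A v))"

definition compact_open :: "'a topology \<Rightarrow> 'b topology \<Rightarrow> ('a \<Rightarrow> 'b) topology" where
  "compact_open X Y =
     subtopology
       (topology_generated_by {{f. f ` K \<subseteq> U} | K U. compactin X K \<and> openin Y U})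
       {f. continuous_map X Y f \<and> f \<in> extensional (topspace X)}"

abbreviation I01 :: "real topology" where
  "I01 \<equiv> top_of_set {0..1}"

definition path_space :: "'b topology \<Rightarrow> (real \<Rightarrow> 'b) topology" where
  "path_space Y = compact_open I01 Y"

definition loop_space :: "'b topology \<Rightarrow> 'b \<Rightarrow> (real \<Rightarrow> 'b) topology" where
  "loop_space Y y = subtopology (path_space Y) {\<gamma>. \<gamma> 0 = y \<and> \<gamma> 1 = y}"

definition loop_map :: "('a \<Rightarrow> 'b) \<Rightarrow> (real \<Rightarrow> 'a) \<Rightarrow> (real \<Rightarrow> 'b)" where
  "loop_map f \<gamma> = restrict (f \<circ> \<gamma>) {0..1}"

definition hofib :: "'e topology \<Rightarrow> 'b topology \<Rightarrow> ('e \<Rightarrow> 'b) \<Rightarrow> 'b \<Rightarrow> ('e \<times> (real \<Rightarrow> 'b)) topology" where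
  "hofib E B p b =
     subtopology (prod_topology E (path_space B))
       {(e, \<gamma>). e \<in> topspace E \<and> \<gamma> \<in> topspace (path_space B) \<and> \<gamma> 0 = p e \<and> \<gamma> 1 = b}"

definition hofib_base :: "'e \<Rightarrow> 'b \<Rightarrow> 'e \<times> (real \<Rightarrow> 'b)" where
  "hofib_base e0 b = (e0, restrict (\<lambda>_. b) {0..1})"

definition homotopy_equivalence_map :: "'a topology \<Rightarrow> 'b topology \<Rightarrow> ('a \<Rightarrow> 'b) \<Rightarrow> bool" where
  "homotopy_equivalence_map X Y f \<longleftrightarrow> continuous_map X Y f \<and>
     (\<exists>g. continuous_map Y X g \<and> homotopic_with (\<lambda>_. True) X X (g \<circ> f) id \<and>
          homotopic_with (\<lambda>_. True) Y Y (f \<circ> g) id)"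

definition homotopy_fibration ::
  "'f topology \<Rightarrow> 'e topology \<Rightarrow> 'b topology \<Rightarrow> 'b \<Rightarrow> ('f \<Rightarrow> 'e) \<Rightarrow> ('e \<Rightarrow> 'b) \<Rightarrow> bool" where
  "homotopy_fibration F E B b j p \<longleftrightarrow> continuous_map E B p \<and>
     (\<exists>h. homotopy_equivalence_map F (hofib E B p b) h \<and> (\<forall>x\<in>topspace F. j x = fst (h x)))"

definition quotient_topology :: "'a topology \<Rightarrow> ('a \<times> 'a) set \<Rightarrow> 'a set topology" where
  "quotient_topology X r = topology (\<lambda>U. U \<subseteq> topspace X // r \<and> openin X (\<Union>U))"

definition join_rel :: "'g topology \<Rightarrow> 'h topology \<Rightarrow> (('g \<times> 'h \<times> real) \<times> ('g \<times> 'h \<times> real)) set" where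
  "join_rel G H = {((g, h, t), (g', h', t')).
      g \<in> topspace G \<and> g' \<in> topspace G \<and> h \<in> topspace H \<and> h' \<in> topspace H \<and>
      t \<in> {0..1} \<and> t = t' \<and>
      ((t = 0 \<and> g = g') \<or> (t = 1 \<and> h = h') \<or> (g = g' \<and> h = h'))}"

definition join_space :: "'g topology \<Rightarrow> 'h topology \<Rightarrow> ('g \<times> 'h \<times> real) set topology" where
  "join_space G H = quotient_topology (prod_topology G (prod_topology H I01)) (join_rel G H)"

definition join_pt :: "'g topology \<Rightarrow> 'h topology \<Rightarrow> 'g \<Rightarrow> 'h \<Rightarrow> real \<Rightarrow> ('g \<times> 'h \<times> real) set" where
  "join_pt G H g h t = join_rel G H `` {(g, h, t)}"

end

theory Submission
  imports Defs
begin

text \<open>The obstacle is point-set. A plain product of CW complexes need not be a CW complex, and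
  the path spaces \<open>E1\<close>, \<open>E2\<close> carry no cell structure, so the inclusions of
  \<open>G\<close> and \<open>H\<close> are not handled as inclusions of subcomplexes.
  \<open>halo_deformation\<close> isolates a weak form of a cofibration that passes through every
  construction used here. Its numerical function \<open>u\<close> matters as much as its homotopy:
  maps out of a join are easy to define, maps into it are not, and \<open>u\<close> leaves a margin
  in which the map from \<open>W\<close> to the join can be glued from closed pieces on which all
  coordinates that count lie in \<open>G\<close> or \<open>H\<close>. For one CW pair the halo is
  read off from a retraction of \<open>X \<times> I\<close> onto
  \<open>X \<times> 0 \<union> A \<times> I\<close>. The weak topology is given for \<open>X\<close>
  and not for \<open>X \<times> I\<close>, so continuity is proved for the curried map from
  \<open>X\<close> into a path space. Homotopy equivalences here are unpointed, whereas loop spaces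
  need base points; hence the comparison of loops under a homotopy that moves the base
  point.\<close>

text \<open>
  With \<open>P\<close> denoting the polyhedral products, the homotopy fibre of \<open>PQ \<rightarrow> PM \<times> PK\<close> is the space
  \<open>W\<close> of pairs of paths in \<open>E1 \<times> E2\<close> whose first member starts in \<open>PN\<close> or whose second member
  starts in \<open>PL\<close>; here \<open>E1\<close>, \<open>E2\<close> are the contractible spaces of paths in \<open>PM\<close>, \<open>PK\<close> ending at
  the base point, and \<open>G \<subseteq> E1\<close>, \<open>H \<subseteq> E2\<close>. So \<open>W = E1 \<times> H \<union> G \<times> E2\<close>. The CW hypothesis enters
  only through a neighbourhood of \<open>A\<close> in \<open>X\<close> that deforms into \<open>A\<close>; this passes to polyhedral
  products and then to path spaces, and makes \<open>W\<close> homotopy equivalent to the join by explicit maps.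
  Contracting the two coordinates of a loop in \<open>PM \<times> PK\<close> one after the other stays inside \<open>W\<close>.
  This null-homotopy of the connecting map \<open>\<Omega>(PM \<times> PK) \<rightarrow> W\<close> yields both the section after looping
  and the splitting, because \<open>\<Omega>PQ\<close> is the homotopy fibre of the connecting map.
  All spaces carry their plain (not compactly generated) topologies.
\<close>

section \<open>Path spaces and the exponential law\<close>

lemma continuous_map_glue:
  assumes "continuous_map X euclideanreal p" "continuous_map X euclideanreal q"
    and "continuous_map X Y f" "continuous_map X Y g"
    and "\<And>x. \<lbrakk>x \<in> topspace X; p x = q x\<rbrakk> \<Longrightarrow> f x = g x"
  shows "continuous_map X Y (\<lambda>x. if p x \<le> q x then f x else g x)"
  by (rule continuous_map_cases_le) (use assms in \<open>auto intro: continuous_map_from_subtopology\<close>)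

lemma continuous_map_fst_comp:
  "continuous_map Z (prod_topology X Y) f \<Longrightarrow> continuous_map Z X (\<lambda>x. fst (f x))"
  by (drule continuous_map_fst_of) (simp add: o_def)

lemma continuous_map_snd_comp:
  "continuous_map Z (prod_topology X Y) f \<Longrightarrow> continuous_map Z Y (\<lambda>x. snd (f x))"
  by (drule continuous_map_snd_of) (simp add: o_def)

lemma continuous_map_comp:
  "\<lbrakk>continuous_map Y Z g; continuous_map X Y f\<rbrakk> \<Longrightarrow> continuous_map X Z (\<lambda>x. g (f x))"
  using continuous_map_compose[of X Y f Z g] by (simp add: o_def)

lemma continuous_map_I01:
  "continuous_map Z I01 f \<longleftrightarrow> continuous_map Z euclideanreal f \<and> (\<forall>z\<in>topspace Z. 0 \<le> f z \<and> f z \<le> 1)"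
  by (auto simp: continuous_map_in_subtopology Pi_iff)

lemma continuous_map_I01D:
  "continuous_map Z I01 f \<Longrightarrow> continuous_map Z euclideanreal f"
  by (simp add: continuous_map_I01)

lemma continuous_map_self: "continuous_map X X (\<lambda>x. x)"
  by (simp add: continuous_map_def)

lemma continuous_map_proj:
  "continuous_map (prod_topology A B) A (\<lambda>w. fst w)"
  "continuous_map (prod_topology A B) B (\<lambda>w. snd w)"
  "continuous_map (prod_topology (prod_topology A B) C) A (\<lambda>w. fst (fst w))"
  "continuous_map (prod_topology (prod_topology A B) C) B (\<lambda>w. snd (fst w))"
  "continuous_map (prod_topology (prod_topology (prod_topology A B) C) D) A (\<lambda>w. fst (fst (fst w)))"
  "continuous_map (prod_topology (prod_topology (prod_topology A B) C) D) B (\<lambda>w. snd (fst (fst w)))"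
  by (rule continuous_map_fst_comp continuous_map_snd_comp continuous_map_self)+

lemmas continuous_map_real_proj =
  continuous_map_proj(1)[of I01, THEN continuous_map_I01D]
  continuous_map_proj(2)[of _ I01, THEN continuous_map_I01D]
  continuous_map_proj(3)[of I01, THEN continuous_map_I01D]
  continuous_map_proj(4)[of _ I01, THEN continuous_map_I01D]
  continuous_map_proj(5)[of I01, THEN continuous_map_I01D]
  continuous_map_proj(6)[of _ I01, THEN continuous_map_I01D]

lemmas cont_real = continuous_map_proj continuous_map_real_proj
  continuous_map_real_max continuous_map_real_min continuous_map_add
  continuous_map_diff continuous_map_real_mult continuous_map_const[THEN iffD2]
  continuous_map_pairedI continuous_map_self continuous_map_fst_comp continuous_map_snd_comp

lemma continuous_map_I01_convex:
  assumes "continuous_map W I01 s" "continuous_map W I01 a" "continuous_map W I01 b"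
  shows "continuous_map W I01 (\<lambda>w. (1 - s w) * a w + s w * b w)"
  using assms unfolding continuous_map_I01
  by (intro conjI ballI cont_real) (auto intro: convex_bound_le)

lemma I01_Hausdorff: "Hausdorff_space I01"
  by (rule Hausdorff_space_subtopology[OF Hausdorff_space_euclidean])

lemma I01_locally_compact: "locally_compact_space I01"
  by (rule compact_imp_locally_compact_space) (simp add: compact_space_subtopology)

lemma topspace_path_space: "topspace (path_space Y) = {f. continuous_map I01 Y f \<and> f \<in> extensional {0..1}}"
proof -
  \<comment> \<open>The subbasic set for the empty compact set is the set of all functions, so the
    generated topology lives on the whole function type before it is cut down to paths.\<close>
  have "\<exists>K U. UNIV = {f::real \<Rightarrow> 'a. f ` K \<subseteq> U} \<and> compactin I01 K \<and> openin Y U"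
    by (rule exI[of _ "{}"], rule exI[of _ "{}"]) auto
  then have "\<Union>{{f::real \<Rightarrow> 'a. f ` K \<subseteq> U} |K U. compactin I01 K \<and> openin Y U} = UNIV"
    by blast
  then show ?thesis
    by (simp add: path_space_def compact_open_def topology_generated_by_topspace)
qed

lemma openin_path_space_subbasis:
  assumes "compactin I01 K" "openin Y U"
  shows "openin (path_space Y) {f \<in> topspace (path_space Y). f ` K \<subseteq> U}"
proof -
  have "openin (topology_generated_by {{f. f ` K \<subseteq> U} | K U. compactin I01 K \<and> openin Y U}) {f. f ` K \<subseteq> U}"
    by (rule topology_generated_by_Basis) (use assms in blast)
  then show ?thesis
    unfolding topspace_path_space
    by (auto simp: path_space_def compact_open_def openin_subtopology intro!: exI[of _ "{f. f ` K \<subseteq> U}"])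
qed

text \<open>Local compactness of the interval is the reason: a compact neighbourhood
  \<open>C\<close> of \<open>t\<close> inside the preimage of \<open>U\<close> under
  \<open>\<gamma>\<close> gives a subbasic neighbourhood of \<open>\<gamma>\<close> all of whose
  members send \<open>C\<close> into \<open>U\<close>.\<close>

lemma continuous_map_path_eval:
  "continuous_map (prod_topology (path_space Y) I01) Y (\<lambda>w. (fst w) (snd w))"
  unfolding continuous_map_def
proof (intro conjI allI impI)
  show "(\<lambda>w. fst w (snd w)) \<in> topspace (prod_topology (path_space Y) I01) \<rightarrow> topspace Y"
    by (auto simp: topspace_path_space continuous_map_def Pi_iff)
  fix U assume U: "openin Y U"
  show "openin (prod_topology (path_space Y) I01) {w \<in> topspace (prod_topology (path_space Y) I01). fst w (snd w) \<in> U}"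
  proof (subst openin_subopen, safe)
    fix \<gamma> t assume w: "(\<gamma>, t) \<in> topspace (prod_topology (path_space Y) I01)" "fst (\<gamma>, t) (snd (\<gamma>, t)) \<in> U"
    then have \<gamma>: "continuous_map I01 Y \<gamma>" and t: "t \<in> {0..1}" by (auto simp: topspace_path_space)
    let ?V = "{s \<in> topspace I01. \<gamma> s \<in> U}"
    have V: "openin I01 ?V" using \<gamma> U by (simp add: continuous_map_def)
    have "neighbourhood_base_of (compactin I01) I01"
      using locally_compact_space_neighbourhood_base[of I01] I01_Hausdorff I01_locally_compact by simp
    then have nb: "neighbourhood_base_at t (compactin I01) I01"
      using t by (simp add: neighbourhood_base_of_def)
    have tV: "t \<in> ?V" using t w by simp
    obtain W C where WC: "openin I01 W" "compactin I01 C" "t \<in> W" "W \<subseteq> C" "C \<subseteq> ?V"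
      using nb[unfolded neighbourhood_base_at_def, rule_format, OF conjI[OF V tV]] by (elim exE conjE)
    have "\<gamma> ` C \<subseteq> U" using WC(5) by blast
    let ?S = "{f \<in> topspace (path_space Y). f ` C \<subseteq> U}"
    have "openin (prod_topology (path_space Y) I01) (?S \<times> W)"
      using openin_path_space_subbasis[OF WC(2) U] WC(1) by (simp add: openin_prod_Times_iff)
    moreover have "(\<gamma>, t) \<in> ?S \<times> W" using WC(3) w \<open>\<gamma> ` C \<subseteq> U\<close> by simp
    moreover have "?S \<times> W \<subseteq> {w \<in> topspace (prod_topology (path_space Y) I01). fst w (snd w) \<in> U}"
    proof (clarify, intro CollectI conjI)
      fix f s assume f: "f \<in> topspace (path_space Y)" "f ` C \<subseteq> U" and s: "s \<in> W"
      then show "(f, s) \<in> topspace (prod_topology (path_space Y) I01)"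
        using openin_subset[OF WC(1)] by auto
      show "fst (f, s) (snd (f, s)) \<in> U" using f s WC(4) by (simp add: image_subset_iff subset_iff)
    qed
    ultimately show "\<exists>T. openin (prod_topology (path_space Y) I01) T \<and> (\<gamma>, t) \<in> T \<and>
        T \<subseteq> {w \<in> topspace (prod_topology (path_space Y) I01). fst w (snd w) \<in> U}"
      by (intro exI[of _ "?S \<times> W"] conjI)
  qed
qed

text \<open>By the tube lemma along a compact \<open>K\<close>, this holds for every space
  \<open>Z\<close>. Together with \<open>continuous_map_path_app\<close> it reduces the continuity
  of path-valued constructions to that of ordinary maps on \<open>Z \<times> I\<close>.\<close>

lemma continuous_map_path_curry:
  assumes F: "continuous_map (prod_topology Z I01) Y (\<lambda>w. F (fst w) (snd w))"
  shows "continuous_map Z (path_space Y) (\<lambda>z. restrict (F z) {0..1})"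
proof -
  have slice: "continuous_map I01 Y (restrict (F z) {0..1})" if "z \<in> topspace Z" for z
  proof -
    have "continuous_map I01 (prod_topology Z I01) (\<lambda>t. (z, t))"
      using that by (intro cont_real) auto
    from continuous_map_comp[OF F this] show ?thesis by simp
  qed
  show ?thesis
    unfolding path_space_def compact_open_def continuous_map_in_subtopology
  proof (intro conjI continuous_on_generated_topo)
    fix S assume "S \<in> {{f::real \<Rightarrow> 'b. f ` K \<subseteq> U} |K U. compactin I01 K \<and> openin Y U}"
    then obtain K U where S: "S = {f. f ` K \<subseteq> U}" and K: "compactin I01 K" and U: "openin Y U" by blast
    have K01: "K \<subseteq> {0..1}" using compactin_subset_topspace[OF K] by simp
    define W where "W = {w \<in> topspace (prod_topology Z I01). F (fst w) (snd w) \<in> U}"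
    have W: "openin (prod_topology Z I01) W" unfolding W_def
      using F U by (simp add: continuous_map_def)
    show "openin Z ((\<lambda>z. restrict (F z) {0..1}) -` S \<inter> topspace Z)"
    proof (subst openin_subopen, safe)
      fix z assume z: "z \<in> topspace Z" "restrict (F z) {0..1} \<in> S"
      have "F z b \<in> U" if "b \<in> K" for b
      proof -
        have "restrict (F z) {0..1} b \<in> U" using z(2) that unfolding S by blast
        then show ?thesis using that K01 by auto
      qed
      then have zK: "{z} \<times> K \<subseteq> W" unfolding W_def using K01 z(1) by auto
      obtain A B where AB: "openin Z A" "z \<in> A" "K \<subseteq> B" "A \<times> B \<subseteq> W"
        using tube_lemma_right[OF W K z(1) zK] by metis
      have "A \<subseteq> (\<lambda>z. restrict (F z) {0..1}) -` S \<inter> topspace Z"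
      proof
        fix x assume x: "x \<in> A"
        have "F x b \<in> U" if "b \<in> K" for b
          using subsetD[OF AB(4), of "(x, b)"] AB(3) x that by (auto simp: W_def)
        then show "x \<in> (\<lambda>z. restrict (F z) {0..1}) -` S \<inter> topspace Z"
          using x openin_subset[OF AB(1)] K01 unfolding S by (auto simp: subset_iff)
      qed
      then show "\<exists>T. openin Z T \<and> z \<in> T \<and> T \<subseteq> (\<lambda>z. restrict (F z) {0..1}) -` S \<inter> topspace Z"
        using AB by (intro exI[of _ A] conjI)
    qed
  next
    have "UNIV \<in> {{f::real \<Rightarrow> 'b. f ` K \<subseteq> U} |K U. compactin I01 K \<and> openin Y U}"
      by (simp, rule exI[of _ "{}"], rule exI[of _ "{}"]) auto
    then show "(\<lambda>z. restrict (F z) {0..1}) ` topspace Z \<subseteq> \<Union> {{f. f ` K \<subseteq> U} |K U. compactin I01 K \<and> openin Y U}"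
      by blast
  next
    show "(\<lambda>z. restrict (F z) {0..1}) \<in> topspace Z \<rightarrow> {f. continuous_map I01 Y f \<and> f \<in> extensional (topspace I01)}"
      using slice by auto
  qed
qed

lemma continuous_map_path_app:
  assumes "continuous_map W (path_space Y) \<gamma>" "continuous_map W I01 \<tau>"
  shows "continuous_map W Y (\<lambda>w. \<gamma> w (\<tau> w))"
  using continuous_map_comp[OF continuous_map_path_eval continuous_map_pairedI[OF assms]] by simp

lemma path_space_fun_eq:
  assumes "\<gamma> \<in> extensional {0..1}" "\<delta> \<in> extensional {0..1}" "\<And>t. 0 \<le> t \<Longrightarrow> t \<le> 1 \<Longrightarrow> \<gamma> t = \<delta> t"
  shows "\<gamma> = (\<delta> :: real \<Rightarrow> 'b)"
  using assms by (auto intro: extensionalityI)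

lemma path_space_app_in: "\<lbrakk>\<gamma> \<in> topspace (path_space Y); 0 \<le> t; t \<le> 1\<rbrakk> \<Longrightarrow> \<gamma> t \<in> topspace Y"
  by (auto simp: topspace_path_space continuous_map_def Pi_iff)

lemma path_space_extensional: "\<gamma> \<in> topspace (path_space Y) \<Longrightarrow> \<gamma> \<in> extensional {0..1}"
  by (simp add: topspace_path_space)

lemma homotopic_withI:
  assumes "continuous_map (prod_topology I01 X) Y (\<lambda>w. h (fst w) (snd w))"
    and "\<And>x. x \<in> topspace X \<Longrightarrow> h 0 x = f x" "\<And>x. x \<in> topspace X \<Longrightarrow> h 1 x = g x"
  shows "homotopic_with (\<lambda>_. True) X Y f g"
  by (subst homotopic_with, simp, rule exI[of _ "\<lambda>w. h (fst w) (snd w)"]) (use assms in auto)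

lemma homotopic_withD:
  assumes "homotopic_with (\<lambda>_. True) X Y f g"
  obtains h where "continuous_map (prod_topology I01 X) Y (\<lambda>w. h (fst w) (snd w))"
    "\<And>x. h 0 x = f x" "\<And>x. h 1 x = g x"
proof -
  from assms obtain h where h: "continuous_map (prod_topology I01 X) Y h" "\<forall>x. h (0, x) = f x" "\<forall>x. h (1, x) = g x"
    by (auto simp: homotopic_with_def)
  show ?thesis by (rule that[of "\<lambda>s x. h (s, x)"]) (use h in auto)
qed

section \<open>Concatenation of paths\<close>

lemma continuous_map_from_path_curry:
  assumes "continuous_map (prod_topology Z I01) Y (\<lambda>w. F (fst w) (snd w))"
    and "\<And>z. z \<in> topspace Z \<Longrightarrow> restrict (F z) {0..1} \<in> S"
  shows "continuous_map Z (subtopology (path_space Y) S) (\<lambda>z. restrict (F z) {0..1})"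
  using continuous_map_path_curry[OF assms(1)] assms(2) by (auto simp: continuous_map_in_subtopology)

text \<open>Homotopies of path-valued maps can thus be written as functions of three parameters. The
  end conditions of the path space are packed into \<open>S\<close>, and extensionality of paths
  reduces the two boundary equations to the unit interval.\<close>

lemma homotopic_with_pathI:
  assumes P: "P = subtopology (path_space Y) S"
    and "continuous_map (prod_topology (prod_topology I01 Z) I01) Y (\<lambda>w. h (fst (fst w)) (snd (fst w)) (snd w))"
    and "\<And>z s. \<lbrakk>z \<in> topspace Z; 0 \<le> s; s \<le> 1\<rbrakk> \<Longrightarrow> restrict (h s z) {0..1} \<in> S"
    and "\<And>z. z \<in> topspace Z \<Longrightarrow> f z \<in> extensional {0..1}"
    and "\<And>z. z \<in> topspace Z \<Longrightarrow> g z \<in> extensional {0..1}"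
    and "\<And>z t. \<lbrakk>z \<in> topspace Z; 0 \<le> t; t \<le> 1\<rbrakk> \<Longrightarrow> h 0 z t = f z t"
    and "\<And>z t. \<lbrakk>z \<in> topspace Z; 0 \<le> t; t \<le> 1\<rbrakk> \<Longrightarrow> h 1 z t = g z t"
  shows "homotopic_with (\<lambda>_. True) Z P f g"
  unfolding P
proof (rule homotopic_withI[where h="\<lambda>s z. restrict (h s z) {0..1}"])
  show "continuous_map (prod_topology I01 Z) (subtopology (path_space Y) S) (\<lambda>w. restrict (h (fst w) (snd w)) {0..1})"
    using assms(2,3) by (intro continuous_map_from_path_curry) auto
qed (use assms(4-7) in \<open>auto intro!: path_space_fun_eq\<close>)

text \<open>The clamps alter no value on the branch where they stand; they make each branch
  continuous on the whole interval, as \<open>continuous_map_glue\<close> demands.\<close>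

definition path_cat :: "(real \<Rightarrow> 'a) \<Rightarrow> (real \<Rightarrow> 'a) \<Rightarrow> real \<Rightarrow> 'a" where
  "path_cat \<gamma> \<delta> = restrict (\<lambda>t. if t \<le> 1/2 then \<gamma> (min 1 (2 * t)) else \<delta> (max 0 (2 * t - 1))) {0..1}"

definition path_rev :: "(real \<Rightarrow> 'a) \<Rightarrow> real \<Rightarrow> 'a" where
  "path_rev \<gamma> = restrict (\<lambda>t. \<gamma> (1 - t)) {0..1}"

lemma path_cat_ends [simp]: "path_cat \<gamma> \<delta> 0 = \<gamma> 0" "path_cat \<gamma> \<delta> 1 = \<delta> 1"
  by (auto simp: path_cat_def)

lemma path_rev_ends [simp]: "path_rev \<gamma> 0 = \<gamma> 1" "path_rev \<gamma> 1 = \<gamma> 0"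
  by (auto simp: path_rev_def)

lemma path_rev_rev: "\<gamma> \<in> extensional {0..1} \<Longrightarrow> path_rev (path_rev \<gamma>) = \<gamma>"
  by (auto simp: path_rev_def intro!: path_space_fun_eq)

lemma path_extensional [simp]: "path_cat \<gamma> \<delta> \<in> extensional {0..1}" "path_rev \<gamma> \<in> extensional {0..1}"
  by (auto simp: path_cat_def path_rev_def)

lemma continuous_map_path_cat:
  assumes "continuous_map Z (path_space Y) f" "continuous_map Z (path_space Y) g"
    and "\<And>z. z \<in> topspace Z \<Longrightarrow> f z 1 = g z 0"
  shows "continuous_map Z (path_space Y) (\<lambda>z. path_cat (f z) (g z))"
  unfolding path_cat_def
proof (rule continuous_map_path_curry, rule continuous_map_glue)
  show "continuous_map (prod_topology Z I01) Y (\<lambda>w. f (fst w) (min 1 (2 * snd w)))"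
    by (rule continuous_map_path_app[OF continuous_map_comp[OF assms(1) continuous_map_fst]],
        subst continuous_map_I01, intro conjI cont_real) auto
  show "continuous_map (prod_topology Z I01) Y (\<lambda>w. g (fst w) (max 0 (2 * snd w - 1)))"
    by (rule continuous_map_path_app[OF continuous_map_comp[OF assms(2) continuous_map_fst]],
        subst continuous_map_I01, intro conjI cont_real) auto
qed (auto intro!: cont_real assms(3))

lemma continuous_map_path_rev:
  assumes "continuous_map Z (path_space Y) f"
  shows "continuous_map Z (path_space Y) (\<lambda>z. path_rev (f z))"
  unfolding path_rev_def
  by (rule continuous_map_path_curry,
      rule continuous_map_path_app[OF continuous_map_comp[OF assms(1) continuous_map_fst]],
      subst continuous_map_I01, intro conjI cont_real) auto

text \<open>Retract the spur along \<open>n\<close>, then reparametrise. Both paths vary with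
  \<open>z\<close>, so that the lemma serves a fixed connecting path as well as the family of paths
  given by a null-homotopy. Only the ends of \<open>\<psi> z\<close> decide membership in
  \<open>S\<close>, and they never move.\<close>

lemma homotopic_path_cancel:
  assumes P: "P = subtopology (path_space Y) S"
    and n: "continuous_map Z (path_space Y) n" and \<psi>: "continuous_map Z (path_space Y) \<psi>"
    and start: "\<And>z. z \<in> topspace Z \<Longrightarrow> n z 0 = \<psi> z 0"
    and S: "\<And>z \<gamma>. \<lbrakk>z \<in> topspace Z; \<gamma> 0 = \<psi> z 0; \<gamma> 1 = \<psi> z 1\<rbrakk> \<Longrightarrow> \<gamma> \<in> S"
  shows "homotopic_with (\<lambda>_. True) Z P
      (\<lambda>z. path_cat (n z) (path_cat (path_rev (n z)) (\<psi> z))) \<psi>"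
proof -
  let ?W = "prod_topology (prod_topology I01 Z) I01"
  have n': "continuous_map ?W (path_space Y) (\<lambda>w. n (snd (fst w)))"
    by (rule continuous_map_comp[OF n], intro cont_real)
  have \<psi>': "continuous_map ?W (path_space Y) (\<lambda>w. \<psi> (snd (fst w)))"
    by (rule continuous_map_comp[OF \<psi>], intro cont_real)
  have \<psi>E: "\<psi> z \<in> extensional {0..1}" if "z \<in> topspace Z" for z
    using \<psi> that by (auto simp: continuous_map_def topspace_path_space)
  \<comment> \<open>On \<open>[0, 3/4]\<close> the minimum of \<open>2*t\<close> and
    \<open>3 - 4*t\<close> is a tent with peak 1 at \<open>1/2\<close>: out along \<open>n\<close>
    and back, at the speeds of the nested concatenation. Capping the tent at \<open>1 - s\<close>
    shortens the spur to its starting point.\<close>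
  define h1 where "h1 s z t = (if t \<le> 3/4 then n z (max 0 (min (min (2*t) (3 - 4*t)) (1 - s)))
      else \<psi> z (max 0 (4*t - 3)))" for s t :: real and z
  have "homotopic_with (\<lambda>_. True) Z P
      (\<lambda>z. path_cat (n z) (path_cat (path_rev (n z)) (\<psi> z))) (\<lambda>z. restrict (h1 1 z) {0..1})"
  proof (rule homotopic_with_pathI[OF P, where h=h1])
    show "continuous_map ?W Y (\<lambda>w. h1 (fst (fst w)) (snd (fst w)) (snd w))"
      unfolding h1_def
    proof (rule continuous_map_glue)
      show "continuous_map ?W Y (\<lambda>w. n (snd (fst w)) (max 0 (min (min (2 * snd w) (3 - 4 * snd w)) (1 - fst (fst w)))))"
        by (rule continuous_map_path_app[OF n'], subst continuous_map_I01, intro conjI cont_real) auto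
      show "continuous_map ?W Y (\<lambda>w. \<psi> (snd (fst w)) (max 0 (4 * snd w - 3)))"
        by (rule continuous_map_path_app[OF \<psi>'], subst continuous_map_I01, intro conjI cont_real) auto
    qed (auto intro!: cont_real simp: start)
    show "restrict (h1 s z) {0..1} \<in> S" if "z \<in> topspace Z" "0 \<le> s" "s \<le> 1" for z s
      by (rule S[OF that(1)]) (use that in \<open>auto simp: h1_def start\<close>)
    show "h1 0 z t = path_cat (n z) (path_cat (path_rev (n z)) (\<psi> z)) t" if "z \<in> topspace Z" "0 \<le> t" "t \<le> 1" for z t
    proof -
      consider "t \<le> 1/2" | "1/2 < t" "t \<le> 3/4" | "3/4 < t" by linarith
      then show ?thesis
      proof cases
        case 1
        then have "max 0 (min (min (2*t) (3 - 4*t)) 1) = 2*t" "min 1 (2*t) = 2*t" using that by auto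
        then show ?thesis using 1 that by (simp add: h1_def path_cat_def)
      next
        case 2
        then have "max 0 (min (min (2*t) (3 - 4*t)) 1) = 3 - 4*t" "max 0 (2*t - 1) = 2*t - 1"
          "min 1 (2 * (2*t - 1)) = 4*t - 2" by auto
        then show ?thesis using 2 that by (simp add: h1_def path_cat_def path_rev_def)
      next
        case 3
        then have "max 0 (2*t - 1) = 2*t - 1" "max 0 (2*(2*t - 1) - 1) = 4*t - 3" by auto
        then show ?thesis using 3 that by (simp add: h1_def path_cat_def)
      qed
    qed
  qed auto
  \<comment> \<open>The remaining path waits at the start of \<open>\<psi>\<close> until
    \<open>3/4\<close>; its parameter is moved linearly to the identity.\<close>
  moreover have "homotopic_with (\<lambda>_. True) Z P (\<lambda>z. restrict (h1 1 z) {0..1}) \<psi>"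
  proof (rule homotopic_with_pathI[OF P, where h="\<lambda>s z t. \<psi> z ((1 - s) * max 0 (4*t - 3) + s * t)"])
    show "continuous_map ?W Y (\<lambda>w. \<psi> (snd (fst w)) ((1 - fst (fst w)) * max 0 (4 * snd w - 3) + fst (fst w) * snd w))"
    proof (rule continuous_map_path_app[OF \<psi>'], subst continuous_map_I01, intro conjI cont_real ballI)
      fix w assume "w \<in> topspace ?W"
      then have w: "0 \<le> fst (fst w)" "fst (fst w) \<le> 1" "0 \<le> snd w" "snd w \<le> 1" by auto
      then show "0 \<le> (1 - fst (fst w)) * max 0 (4 * snd w - 3) + fst (fst w) * snd w" by auto
      show "(1 - fst (fst w)) * max 0 (4 * snd w - 3) + fst (fst w) * snd w \<le> 1"
        by (rule convex_bound_le) (use w in auto)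
    qed auto
    show "restrict (\<lambda>t. \<psi> z ((1 - s) * max 0 (4*t - 3) + s * t)) {0..1} \<in> S" if "z \<in> topspace Z" "0 \<le> s" "s \<le> 1" for z s
      by (rule S[OF that(1)]) auto
    show "(\<lambda>z. \<psi> z ((1 - 0) * max 0 (4 * t - 3) + 0 * t)) z = restrict (h1 1 z) {0..1} t" if "z \<in> topspace Z" "0 \<le> t" "t \<le> 1" for z t
    proof -
      have "max 0 (4*t - 3) = 0" if "t \<le> 3/4" using that by auto
      then show ?thesis using that start by (auto simp: h1_def)
    qed
  qed (auto simp: \<psi>E)
  ultimately show ?thesis by (rule homotopic_with_trans)
qed

section \<open>Loop spaces under homotopy equivalences\<close>

lemma homotopy_equivalence_mapI:
  assumes "continuous_map X Y f" "continuous_map Y X g"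
    "homotopic_with (\<lambda>_. True) X X (\<lambda>x. g (f x)) (\<lambda>x. x)" "homotopic_with (\<lambda>_. True) Y Y (\<lambda>y. f (g y)) (\<lambda>y. y)"
  shows "homotopy_equivalence_map X Y f"
  using assms unfolding homotopy_equivalence_map_def by (auto simp: o_def id_def)

section \<open>Composition and inverses of homotopy equivalences\<close>

lemma homotopic_comp_left:
  "\<lbrakk>homotopic_with (\<lambda>_. True) X Y f g; continuous_map Y Z h\<rbrakk>
    \<Longrightarrow> homotopic_with (\<lambda>_. True) X Z (h \<circ> f) (h \<circ> g)"
  by (rule homotopic_with_compose_continuous_map_left) auto

lemma homotopic_comp_right:
  "\<lbrakk>homotopic_with (\<lambda>_. True) Y Z f g; continuous_map X Y h\<rbrakk>
    \<Longrightarrow> homotopic_with (\<lambda>_. True) X Z (f \<circ> h) (g \<circ> h)"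
  by (rule homotopic_with_compose_continuous_map_right) auto

lemma homotopy_equivalence_map_comp:
  assumes "homotopy_equivalence_map X Y f" "homotopy_equivalence_map Y Z g"
  shows "homotopy_equivalence_map X Z (g \<circ> f)"
proof -
  obtain f' where f: "continuous_map X Y f" "continuous_map Y X f'"
    "homotopic_with (\<lambda>_. True) X X (f' \<circ> f) id" "homotopic_with (\<lambda>_. True) Y Y (f \<circ> f') id"
    using assms(1) unfolding homotopy_equivalence_map_def by blast
  obtain g' where g: "continuous_map Y Z g" "continuous_map Z Y g'"
    "homotopic_with (\<lambda>_. True) Y Y (g' \<circ> g) id" "homotopic_with (\<lambda>_. True) Z Z (g \<circ> g') id"
    using assms(2) unfolding homotopy_equivalence_map_def by blast
  have "homotopic_with (\<lambda>_. True) X X (f' \<circ> (g' \<circ> g) \<circ> f) (f' \<circ> id \<circ> f)"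
    by (rule homotopic_comp_right[OF homotopic_comp_left[OF g(3) f(2)] f(1)])
  then have 1: "homotopic_with (\<lambda>_. True) X X (f' \<circ> g' \<circ> (g \<circ> f)) id"
    using homotopic_with_trans[OF _ f(3)] by (simp add: o_assoc)
  have "homotopic_with (\<lambda>_. True) Z Z (g \<circ> (f \<circ> f') \<circ> g') (g \<circ> id \<circ> g')"
    by (rule homotopic_comp_right[OF homotopic_comp_left[OF f(4) g(1)] g(2)])
  then have 2: "homotopic_with (\<lambda>_. True) Z Z (g \<circ> f \<circ> (f' \<circ> g')) id"
    using homotopic_with_trans[OF _ g(4)] by (simp add: o_assoc)
  show ?thesis unfolding homotopy_equivalence_map_def
    using f g 1 2 by (blast intro: continuous_map_compose)
qed

text \<open>The one-sided inverses agree up to homotopy: \<open>a\<close> is homotopic to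
  \<open>a \<circ> f \<circ> b\<close>, and that to \<open>b\<close>.\<close>

lemma homotopy_equivalence_map_left_right:
  assumes f: "continuous_map X Y f" and a: "continuous_map Y X a" and b: "continuous_map Y X b"
    and af: "homotopic_with (\<lambda>_. True) X X (a \<circ> f) id" and fb: "homotopic_with (\<lambda>_. True) Y Y (f \<circ> b) id"
  shows "homotopy_equivalence_map X Y f"
proof -
  have "homotopic_with (\<lambda>_. True) Y X (a \<circ> f \<circ> b) (id \<circ> b)"
    by (rule homotopic_comp_right[OF af b])
  moreover have "homotopic_with (\<lambda>_. True) Y X (a \<circ> (f \<circ> b)) (a \<circ> id)"
    by (rule homotopic_comp_left[OF fb a])
  ultimately have "homotopic_with (\<lambda>_. True) Y X a b"
    by (metis comp_assoc comp_id homotopic_with_symD homotopic_with_trans id_comp)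
  then have "homotopic_with (\<lambda>_. True) Y Y (f \<circ> a) (f \<circ> b)"
    by (rule homotopic_comp_left[OF _ f])
  then have "homotopic_with (\<lambda>_. True) Y Y (f \<circ> a) id" using fb homotopic_with_trans by blast
  then show ?thesis unfolding homotopy_equivalence_map_def using f a af by blast
qed

lemma homotopy_equivalence_map_imp_space:
  "homotopy_equivalence_map X Y f \<Longrightarrow> X homotopy_equivalent_space Y"
  unfolding homotopy_equivalence_map_def homotopy_equivalent_space_def by blast

lemma topspace_loop_space:
  "topspace (loop_space Y y) = {\<gamma> \<in> topspace (path_space Y). \<gamma> 0 = y \<and> \<gamma> 1 = y}"
  by (auto simp: loop_space_def)

lemma continuous_map_loop_space:
  "continuous_map Z (loop_space Y y) f \<longleftrightarrow>
    continuous_map Z (path_space Y) f \<and> (\<forall>z\<in>topspace Z. f z 0 = y \<and> f z 1 = y)"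
  by (auto simp: loop_space_def continuous_map_in_subtopology)

lemma continuous_map_loop_map:
  assumes "continuous_map X Y f"
  shows "continuous_map (loop_space X x) (loop_space Y (f x)) (loop_map f)"
  unfolding continuous_map_loop_space
proof (intro conjI ballI)
  have "continuous_map (prod_topology (loop_space X x) I01) Y (\<lambda>w. f (fst w (snd w)))"
    by (rule continuous_map_comp[OF assms], rule continuous_map_path_app, rule continuous_map_comp[OF _ continuous_map_proj(1)])
      (auto simp: loop_space_def intro: continuous_map_from_subtopology continuous_map_self continuous_map_proj)
  then show "continuous_map (loop_space X x) (path_space Y) (loop_map f)"
    unfolding loop_map_def using continuous_map_path_curry[of "loop_space X x" Y "\<lambda>\<gamma> t. f (\<gamma> t)"]
    by (simp add: o_def)
qed (auto simp: topspace_loop_space loop_map_def)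

definition paths_between :: "'a topology \<Rightarrow> 'a \<Rightarrow> 'a \<Rightarrow> (real \<Rightarrow> 'a) topology" where
  "paths_between X x y = subtopology (path_space X) {\<gamma>. \<gamma> 0 = x \<and> \<gamma> 1 = y}"

lemma paths_between_loop: "paths_between X x x = loop_space X x"
  by (simp add: paths_between_def loop_space_def)

lemma topspace_paths_between:
  "topspace (paths_between X x y) = {\<gamma> \<in> topspace (path_space X). \<gamma> 0 = x \<and> \<gamma> 1 = y}"
  by (auto simp: paths_between_def)

lemma continuous_map_paths_between:
  "continuous_map Z (paths_between Y x y) f \<longleftrightarrow>
    continuous_map Z (path_space Y) f \<and> (\<forall>z\<in>topspace Z. f z 0 = x \<and> f z 1 = y)"
  by (auto simp: paths_between_def continuous_map_in_subtopology)

lemma continuous_map_paths_between_path: "continuous_map (paths_between Y x y) (path_space Y) (\<lambda>\<gamma>. \<gamma>)"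
  by (simp add: paths_between_def continuous_map_from_subtopology continuous_map_self)

lemma homotopy_equivalence_map_rev:
  "homotopy_equivalence_map (paths_between X x y) (paths_between X y x) path_rev"
proof (rule homotopy_equivalence_mapI)
  have *: "continuous_map (paths_between X x y) (paths_between X y x) path_rev" for x y
    unfolding continuous_map_paths_between[of _ X y x]
    by (auto intro!: continuous_map_path_rev continuous_map_paths_between_path simp: topspace_paths_between)
  show "continuous_map (paths_between X x y) (paths_between X y x) path_rev"
    "continuous_map (paths_between X y x) (paths_between X x y) path_rev" by (rule *)+
  have "homotopic_with (\<lambda>_. True) (paths_between X x y) (paths_between X x y) (\<lambda>\<gamma>. path_rev (path_rev \<gamma>)) (\<lambda>\<gamma>. \<gamma>)" for x y
    by (rule homotopic_with_equal)
      (use continuous_map_comp[OF * *] in \<open>auto simp: topspace_paths_between path_space_extensional path_rev_rev\<close>)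
  then show "homotopic_with (\<lambda>_. True) (paths_between X x y) (paths_between X x y) (\<lambda>\<gamma>. path_rev (path_rev \<gamma>)) (\<lambda>\<gamma>. \<gamma>)"
    "homotopic_with (\<lambda>_. True) (paths_between X y x) (paths_between X y x) (\<lambda>\<gamma>. path_rev (path_rev \<gamma>)) (\<lambda>\<gamma>. \<gamma>)"
    by auto
qed

lemma continuous_map_path_cat_const:
  assumes "a \<in> topspace (paths_between X x' x)"
  shows "continuous_map (paths_between X x y) (paths_between X x' y) (path_cat a)"
  unfolding continuous_map_paths_between[of _ X x' y]
  using assms by (auto intro!: continuous_map_path_cat continuous_map_paths_between_path simp: topspace_paths_between)

lemma homotopic_path_cancel_const:
  assumes a: "a \<in> topspace (paths_between X x' x)"
  shows "homotopic_with (\<lambda>_. True) (paths_between X x' y) (paths_between X x' y) (\<lambda>\<gamma>. path_cat a (path_cat (path_rev a) \<gamma>)) (\<lambda>\<gamma>. \<gamma>)"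
  by (rule homotopic_path_cancel[OF paths_between_def, where n="\<lambda>_. a"])
    (use a in \<open>auto simp: topspace_paths_between intro: continuous_map_paths_between_path\<close>)

lemma path_rev_between: "a \<in> topspace (paths_between X x' x) \<Longrightarrow> path_rev a \<in> topspace (paths_between X x x')"
  using homotopy_equivalence_map_rev[of X x' x] by (auto simp: homotopy_equivalence_map_def continuous_map_def)

lemma homotopy_equivalence_map_path_cat:
  assumes a: "a \<in> topspace (paths_between X x' x)"
  shows "homotopy_equivalence_map (paths_between X x y) (paths_between X x' y) (path_cat a)"
proof (rule homotopy_equivalence_mapI)
  show "continuous_map (paths_between X x y) (paths_between X x' y) (path_cat a)"
    by (rule continuous_map_path_cat_const[OF a])
  show "continuous_map (paths_between X x' y) (paths_between X x y) (path_cat (path_rev a))"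
    by (rule continuous_map_path_cat_const[OF path_rev_between[OF a]])
  have "path_rev (path_rev a) = a"
    using a by (intro path_rev_rev path_space_extensional[of _ X]) (simp add: topspace_paths_between)
  then show "homotopic_with (\<lambda>_. True) (paths_between X x y) (paths_between X x y) (\<lambda>\<gamma>. path_cat (path_rev a) (path_cat a \<gamma>)) (\<lambda>\<gamma>. \<gamma>)"
    using homotopic_path_cancel_const[OF path_rev_between[OF a]] by simp
qed (rule homotopic_path_cancel_const[OF a])

text \<open>This is the conjugate loop: back along \<open>\<eta>\<close>, around the given loop,
  forth along \<open>\<eta>\<close>. Writing it with left concatenations and reversals only exhibits
  it as a composite of four known equivalences. The three pieces occupy \<open>[0, 1/4]\<close>,
  \<open>[1/4, 1/2]\<close> and \<open>[1/2, 1]\<close>.\<close>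

definition loop_conj :: "(real \<Rightarrow> 'a) \<Rightarrow> (real \<Rightarrow> 'a) \<Rightarrow> real \<Rightarrow> 'a" where
  "loop_conj \<eta> = path_rev \<circ> path_cat (path_rev \<eta>) \<circ> path_rev \<circ> path_cat (path_rev \<eta>)"

lemma homotopy_equivalence_map_loop_conj:
  assumes \<eta>: "\<eta> \<in> topspace (paths_between X x' x)"
  shows "homotopy_equivalence_map (loop_space X x') (loop_space X x) (loop_conj \<eta>)"
  unfolding loop_conj_def paths_between_loop[symmetric] o_assoc[symmetric]
  by (rule homotopy_equivalence_map_comp[OF homotopy_equivalence_map_comp[OF homotopy_equivalence_map_comp]])
    (rule homotopy_equivalence_map_path_cat[OF path_rev_between[OF \<eta>]] homotopy_equivalence_map_rev)+

text \<open>A free homotopy from \<open>H 0\<close> to the identity drags the base point along the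
  path of \<open>H t x\<close>; conjugation with that path compensates for this drift.\<close>

lemma homotopic_loop_conj:
  assumes H: "continuous_map (prod_topology I01 X) X (\<lambda>w. H (fst w) (snd w))"
    and H1: "\<And>x. x \<in> topspace X \<Longrightarrow> H 1 x = x" and x: "x \<in> topspace X"
  shows "homotopic_with (\<lambda>_. True) (loop_space X x) (loop_space X x)
     (\<lambda>\<gamma>. loop_conj (restrict (\<lambda>t. H t x) {0..1}) (loop_map (H 0) \<gamma>)) (\<lambda>\<gamma>. \<gamma>)"
proof (rule homotopic_with_pathI[OF loop_space_def])
  let ?Z = "loop_space X x"
  let ?W = "prod_topology (prod_topology I01 ?Z) I01"
  \<comment> \<open>\<open>(?S t, ?T t)\<close> runs along three sides of the unit square, from
    \<open>(1,0)\<close> to \<open>(0,0)\<close> to \<open>(0,1)\<close> to \<open>(1,1)\<close>,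
    with the timing of \<open>loop_conj\<close>. It is moved linearly to the fourth side, where
    \<open>H\<close> is the identity.\<close>
  let ?S = "\<lambda>t::real. max (max (1 - 4*t) (2*t - 1)) 0"
  let ?T = "\<lambda>t::real. min 1 (max 0 (4*t - 1))"
  let ?h = "\<lambda>s \<gamma> t. H ((1 - s) * ?S t + s * 1) (\<gamma> ((1 - s) * ?T t + s * t))"
  have g: "continuous_map ?W (path_space X) (\<lambda>w. snd (fst w))"
    by (rule continuous_map_comp[OF _ continuous_map_proj(4)])
      (simp add: loop_space_def continuous_map_from_subtopology continuous_map_self)
  have S: "continuous_map ?W I01 (\<lambda>w. ?S (snd w))" and T: "continuous_map ?W I01 (\<lambda>w. ?T (snd w))"
    by (subst continuous_map_I01, intro conjI cont_real; auto)+
  have "continuous_map ?W X (\<lambda>w. H (fst ((1 - fst (fst w)) * ?S (snd w) + fst (fst w) * 1, snd (fst w) ((1 - fst (fst w)) * ?T (snd w) + fst (fst w) * snd w)))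
      (snd ((1 - fst (fst w)) * ?S (snd w) + fst (fst w) * 1, snd (fst w) ((1 - fst (fst w)) * ?T (snd w) + fst (fst w) * snd w))))"
    by (rule continuous_map_comp[OF H], intro continuous_map_pairedI continuous_map_path_app[OF g] continuous_map_I01_convex S T continuous_map_proj) auto
  then show "continuous_map ?W X (\<lambda>w. ?h (fst (fst w)) (snd (fst w)) (snd w))" by simp
  show "restrict (?h s \<gamma>) {0..1} \<in> {\<gamma>. \<gamma> 0 = x \<and> \<gamma> 1 = x}" if "\<gamma> \<in> topspace ?Z" "0 \<le> s" "s \<le> 1" for \<gamma> s
    using that x by (auto simp: H1 topspace_loop_space)
  show "?h 0 \<gamma> t = loop_conj (restrict (\<lambda>t. H t x) {0..1}) (loop_map (H 0) \<gamma>) t" if \<gamma>: "\<gamma> \<in> topspace ?Z" and t: "0 \<le> t" "t \<le> 1" for \<gamma> t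
  proof -
    consider "t < 1/4" | "t = 1/4" | "1/4 < t" "t < 1/2" | "t = 1/2" | "1/2 < t" by linarith
    then show ?thesis
    proof cases
      case 1
      then have "?S t = 1 - 4*t" "?T t = 0" by auto
      then show ?thesis using 1 t \<gamma>[unfolded topspace_loop_space]
        by (simp add: loop_conj_def path_rev_def path_cat_def max_def min_def)
    next
      case 2
      show ?thesis using \<gamma>[unfolded topspace_loop_space] unfolding 2
        by (simp add: loop_conj_def path_rev_def path_cat_def max_def min_def loop_map_def)
    next
      case 3
      then have "?S t = 0" "?T t = 4*t - 1" by auto
      then show ?thesis using 3 t \<gamma>[unfolded topspace_loop_space]
        by (simp add: loop_conj_def path_rev_def path_cat_def max_def min_def loop_map_def)
    next
      case 4
      then show ?thesis using t \<gamma>[unfolded topspace_loop_space]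
        by (simp add: loop_conj_def path_rev_def path_cat_def max_def min_def loop_map_def)
    next
      case 5
      then have "?S t = 2*t - 1" "?T t = 1" by auto
      then show ?thesis using 5 t \<gamma>[unfolded topspace_loop_space]
        by (simp add: loop_conj_def path_rev_def path_cat_def max_def min_def loop_map_def)
    qed
  qed
  show "?h 1 \<gamma> t = \<gamma> t" if "\<gamma> \<in> topspace ?Z" "0 \<le> t" "t \<le> 1" for \<gamma> t
    using that H1[OF path_space_app_in[of \<gamma> X t]] by (simp add: topspace_loop_space)
qed (auto simp: loop_conj_def topspace_loop_space path_space_extensional)

text \<open>The inverse \<open>k\<close> need not bring \<open>f x\<close> back to \<open>x\<close>.
  Up to homotopy, looping \<open>k\<close> has the left inverse
  \<open>loop_conj \<kappa> \<circ> loop_map f\<close> and the right inverse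
  \<open>loop_map f \<circ> loop_conj \<eta>\<close>, so it is an equivalence; a change of base
  point from \<open>x1\<close> to \<open>x\<close> completes the argument.\<close>

lemma loop_space_homotopy_equivalence:
  assumes f: "homotopy_equivalence_map X Y f" and x: "x \<in> topspace X"
  shows "loop_space X x homotopy_equivalent_space loop_space Y (f x)"
proof -
  obtain k where fc: "continuous_map X Y f" and kc: "continuous_map Y X k"
    and kf: "homotopic_with (\<lambda>_. True) X X (k \<circ> f) id" and fk: "homotopic_with (\<lambda>_. True) Y Y (f \<circ> k) id"
    using f unfolding homotopy_equivalence_map_def by blast
  obtain H where H: "continuous_map (prod_topology I01 X) X (\<lambda>w. H (fst w) (snd w))"
      "\<And>x. H 0 x = (k \<circ> f) x" "\<And>x. H 1 x = id x"
    by (rule homotopic_withD[OF kf], rule that)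
  obtain K where K: "continuous_map (prod_topology I01 Y) Y (\<lambda>w. K (fst w) (snd w))"
      "\<And>x. K 0 x = (f \<circ> k) x" "\<And>x. K 1 x = id x"
    by (rule homotopic_withD[OF fk], rule that)
  define y where "y = f x"
  define x1 where "x1 = k y"
  have y: "y \<in> topspace Y" and x1: "x1 \<in> topspace X"
    using fc kc x by (auto simp: y_def x1_def continuous_map_def)
  define \<eta> where "\<eta> = restrict (\<lambda>t. H t x) {0..1}"
  define \<kappa> where "\<kappa> = restrict (\<lambda>t. K t y) {0..1}"
  have slice: "(\<lambda>_. restrict (\<lambda>t. G t z) {0..1}) () \<in> topspace (path_space Z)"
    if "continuous_map (prod_topology I01 Z) Z (\<lambda>w. G (fst w) (snd w))" "z \<in> topspace Z" for G :: "real \<Rightarrow> 'z \<Rightarrow> 'z" and z Z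
  proof -
    have "continuous_map I01 (prod_topology I01 Z) (\<lambda>t. (t, z))"
      using that(2) by (intro cont_real) auto
    from continuous_map_comp[OF that(1) this] show ?thesis by (simp add: topspace_path_space)
  qed
  have \<eta>: "\<eta> \<in> topspace (paths_between X x1 x)"
    using slice[OF H(1) x] H(2,3)[of x] by (simp add: topspace_paths_between \<eta>_def x1_def y_def)
  have \<kappa>: "\<kappa> \<in> topspace (paths_between Y (f x1) y)"
    using slice[OF K(1) y] K(2,3)[of y] by (simp add: topspace_paths_between \<kappa>_def x1_def y_def)
  note cf = continuous_map_loop_map[OF fc, of x, folded y_def] continuous_map_loop_map[OF kc, of y, folded x1_def]
    continuous_map_loop_map[OF fc, of x1]
  have ce: "homotopy_equivalence_map (loop_space X x1) (loop_space X x) (loop_conj \<eta>)"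
    by (rule homotopy_equivalence_map_loop_conj[OF \<eta>])
  then obtain d where d: "continuous_map (loop_space X x) (loop_space X x1) d"
      "homotopic_with (\<lambda>_. True) (loop_space X x1) (loop_space X x1) (d \<circ> loop_conj \<eta>) id"
      and c: "continuous_map (loop_space X x1) (loop_space X x) (loop_conj \<eta>)"
    unfolding homotopy_equivalence_map_def by blast
  have ck: "continuous_map (loop_space Y (f x1)) (loop_space Y y) (loop_conj \<kappa>)"
    using homotopy_equivalence_map_loop_conj[OF \<kappa>] unfolding homotopy_equivalence_map_def by blast
  have comp: "loop_map (g \<circ> h) \<gamma> = loop_map g (loop_map h \<gamma>)" for g :: "'c \<Rightarrow> 'd" and h :: "'e \<Rightarrow> 'c" and \<gamma>
    by (auto simp: loop_map_def)
  have H0: "H 0 = k \<circ> f" "K 0 = f \<circ> k" using H(2) K(2) by (auto simp: fun_eq_iff)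
  have h1: "homotopic_with (\<lambda>_. True) (loop_space X x) (loop_space X x) (loop_conj \<eta> \<circ> loop_map k \<circ> loop_map f) id"
  proof -
    have "loop_conj \<eta> \<circ> loop_map k \<circ> loop_map f = (\<lambda>\<gamma>. loop_conj (restrict (\<lambda>t. H t x) {0..1}) (loop_map (H 0) \<gamma>))"
      by (simp add: fun_eq_iff H0 comp \<eta>_def)
    then show ?thesis using homotopic_loop_conj[OF H(1) _ x] H(3) by (simp add: id_def)
  qed
  have h2: "homotopic_with (\<lambda>_. True) (loop_space Y y) (loop_space Y y) (loop_conj \<kappa> \<circ> loop_map f \<circ> loop_map k) id"
  proof -
    have "loop_conj \<kappa> \<circ> loop_map f \<circ> loop_map k = (\<lambda>\<gamma>. loop_conj (restrict (\<lambda>t. K t y) {0..1}) (loop_map (K 0) \<gamma>))"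
      by (simp add: fun_eq_iff H0 comp \<kappa>_def)
    then show ?thesis using homotopic_loop_conj[OF K(1) _ y] K(3) by (simp add: id_def)
  qed
  have h3: "homotopic_with (\<lambda>_. True) (loop_space X x) (loop_space X x1) (loop_map k \<circ> loop_map f) d"
  proof -
    have "homotopic_with (\<lambda>_. True) (loop_space X x) (loop_space X x1)
        ((d \<circ> loop_conj \<eta>) \<circ> (loop_map k \<circ> loop_map f)) (id \<circ> (loop_map k \<circ> loop_map f))"
      by (rule homotopic_comp_right[OF d(2)]) (rule continuous_map_compose[OF cf(1,2)])
    moreover have "homotopic_with (\<lambda>_. True) (loop_space X x) (loop_space X x1)
        (d \<circ> (loop_conj \<eta> \<circ> loop_map k \<circ> loop_map f)) (d \<circ> id)"
      by (rule homotopic_comp_left[OF h1 d(1)])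
    ultimately show ?thesis
      using homotopic_with_trans[OF homotopic_with_symD] by (simp only: o_assoc id_comp comp_id)
  qed
  have "homotopy_equivalence_map (loop_space Y y) (loop_space X x1) (loop_map k)"
  proof (rule homotopy_equivalence_map_left_right)
    show "homotopic_with (\<lambda>_. True) (loop_space Y y) (loop_space Y y) ((loop_conj \<kappa> \<circ> loop_map f) \<circ> loop_map k) id"
      by (rule h2)
    have "homotopic_with (\<lambda>_. True) (loop_space X x1) (loop_space X x1)
        (loop_map k \<circ> loop_map f \<circ> loop_conj \<eta>) (d \<circ> loop_conj \<eta>)"
      by (rule homotopic_comp_right[OF h3 c])
    then show "homotopic_with (\<lambda>_. True) (loop_space X x1) (loop_space X x1) (loop_map k \<circ> (loop_map f \<circ> loop_conj \<eta>)) id"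
      using homotopic_with_trans[OF _ d(2)] by (simp add: o_assoc)
  qed (rule cf(2) continuous_map_compose[OF cf(3) ck] continuous_map_compose[OF c cf(1)])+
  then have "loop_space Y y homotopy_equivalent_space loop_space X x"
    by (rule homotopy_eqv_trans[OF homotopy_equivalence_map_imp_space homotopy_equivalence_map_imp_space[OF ce]])
  then show ?thesis unfolding y_def by (rule homotopy_equivalent_space_sym[THEN iffD1])
qed

section \<open>Splitting the loop space of a fibration\<close>

lemma topspace_hofib:
  "x \<in> topspace (hofib E B p b) \<longleftrightarrow>
    fst x \<in> topspace E \<and> snd x \<in> topspace (path_space B) \<and> snd x 0 = p (fst x) \<and> snd x 1 = b"
  by (cases x) (auto simp: hofib_def)

lemma continuous_map_into_hofib:
  assumes "continuous_map Z E f" "continuous_map Z (path_space B) g"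
    and "\<And>z. z \<in> topspace Z \<Longrightarrow> g z 0 = p (f z) \<and> g z 1 = b"
  shows "continuous_map Z (hofib E B p b) (\<lambda>z. (f z, g z))"
  using assms unfolding hofib_def
  by (auto simp: continuous_map_in_subtopology continuous_map_paired dest: continuous_map_image_subset_topspace)

lemma continuous_map_from_hofib:
  assumes "continuous_map Z (hofib E B p b) f"
  shows "continuous_map Z E (\<lambda>z. fst (f z))" "continuous_map Z (path_space B) (\<lambda>z. snd (f z))"
proof -
  have "continuous_map Z (prod_topology E (path_space B)) f"
    using assms unfolding hofib_def by (rule continuous_map_into_fulltopology)
  then show "continuous_map Z E (\<lambda>z. fst (f z))" "continuous_map Z (path_space B) (\<lambda>z. snd (f z))"
    by (rule continuous_map_fst_comp continuous_map_snd_comp)+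
qed

lemma continuous_map_path_space_inclusion: "continuous_map (subtopology (path_space Y) S) (path_space Y) (\<lambda>\<gamma>. \<gamma>)"
  by (simp add: continuous_map_from_subtopology continuous_map_self)

text \<open>A loop \<open>\<omega>\<close> at \<open>b = p e0\<close> gives the point
  \<open>(e0, \<omega>)\<close> of the homotopy fibre; this is the connecting map, and
  \<open>N\<close> contracts it to the base point.\<close>

locale fibre_nullhomotopy =
  fixes E :: "'e topology" and B :: "'b topology" and p :: "'e \<Rightarrow> 'b" and e0 :: 'e and b :: 'b
    and N :: "(real \<Rightarrow> 'b) \<Rightarrow> real \<Rightarrow> 'e \<times> (real \<Rightarrow> 'b)"
  assumes p: "continuous_map E B p" and e0: "e0 \<in> topspace E" and p_e0: "p e0 = b"
    and N: "continuous_map (prod_topology (loop_space B b) I01) (hofib E B p b) (\<lambda>w. N (fst w) (snd w))"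
    and N0: "\<And>\<omega>. \<omega> \<in> topspace (loop_space B b) \<Longrightarrow> N \<omega> 0 = (e0, \<omega>)"
    and N1: "\<And>\<omega>. \<omega> \<in> topspace (loop_space B b) \<Longrightarrow> N \<omega> 1 = hofib_base e0 b"
begin

abbreviation "F \<equiv> hofib E B p b"
abbreviation "f0 \<equiv> hofib_base e0 b"

lemma N_in:
  assumes "\<omega> \<in> topspace (loop_space B b)" "0 \<le> t" "t \<le> 1"
  shows "N \<omega> t \<in> topspace F"
proof -
  have "(\<omega>, t) \<in> topspace (prod_topology (loop_space B b) I01)" using assms by auto
  from funcset_mem[OF N[unfolded continuous_map_def, THEN conjunct1] this] show ?thesis by simp
qed

definition loop_section where "loop_section \<omega> = restrict (\<lambda>t. fst (N \<omega> t)) {0..1}"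

lemma continuous_map_loop_section: "continuous_map (loop_space B b) (loop_space E e0) loop_section"
  unfolding continuous_map_loop_space
proof
  show "continuous_map (loop_space B b) (path_space E) loop_section"
    unfolding loop_section_def by (rule continuous_map_path_curry, rule continuous_map_from_hofib[OF N])
qed (simp add: loop_section_def N0 N1 hofib_base_def)

text \<open>Consider \<open>snd (N \<omega> x) y\<close> on the unit square. The edge
  \<open>y = 0\<close> is the projected section, the edge \<open>x = 0\<close> is
  \<open>\<omega>\<close>, and the other two edges are constant at \<open>b\<close>. Hence the two
  nonconstant edges are homotopic loops.\<close>

lemma homotopic_loop_section:
  "homotopic_with (\<lambda>_. True) (loop_space B b) (loop_space B b) (loop_map p \<circ> loop_section) id"
proof -
  let ?W = "prod_topology (prod_topology I01 (loop_space B b)) I01"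
  \<comment> \<open>Straight segments from the corner \<open>(0,0)\<close>, whose far end travels
    from \<open>(1,0)\<close> through \<open>(1,1)\<close> to \<open>(0,1)\<close> and so stays on
    the two edges that are constant at \<open>b\<close>.\<close>
  let ?x = "\<lambda>s t::real. min 1 (2 * (1 - s)) * t" and ?y = "\<lambda>s t::real. min 1 (2 * s) * t"
  have unit: "0 \<le> c * t \<and> c * t \<le> 1" if "0 \<le> c" "c \<le> 1" "0 \<le> t" "t \<le> 1" for c t :: real
    using that by (simp add: mult_le_one)
  have x: "continuous_map ?W I01 (\<lambda>w. ?x (fst (fst w)) (snd w))"
    unfolding continuous_map_I01 by (intro conjI cont_real ballI unit[THEN conjunct1] unit[THEN conjunct2]) auto
  have y: "continuous_map ?W I01 (\<lambda>w. ?y (fst (fst w)) (snd w))"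
    unfolding continuous_map_I01 by (intro conjI cont_real ballI unit[THEN conjunct1] unit[THEN conjunct2]) auto
  have Nc: "continuous_map ?W F (\<lambda>w. N (snd (fst w)) (?x (fst (fst w)) (snd w)))"
    using continuous_map_comp[OF N continuous_map_pairedI[OF continuous_map_proj(4) x]] by simp
  have c: "continuous_map ?W B (\<lambda>w. snd (N (snd (fst w)) (?x (fst (fst w)) (snd w))) (?y (fst (fst w)) (snd w)))"
    by (rule continuous_map_path_app[OF continuous_map_from_hofib(2)[OF Nc] y])
  have ends: "snd (N \<omega> s) 0 = p (fst (N \<omega> s))" "snd (N \<omega> s) 1 = b"
    if "\<omega> \<in> topspace (loop_space B b)" "0 \<le> s" "s \<le> 1" for \<omega> s
    using N_in[OF that] by (simp_all add: topspace_hofib)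
  show ?thesis
  proof (rule homotopic_with_pathI[OF loop_space_def, where h="\<lambda>s \<omega> t. snd (N \<omega> (?x s t)) (?y s t)"])
    show "continuous_map ?W B (\<lambda>w. snd (N (snd (fst w)) (?x (fst (fst w)) (snd w))) (?y (fst (fst w)) (snd w)))"
      by (rule c)
    show "restrict (\<lambda>t. snd (N \<omega> (?x s t)) (?y s t)) {0..1} \<in> {\<gamma>. \<gamma> 0 = b \<and> \<gamma> 1 = b}"
      if \<omega>: "\<omega> \<in> topspace (loop_space B b)" and s: "0 \<le> s" "s \<le> 1" for \<omega> s
    proof -
      have "snd (N \<omega> 0) 0 = b" using \<omega> by (simp add: N0 topspace_loop_space)
      moreover have "snd (N \<omega> (min 1 (2 * (1 - s)))) (min 1 (2 * s)) = b"
      proof (cases "s \<le> 1/2")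
        case True
        then have "min 1 (2 * (1 - s)) = 1" by auto
        then show ?thesis using \<omega> s True by (simp add: N1 hofib_base_def)
      next
        case False
        then have "min 1 (2 * s) = 1" by auto
        then show ?thesis using ends(2)[OF \<omega>] s by simp
      qed
      ultimately show ?thesis by simp
    qed
    show "snd (N \<omega> (?x 0 t)) (?y 0 t) = (loop_map p \<circ> loop_section) \<omega> t"
      if "\<omega> \<in> topspace (loop_space B b)" "0 \<le> t" "t \<le> 1" for \<omega> t
      using that ends(1) by (simp add: loop_map_def loop_section_def)
    show "snd (N \<omega> (?x 1 t)) (?y 1 t) = id \<omega> t"
      if "\<omega> \<in> topspace (loop_space B b)" "0 \<le> t" "t \<le> 1" for \<omega> t
      using that N0 by simp
  qed (auto simp: loop_map_def topspace_loop_space path_space_extensional)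
qed

text \<open>Paths in the fibre from some \<open>(e0, \<omega>)\<close> to the base point: the homotopy fibre of the
  connecting map from loops on the base into the fibre.\<close>
definition "connecting_fibre = subtopology (path_space F) {\<psi>. fst (\<psi> 0) = e0 \<and> \<psi> 1 = f0}"

lemma topspace_connecting_fibre:
  "\<psi> \<in> topspace connecting_fibre \<longleftrightarrow> \<psi> \<in> topspace (path_space F) \<and> fst (\<psi> 0) = e0 \<and> \<psi> 1 = f0"
  by (simp add: connecting_fibre_def)

lemma connecting_fibre_in:
  assumes "\<psi> \<in> topspace connecting_fibre" "0 \<le> s" "s \<le> 1"
  shows "\<psi> s \<in> topspace F" "snd (\<psi> s) 0 = p (fst (\<psi> s))" "snd (\<psi> s) 1 = b" "snd (\<psi> s) \<in> extensional {0..1}"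
proof -
  show "\<psi> s \<in> topspace F"
    by (rule path_space_app_in) (use assms topspace_connecting_fibre in auto)
  then show "snd (\<psi> s) 0 = p (fst (\<psi> s))" "snd (\<psi> s) 1 = b" "snd (\<psi> s) \<in> extensional {0..1}"
    by (auto simp: topspace_hofib path_space_extensional)
qed

lemma continuous_map_connecting_fibre_path: "continuous_map connecting_fibre (path_space F) (\<lambda>\<psi>. \<psi>)"
  unfolding connecting_fibre_def by (rule continuous_map_path_space_inclusion)

text \<open>The total-space coordinate of such a path is a loop at \<open>e0\<close>, and the
  base-path coordinate carries no further homotopy information, because it can be deformed to the
  tail of the projected loop.\<close>

lemma connecting_fibre_loop: "connecting_fibre homotopy_equivalent_space loop_space E e0"
proof -
  define q :: "(real \<Rightarrow> 'e \<times> (real \<Rightarrow> 'b)) \<Rightarrow> real \<Rightarrow> 'e" where "q \<psi> = restrict (\<lambda>s. fst (\<psi> s)) {0..1}" for \<psi>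
  \<comment> \<open>At time \<open>s\<close> the base path is the rest of the projected loop after
    \<open>s\<close>, padded at its end; it starts at \<open>p (\<epsilon> s)\<close> and has shrunk
    to the constant path at \<open>s = 1\<close>.\<close>
  define r :: "(real \<Rightarrow> 'e) \<Rightarrow> real \<Rightarrow> 'e \<times> (real \<Rightarrow> 'b)" where
    "r \<epsilon> = restrict (\<lambda>s. (\<epsilon> s, restrict (\<lambda>t. p (\<epsilon> (min 1 (s + t)))) {0..1})) {0..1}" for \<epsilon>
  have q: "continuous_map connecting_fibre (loop_space E e0) q"
    unfolding continuous_map_loop_space
  proof
    show "continuous_map connecting_fibre (path_space E) q"
      unfolding q_def
      by (rule continuous_map_path_curry, rule continuous_map_from_hofib, rule continuous_map_path_app,
        rule continuous_map_comp[OF continuous_map_connecting_fibre_path continuous_map_proj(1)], rule continuous_map_proj)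
  qed (simp add: q_def topspace_connecting_fibre hofib_base_def)
  have l: "continuous_map (loop_space E e0) (path_space E) (\<lambda>\<epsilon>. \<epsilon>)"
    unfolding loop_space_def by (rule continuous_map_path_space_inclusion)
  have r: "continuous_map (loop_space E e0) connecting_fibre r"
    unfolding r_def connecting_fibre_def
  proof (rule continuous_map_from_path_curry, rule continuous_map_into_hofib)
    let ?W = "prod_topology (loop_space E e0) I01"
    show "continuous_map ?W E (\<lambda>w. fst w (snd w))"
      by (rule continuous_map_path_app[OF continuous_map_comp[OF l continuous_map_proj(1)] continuous_map_proj(2)])
    show "continuous_map ?W (path_space B) (\<lambda>w. restrict (\<lambda>t. p (fst w (min 1 (snd w + t)))) {0..1})"
    proof (rule continuous_map_path_curry, rule continuous_map_comp[OF p], rule continuous_map_path_app)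
      show "continuous_map (prod_topology ?W I01) (path_space E) (\<lambda>w. fst (fst w))"
        by (rule continuous_map_comp[OF l continuous_map_proj(3)])
      show "continuous_map (prod_topology ?W I01) I01 (\<lambda>w. min 1 (snd (fst w) + snd w))"
        unfolding continuous_map_I01 by (intro conjI cont_real) auto
    qed
  qed (use p_e0 in \<open>auto simp: topspace_loop_space hofib_base_def intro!: path_space_fun_eq\<close>)
  have qr: "q (r \<epsilon>) = \<epsilon>" if "\<epsilon> \<in> topspace (loop_space E e0)" for \<epsilon>
    using that by (auto simp: q_def r_def topspace_loop_space path_space_extensional intro!: path_space_fun_eq)
  let ?W = "prod_topology (prod_topology I01 connecting_fibre) I01"
  let ?W' = "prod_topology ?W I01"
  have psi: "continuous_map ?W' B (\<lambda>w. snd (snd (fst (fst w)) (u w)) (v w))"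
    if "continuous_map ?W' I01 u" "continuous_map ?W' I01 v" for u v
    by (rule continuous_map_path_app[OF continuous_map_from_hofib(2) that(2)],
        rule continuous_map_path_app[OF _ that(1)], rule continuous_map_comp[OF continuous_map_connecting_fibre_path], rule continuous_map_proj)
  have psi1: "continuous_map ?W E (\<lambda>w. fst (snd (fst w) (snd w)))"
    by (rule continuous_map_from_hofib, rule continuous_map_path_app[OF continuous_map_comp[OF continuous_map_connecting_fibre_path]],
       rule continuous_map_proj, rule continuous_map_proj)
  \<comment> \<open>Shrinking the base paths to their starts at once would lose the end condition at
    \<open>t = 1\<close>. So \<open>h1\<close> first shears the family: at \<open>t = 1\<close> it
    always reads \<open>\<psi>\<close> at time 1, where the base path is constant, once
    \<open>\<tau> = 1\<close>. Then \<open>h2\<close> can shrink the path parameter to 0.\<close>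
  define h1 :: "real \<Rightarrow> (real \<Rightarrow> 'e \<times> (real \<Rightarrow> 'b)) \<Rightarrow> real \<Rightarrow> 'e \<times> (real \<Rightarrow> 'b)"
    where "h1 \<tau> \<psi> s = (fst (\<psi> s), restrict (\<lambda>t. snd (\<psi> (min 1 (s + \<tau> * t))) t) {0..1})" for \<tau> \<psi> s
  define h2 :: "real \<Rightarrow> (real \<Rightarrow> 'e \<times> (real \<Rightarrow> 'b)) \<Rightarrow> real \<Rightarrow> 'e \<times> (real \<Rightarrow> 'b)"
    where "h2 \<tau> \<psi> s = (fst (\<psi> s), restrict (\<lambda>t. snd (\<psi> (min 1 (s + t))) ((1 - \<tau>) * t)) {0..1})" for \<tau> \<psi> s
  have "homotopic_with (\<lambda>_. True) connecting_fibre connecting_fibre (\<lambda>\<psi>. \<psi>) (\<lambda>\<psi>. restrict (h1 1 \<psi>) {0..1})"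
  proof (rule homotopic_with_pathI[OF connecting_fibre_def, where h=h1])
    show "continuous_map ?W F (\<lambda>w. h1 (fst (fst w)) (snd (fst w)) (snd w))"
      unfolding h1_def
    proof (rule continuous_map_into_hofib[OF psi1 continuous_map_path_curry[OF psi]])
      show "continuous_map ?W' I01 (\<lambda>w. min 1 (snd (fst w) + fst (fst (fst w)) * snd w))"
        unfolding continuous_map_I01 by (intro conjI cont_real) auto
    qed (auto simp: connecting_fibre_in intro: continuous_map_proj)
    show "restrict (h1 \<tau> \<psi>) {0..1} \<in> {\<psi>. fst (\<psi> 0) = e0 \<and> \<psi> 1 = f0}"
      if "\<psi> \<in> topspace connecting_fibre" "0 \<le> \<tau>" "\<tau> \<le> 1" for \<psi> \<tau>
      using that by (auto simp: h1_def topspace_connecting_fibre hofib_base_def intro!: path_space_fun_eq)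
    show "h1 0 \<psi> s = \<psi> s" if "\<psi> \<in> topspace connecting_fibre" "0 \<le> s" "s \<le> 1" for \<psi> s
      using that connecting_fibre_in(4)[OF that] by (auto simp: h1_def prod_eq_iff intro!: path_space_fun_eq)
  qed (auto simp: topspace_connecting_fibre path_space_extensional)
  moreover have "homotopic_with (\<lambda>_. True) connecting_fibre connecting_fibre (\<lambda>\<psi>. restrict (h1 1 \<psi>) {0..1}) (\<lambda>\<psi>. r (q \<psi>))"
  proof (rule homotopic_with_pathI[OF connecting_fibre_def, where h=h2])
    show "continuous_map ?W F (\<lambda>w. h2 (fst (fst w)) (snd (fst w)) (snd w))"
      unfolding h2_def
    proof (rule continuous_map_into_hofib[OF psi1 continuous_map_path_curry[OF psi]])
      show "continuous_map ?W' I01 (\<lambda>w. min 1 (snd (fst w) + snd w))"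
        unfolding continuous_map_I01 by (intro conjI cont_real) auto
      show "continuous_map ?W' I01 (\<lambda>w. (1 - fst (fst (fst w))) * snd w)"
        unfolding continuous_map_I01 by (intro conjI cont_real) (auto simp: mult_le_one)
    qed (auto simp: connecting_fibre_in topspace_connecting_fibre hofib_base_def)
    show "restrict (h2 \<tau> \<psi>) {0..1} \<in> {\<psi>. fst (\<psi> 0) = e0 \<and> \<psi> 1 = f0}"
      if "\<psi> \<in> topspace connecting_fibre" "0 \<le> \<tau>" "\<tau> \<le> 1" for \<psi> \<tau>
      using that by (auto simp: h2_def topspace_connecting_fibre hofib_base_def mult_le_one intro!: path_space_fun_eq)
    show "h2 0 \<psi> s = restrict (h1 1 \<psi>) {0..1} s" if "\<psi> \<in> topspace connecting_fibre" "0 \<le> s" "s \<le> 1" for \<psi> s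
      using that by (simp add: h1_def h2_def)
    show "h2 1 \<psi> s = r (q \<psi>) s" if "\<psi> \<in> topspace connecting_fibre" "0 \<le> s" "s \<le> 1" for \<psi> s
      using that by (auto simp: h2_def r_def q_def connecting_fibre_in intro!: path_space_fun_eq)
  qed (auto simp: r_def)
  ultimately have "homotopic_with (\<lambda>_. True) connecting_fibre connecting_fibre (\<lambda>\<psi>. \<psi>) (\<lambda>\<psi>. r (q \<psi>))"
    by (rule homotopic_with_trans)
  then have rq: "homotopic_with (\<lambda>_. True) connecting_fibre connecting_fibre (\<lambda>\<psi>. r (q \<psi>)) (\<lambda>\<psi>. \<psi>)"
    by (rule homotopic_with_symD)
  have "homotopic_with (\<lambda>_. True) (loop_space E e0) (loop_space E e0) (\<lambda>\<epsilon>. q (r \<epsilon>)) (\<lambda>\<epsilon>. \<epsilon>)"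
    by (rule homotopic_with_equal) (auto simp: qr intro: continuous_map_comp[OF q r])
  from homotopy_equivalence_mapI[where f=q and g=r, OF q r rq this] show ?thesis
    by (rule homotopy_equivalence_map_imp_space)
qed

text \<open>The restricted path \<open>n \<omega>\<close> leads from \<open>(e0, \<omega>)\<close>
  to the base point and depends continuously on \<open>\<omega>\<close>. Its reverse turns any path
  with the same ends into a loop at \<open>f0\<close>, which trivialises the connecting fibre over
  the loops on the base.\<close>

lemma connecting_fibre_split:
  "connecting_fibre homotopy_equivalent_space prod_topology (loop_space B b) (loop_space F f0)"
proof -
  define n where "n \<omega> = restrict (N \<omega>) {0..1}" for \<omega>
  have n: "continuous_map (loop_space B b) (path_space F) n"
    unfolding n_def by (rule continuous_map_path_curry[OF N])
  have n01: "n \<omega> 0 = (e0, \<omega>)" "n \<omega> 1 = f0" if "\<omega> \<in> topspace (loop_space B b)" for \<omega>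
    using that by (simp_all add: n_def N0 N1)
  have nrr: "path_rev (path_rev (n \<omega>)) = n \<omega>" for \<omega>
    by (simp add: path_rev_rev n_def)
  define \<omega> :: "(real \<Rightarrow> 'e \<times> (real \<Rightarrow> 'b)) \<Rightarrow> real \<Rightarrow> 'b" where "\<omega> \<psi> = snd (\<psi> 0)" for \<psi>
  have \<omega>: "continuous_map connecting_fibre (loop_space B b) \<omega>"
    unfolding continuous_map_loop_space
  proof (intro conjI ballI)
    show "continuous_map connecting_fibre (path_space B) \<omega>"
      unfolding \<omega>_def by (rule continuous_map_from_hofib, rule continuous_map_path_app[OF continuous_map_connecting_fibre_path]) auto
  qed (auto simp: \<omega>_def connecting_fibre_in topspace_connecting_fibre p_e0)
  have \<omega>_in: "\<omega> \<psi> \<in> topspace (loop_space B b)" if "\<psi> \<in> topspace connecting_fibre" for \<psi>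
    using \<omega> that by (auto simp: continuous_map_def)
  have start: "\<psi> 0 = (e0, \<omega> \<psi>)" if "\<psi> \<in> topspace connecting_fibre" for \<psi>
    using that by (auto simp: \<omega>_def topspace_connecting_fibre prod_eq_iff)
  note n\<omega> = continuous_map_comp[OF n \<omega>]
  let ?P = "prod_topology (loop_space B b) (loop_space F f0)"
  define u where "u \<psi> = (\<omega> \<psi>, path_cat (path_rev (n (\<omega> \<psi>))) \<psi>)" for \<psi>
  define v where "v w = path_cat (n (fst w)) (snd w)" for w
  have l: "continuous_map (loop_space F f0) (path_space F) (\<lambda>\<epsilon>. \<epsilon>)"
    unfolding loop_space_def by (rule continuous_map_path_space_inclusion)
  note l2 = continuous_map_comp[OF l continuous_map_proj(2)[of "loop_space B b"]]
  note n2 = continuous_map_comp[OF n continuous_map_proj(1)[of _ "loop_space F f0"]]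
  have u: "continuous_map connecting_fibre ?P u"
    unfolding u_def
  proof (rule continuous_map_pairedI[OF \<omega>], subst continuous_map_loop_space, rule conjI)
    show "continuous_map connecting_fibre (path_space F) (\<lambda>\<psi>. path_cat (path_rev (n (\<omega> \<psi>))) \<psi>)"
      by (rule continuous_map_path_cat[OF continuous_map_path_rev[OF n\<omega>] continuous_map_connecting_fibre_path])
        (simp add: n01 \<omega>_in start)
  qed (auto simp: n01 \<omega>_in topspace_connecting_fibre)
  have v: "continuous_map ?P connecting_fibre v"
    unfolding connecting_fibre_def continuous_map_in_subtopology v_def
  proof
    show "continuous_map ?P (path_space F) (\<lambda>w. path_cat (n (fst w)) (snd w))"
      by (rule continuous_map_path_cat[OF n2 l2]) (auto simp: n01 topspace_loop_space)
  qed (auto simp: n01 topspace_loop_space)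
  have vu: "homotopic_with (\<lambda>_. True) connecting_fibre connecting_fibre (\<lambda>\<psi>. v (u \<psi>)) (\<lambda>\<psi>. \<psi>)"
    unfolding u_def v_def fst_conv snd_conv
    by (rule homotopic_path_cancel[OF connecting_fibre_def n\<omega> continuous_map_connecting_fibre_path])
      (auto simp: n01 \<omega>_in start topspace_connecting_fibre)
  \<comment> \<open>Cancellation is applied to the reversed paths, and \<open>nrr\<close> removes
    the double reversal. The homotopy is then extracted, since it has to be paired with the
    unchanged loop in the first factor.\<close>
  have "homotopic_with (\<lambda>_. True) ?P (loop_space F f0)
      (\<lambda>w. path_cat (path_rev (n (fst w))) (path_cat (path_rev (path_rev (n (fst w)))) (snd w))) (\<lambda>w. snd w)"
    by (rule homotopic_path_cancel[OF loop_space_def continuous_map_path_rev[OF n2] l2])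
      (auto simp: n01 topspace_loop_space)
  then obtain h where h: "continuous_map (prod_topology I01 ?P) (loop_space F f0) (\<lambda>w. h (fst w) (snd w))"
    "\<And>w. h 0 w = path_cat (path_rev (n (fst w))) (path_cat (n (fst w)) (snd w))" "\<And>w. h 1 w = snd w"
    unfolding nrr by (rule homotopic_withD) blast
  have uv: "homotopic_with (\<lambda>_. True) ?P ?P (\<lambda>w. u (v w)) (\<lambda>w. w)"
  proof (rule homotopic_withI[where h="\<lambda>s w. (fst w, h s w)"])
    show "continuous_map (prod_topology I01 ?P) ?P (\<lambda>w. (fst (snd w), h (fst w) (snd w)))"
      by (rule continuous_map_pairedI[OF continuous_map_comp[OF continuous_map_proj(1) continuous_map_proj(2)] h(1)])
  qed (auto simp: u_def v_def h \<omega>_def n01)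
  show ?thesis
    by (rule homotopy_equivalence_map_imp_space[OF homotopy_equivalence_mapI[where f=u and g=v, OF u v vu uv]])
qed

theorem loop_space_split:
  "loop_space E e0 homotopy_equivalent_space prod_topology (loop_space B b) (loop_space F f0)"
  by (rule homotopy_eqv_trans[OF connecting_fibre_loop[THEN homotopy_equivalent_space_sym[THEN iffD1]] connecting_fibre_split])

end

section \<open>Joins and pairs of contractible spaces\<close>

lemma continuous_map_comp2:
  assumes "continuous_map (prod_topology A B) Y (\<lambda>w. f (fst w) (snd w))"
    and "continuous_map Z A a" "continuous_map Z B b"
  shows "continuous_map Z Y (\<lambda>z. f (a z) (b z))"
  using continuous_map_comp[OF assms(1) continuous_map_pairedI[OF assms(2,3)]] by simp

section \<open>Quotient topologies and maps into and out of a join\<close>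

lemma openin_quotient_topology:
  assumes r: "equiv (topspace X) r"
  shows "openin (quotient_topology X r) U \<longleftrightarrow> U \<subseteq> topspace X // r \<and> openin X (\<Union>U)"
proof -
  have "istopology (\<lambda>U. U \<subseteq> topspace X // r \<and> openin X (\<Union>U))"
    unfolding istopology_def
  proof (intro conjI allI impI)
    fix S T assume S: "S \<subseteq> topspace X // r \<and> openin X (\<Union>S)" and T: "T \<subseteq> topspace X // r \<and> openin X (\<Union>T)"
    have "\<Union>(S \<inter> T) = \<Union>S \<inter> \<Union>T"
    proof
      show "\<Union>S \<inter> \<Union>T \<subseteq> \<Union>(S \<inter> T)"
      proof
        fix x assume "x \<in> \<Union>S \<inter> \<Union>T"
        then obtain c d where cd: "c \<in> S" "d \<in> T" "x \<in> c" "x \<in> d" by blast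
        then have "c = d" using quotient_disj[OF r, of c d] S T by blast
        then show "x \<in> \<Union>(S \<inter> T)" using cd by blast
      qed
    qed blast
    then show "S \<inter> T \<subseteq> topspace X // r" "openin X (\<Union>(S \<inter> T))" using S T by auto
  next
    fix K assume K: "\<forall>U\<in>K. U \<subseteq> topspace X // r \<and> openin X (\<Union>U)"
    have "\<Union>(\<Union>K) = \<Union>(Union ` K)" by blast
    moreover have "openin X (\<Union>(Union ` K))" using K by (intro openin_Union) auto
    ultimately show "\<Union>K \<subseteq> topspace X // r" "openin X (\<Union>(\<Union>K))" using K by auto
  qed
  then show ?thesis by (simp add: quotient_topology_def topology_inverse')
qed

lemma quotient_map_quotient_topology:
  assumes r: "equiv (topspace X) r"
  shows "quotient_map X (quotient_topology X r) (\<lambda>x. r `` {x})"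
proof -
  have top: "topspace (quotient_topology X r) = topspace X // r"
  proof
    show "topspace (quotient_topology X r) \<subseteq> topspace X // r"
      using openin_topspace[of "quotient_topology X r"] unfolding openin_quotient_topology[OF r] by blast
    have "openin (quotient_topology X r) (topspace X // r)"
      by (simp add: openin_quotient_topology[OF r] Union_quotient[OF r])
    then show "topspace X // r \<subseteq> topspace (quotient_topology X r)" by (rule openin_subset)
  qed
  show ?thesis
    unfolding quotient_map_def top
  proof (intro conjI allI impI)
    show "(\<lambda>x. r `` {x}) ` topspace X = topspace X // r" by (auto simp: quotient_def)
    fix U assume U: "U \<subseteq> topspace X // r"
    have "{x \<in> topspace X. r `` {x} \<in> U} = \<Union>U"
    proof safe
      fix x assume "x \<in> topspace X" "r `` {x} \<in> U"
      then show "x \<in> \<Union>U" using equiv_class_self[OF r] by blast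
    next
      fix x c assume c: "c \<in> U" "x \<in> c"
      then obtain y where y: "y \<in> topspace X" "c = r `` {y}" using U by (auto elim: quotientE)
      then have yx: "(y, x) \<in> r" using c by auto
      then show "x \<in> topspace X" using equiv_type[OF r] by blast
      have "r `` {y} = r `` {x}" by (rule equiv_class_eq[OF r yx])
      then show "r `` {x} \<in> U" using c y by simp
    qed
    then show "openin X {x \<in> topspace X. r `` {x} \<in> U} = openin (quotient_topology X r) U"
      using U by (simp add: openin_quotient_topology[OF r])
  qed
qed

lemma equiv_join_rel: "equiv (topspace (prod_topology G (prod_topology H I01))) (join_rel G H)"
proof (rule equivI)
  show "refl_on (topspace (prod_topology G (prod_topology H I01))) (join_rel G H)"
    by (auto simp: refl_on_def join_rel_def)
  show "sym (join_rel G H)" by (auto simp: sym_def join_rel_def)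
  show "trans (join_rel G H)" by (auto simp: trans_def join_rel_def)
qed (auto simp: join_rel_def)

lemma quotient_map_join:
  "quotient_map (prod_topology G (prod_topology H I01)) (join_space G H) (\<lambda>x. join_rel G H `` {x})"
  unfolding join_space_def by (rule quotient_map_quotient_topology[OF equiv_join_rel])

lemma topspace_join_space:
  "topspace (join_space G H) = {join_pt G H g h t | g h t. g \<in> topspace G \<and> h \<in> topspace H \<and> 0 \<le> t \<and> t \<le> 1}"
  unfolding quotient_imp_surjective_map[OF quotient_map_join, symmetric] join_pt_def by force

lemma join_pt_eq_iff:
  assumes "g \<in> topspace G" "h \<in> topspace H" "0 \<le> t" "t \<le> 1" "g' \<in> topspace G" "h' \<in> topspace H"
  shows "join_pt G H g h t = join_pt G H g' h' t' \<longleftrightarrow> ((g, h, t), (g', h', t')) \<in> join_rel G H"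
proof
  assume "((g, h, t), (g', h', t')) \<in> join_rel G H"
  then show "join_pt G H g h t = join_pt G H g' h' t'"
    unfolding join_pt_def by (rule equiv_class_eq[OF equiv_join_rel])
next
  assume "join_pt G H g h t = join_pt G H g' h' t'"
  moreover have "(g, h, t) \<in> join_pt G H g h t"
    unfolding join_pt_def by (rule equiv_class_self[OF equiv_join_rel]) (use assms in auto)
  ultimately have "((g', h', t'), (g, h, t)) \<in> join_rel G H" by (simp add: join_pt_def)
  then show "((g, h, t), (g', h', t')) \<in> join_rel G H" using equiv_join_rel by (meson equivE symE)
qed

lemma join_pt_0:
  "\<lbrakk>g \<in> topspace G; h \<in> topspace H; h' \<in> topspace H\<rbrakk> \<Longrightarrow> join_pt G H g h 0 = join_pt G H g h' 0"
  by (simp add: join_pt_eq_iff) (simp add: join_rel_def)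

lemma join_pt_1:
  "\<lbrakk>g \<in> topspace G; g' \<in> topspace G; h \<in> topspace H\<rbrakk> \<Longrightarrow> join_pt G H g h 1 = join_pt G H g' h 1"
  by (simp add: join_pt_eq_iff) (simp add: join_rel_def)

lemma continuous_map_join_pt:
  assumes "continuous_map Z G a" "continuous_map Z H b" "continuous_map Z I01 t"
  shows "continuous_map Z (join_space G H) (\<lambda>z. join_pt G H (a z) (b z) (t z))"
  unfolding join_pt_def
  by (rule continuous_map_comp[OF quotient_imp_continuous_map[OF quotient_map_join]], intro continuous_map_pairedI assms)

text \<open>The product of a quotient map with the identity of the locally compact Hausdorff space
  \<open>I01\<close> is again a quotient map. Hence a homotopy on a join may be given on triples,
  provided it forgets \<open>h\<close> at parameter 0 and \<open>g\<close> at parameter 1.\<close>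

lemma join_space_homotopy_lift:
  assumes F: "continuous_map (prod_topology I01 (prod_topology G (prod_topology H I01))) Y
      (\<lambda>w. F (fst w) (fst (snd w)) (fst (snd (snd w))) (snd (snd (snd w))))"
    and F0: "\<And>s g h h'. \<lbrakk>0 \<le> s; s \<le> 1; g \<in> topspace G; h \<in> topspace H; h' \<in> topspace H\<rbrakk> \<Longrightarrow> F s g h 0 = F s g h' 0"
    and F1: "\<And>s g g' h. \<lbrakk>0 \<le> s; s \<le> 1; g \<in> topspace G; g' \<in> topspace G; h \<in> topspace H\<rbrakk> \<Longrightarrow> F s g h 1 = F s g' h 1"
  obtains f where "continuous_map (prod_topology I01 (join_space G H)) Y (\<lambda>w. f (fst w) (snd w))"
    "\<And>s g h t. \<lbrakk>0 \<le> s; s \<le> 1; g \<in> topspace G; h \<in> topspace H; 0 \<le> t; t \<le> 1\<rbrakk> \<Longrightarrow> f s (join_pt G H g h t) = F s g h t"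
proof -
  let ?X = "prod_topology G (prod_topology H I01)"
  define f where "f s c = (let x = (SOME x. x \<in> c) in F s (fst x) (fst (snd x)) (snd (snd x)))" for s c
  have f: "f s (join_pt G H g h t) = F s g h t"
    if s: "0 \<le> s" "s \<le> 1" and "g \<in> topspace G" "h \<in> topspace H" "0 \<le> t" "t \<le> 1" for s g h t
  proof -
    have "(g, h, t) \<in> join_pt G H g h t"
      unfolding join_pt_def by (rule equiv_class_self[OF equiv_join_rel]) (use that in auto)
    then have "(SOME x. x \<in> join_pt G H g h t) \<in> join_pt G H g h t" by (rule someI)
    moreover obtain g' h' t' where x: "(SOME x. x \<in> join_pt G H g h t) = (g', h', t')" by (metis prod_cases3)
    ultimately have "((g, h, t), (g', h', t')) \<in> join_rel G H" by (simp add: join_pt_def)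
    then have "F s g' h' t' = F s g h t"
      using F0[OF s, of g h' h] F1[OF s, of g' g h] by (auto simp: join_rel_def)
    then show ?thesis by (simp add: f_def x)
  qed
  have q: "quotient_map (prod_topology I01 ?X) (prod_topology I01 (join_space G H)) (\<lambda>(s,x). (s, join_rel G H `` {x}))"
    by (rule quotient_map_prod_right[OF I01_locally_compact disjI1[OF I01_Hausdorff] quotient_map_join])
  have "continuous_map (prod_topology I01 (join_space G H)) Y (\<lambda>w. f (fst w) (snd w))"
  proof (rule continuous_compose_quotient_map[OF q], rule continuous_map_eq[OF F])
    fix w assume w: "w \<in> topspace (prod_topology I01 ?X)"
    then obtain s g h t where wd: "w = (s, g, h, t)" by (metis prod_cases4)
    show "F (fst w) (fst (snd w)) (fst (snd (snd w))) (snd (snd (snd w))) =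
      ((\<lambda>w. f (fst w) (snd w)) \<circ> (\<lambda>(s, x). (s, join_rel G H `` {x}))) w"
      using f[of s g h t] w by (simp add: wd join_pt_def)
  qed
  with f that show ?thesis by blast
qed

text \<open>A weakening of the notion of an NDR pair: points of \<open>S\<close> may move inside
  \<open>S\<close>, and \<open>u\<close> may vanish outside it. The set \<open>u < 1\<close> is the
  halo, swept into \<open>S\<close> at time 1. The freedom to move inside \<open>S\<close> is used
  for path spaces, where deforming a path reparametrises it.\<close>

definition halo_deformation :: "'a topology \<Rightarrow> 'a set \<Rightarrow> ('a \<Rightarrow> real) \<Rightarrow> (real \<Rightarrow> 'a \<Rightarrow> 'a) \<Rightarrow> bool" where
  "halo_deformation E S u D \<longleftrightarrow> S \<subseteq> topspace E \<and> continuous_map E euclideanreal u \<and>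
     (\<forall>x\<in>topspace E. 0 \<le> u x) \<and> (\<forall>x\<in>S. u x = 0) \<and>
     continuous_map (prod_topology I01 E) E (\<lambda>w. D (fst w) (snd w)) \<and>
     (\<forall>x\<in>topspace E. D 0 x = x) \<and> (\<forall>s\<in>{0..1}. \<forall>x\<in>S. D s x \<in> S) \<and>
     (\<forall>x\<in>topspace E. u x < 1 \<longrightarrow> D 1 x \<in> S)"

lemma halo_deformationD:
  assumes "halo_deformation E S u D"
  shows "S \<subseteq> topspace E" "continuous_map E euclideanreal u"
    "\<And>x. x \<in> topspace E \<Longrightarrow> 0 \<le> u x" "\<And>x. x \<in> S \<Longrightarrow> u x = 0"
    "continuous_map (prod_topology I01 E) E (\<lambda>w. D (fst w) (snd w))"
    "\<And>x. x \<in> topspace E \<Longrightarrow> D 0 x = x" "\<And>s x. \<lbrakk>0 \<le> s; s \<le> 1; x \<in> S\<rbrakk> \<Longrightarrow> D s x \<in> S"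
    "\<And>x. \<lbrakk>x \<in> topspace E; u x < 1\<rbrakk> \<Longrightarrow> D 1 x \<in> S"
  using assms unfolding halo_deformation_def by auto

locale contractible_halos =
  fixes E1 :: "'a topology" and S1 u1 D1 C1 e1 and E2 :: "'b topology" and S2 u2 D2 C2 e2
  assumes halo1: "halo_deformation E1 S1 u1 D1" and halo2: "halo_deformation E2 S2 u2 D2"
    and e1: "e1 \<in> S1" and e2: "e2 \<in> S2"
    and C1: "continuous_map (prod_topology I01 E1) E1 (\<lambda>w. C1 (fst w) (snd w))"
    and C1_0: "\<And>x. x \<in> topspace E1 \<Longrightarrow> C1 0 x = x" and C1_1: "\<And>x. x \<in> topspace E1 \<Longrightarrow> C1 1 x = e1"
    and C2: "continuous_map (prod_topology I01 E2) E2 (\<lambda>w. C2 (fst w) (snd w))"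
    and C2_0: "\<And>x. x \<in> topspace E2 \<Longrightarrow> C2 0 x = x" and C2_1: "\<And>x. x \<in> topspace E2 \<Longrightarrow> C2 1 x = e2"
begin

abbreviation "G \<equiv> subtopology E1 S1"
abbreviation "H \<equiv> subtopology E2 S2"
abbreviation "J \<equiv> join_space G H"
definition "W = subtopology (prod_topology E1 E2) {w. fst w \<in> S1 \<or> snd w \<in> S2}"

lemmas halo1D = halo_deformationD[OF halo1] and halo2D = halo_deformationD[OF halo2]

lemma topspace_GH: "topspace G = S1" "topspace H = S2"
  using halo1D(1) halo2D(1) by auto

lemma topspace_W: "w \<in> topspace W \<longleftrightarrow> fst w \<in> topspace E1 \<and> snd w \<in> topspace E2 \<and> (fst w \<in> S1 \<or> snd w \<in> S2)"
  by (cases w) (auto simp: W_def)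

text \<open>At the ends \<open>t = 0, 1\<close> the coordinate that does not matter may lie outside \<open>S1\<close> or \<open>S2\<close>.\<close>
definition "guarded_pt g h t = join_pt G H (if t = 1 then e1 else g) (if t = 0 then e2 else h) t"

lemma join_pt_ends:
  "\<lbrakk>g \<in> S1; h \<in> S2; h' \<in> S2\<rbrakk> \<Longrightarrow> join_pt G H g h 0 = join_pt G H g h' 0"
  "\<lbrakk>g \<in> S1; g' \<in> S1; h \<in> S2\<rbrakk> \<Longrightarrow> join_pt G H g h 1 = join_pt G H g' h 1"
  by (rule join_pt_0 join_pt_1; simp only: topspace_GH)+

lemma guarded_pt_eq: "\<lbrakk>g \<in> S1; h \<in> S2\<rbrakk> \<Longrightarrow> guarded_pt g h t = join_pt G H g h t"
  unfolding guarded_pt_def using join_pt_ends(1)[OF _ e2, of g h] join_pt_ends(2)[OF e1, of g h] by simp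

text \<open>The functions \<open>p\<close> and \<open>q\<close> control how far \<open>a\<close> and
  \<open>b\<close> may stray. A coordinate can leave \<open>S1\<close> or \<open>S2\<close> only at
  value 1, but the join parameter already ignores it from \<open>1/2\<close> on. This margin lets
  three closed pieces cover \<open>Z\<close> on which the map is a join point of honest maps into
  \<open>G\<close> and \<open>H\<close>.\<close>

lemma continuous_map_guarded_pt:
  assumes a: "continuous_map Z E1 a" and b: "continuous_map Z E2 b" and t: "continuous_map Z I01 t"
    and p: "continuous_map Z euclideanreal p" and q: "continuous_map Z euclideanreal q"
    and aS: "\<And>z. \<lbrakk>z \<in> topspace Z; p z < 1\<rbrakk> \<Longrightarrow> a z \<in> S1" and bS: "\<And>z. \<lbrakk>z \<in> topspace Z; q z < 1\<rbrakk> \<Longrightarrow> b z \<in> S2"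
    and t0: "\<And>z. \<lbrakk>z \<in> topspace Z; 1/2 \<le> q z\<rbrakk> \<Longrightarrow> t z = 0" and t1: "\<And>z. \<lbrakk>z \<in> topspace Z; 1/2 \<le> p z\<rbrakk> \<Longrightarrow> t z = 1"
  shows "continuous_map Z J (\<lambda>z. guarded_pt (a z) (b z) (t z))"
proof -
  \<comment> \<open>The parameter cannot be both 0 and 1, so at most one of \<open>p\<close>,
    \<open>q\<close> reaches \<open>1/2\<close> at a given point.\<close>
  have small: "p z < 1/2 \<or> q z < 1/2" if "z \<in> topspace Z" for z
    using t0[OF that] t1[OF that] by force
  let ?A = "\<lambda>z. join_pt G H (a z) e2 0" and ?B = "\<lambda>z. join_pt G H e1 (b z) 1" and ?C = "\<lambda>z. join_pt G H (a z) (b z) (t z)"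
  have "continuous_map Z J (\<lambda>z. if 1/2 \<le> q z then ?A z else if 1/2 \<le> p z then ?B z else ?C z)"
  proof (rule continuous_map_cases_le[OF _ q])
    show "continuous_map (subtopology Z {z \<in> topspace Z. 1/2 \<le> q z}) J ?A"
    proof (rule continuous_map_join_pt)
      show "continuous_map (subtopology Z {z \<in> topspace Z. 1/2 \<le> q z}) G a"
        using a small aS by (auto simp: continuous_map_in_subtopology intro!: continuous_map_from_subtopology) force
    qed (use e2 halo2D(1) in auto)
    let ?Z = "subtopology Z {z \<in> topspace Z. q z \<le> 1/2}"
    show "continuous_map ?Z J (\<lambda>z. if 1/2 \<le> p z then ?B z else ?C z)"
    proof (rule continuous_map_cases_le[OF _ continuous_map_from_subtopology[OF p]])
      show "continuous_map (subtopology ?Z {z \<in> topspace ?Z. 1/2 \<le> p z}) J ?B"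
      proof (rule continuous_map_join_pt)
        show "continuous_map (subtopology ?Z {z \<in> topspace ?Z. 1/2 \<le> p z}) H b"
          using b bS by (auto simp: continuous_map_in_subtopology intro!: continuous_map_from_subtopology)
      qed (use e1 halo1D(1) in auto)
      show "continuous_map (subtopology ?Z {z \<in> topspace ?Z. p z \<le> 1/2}) J ?C"
        by (rule continuous_map_join_pt)
          (use a b t aS bS in \<open>auto simp: continuous_map_in_subtopology intro!: continuous_map_from_subtopology\<close>)
      show "?B z = ?C z" if "z \<in> topspace ?Z" "1/2 = p z" for z
        using that t1[of z] aS[of z] bS[of z] join_pt_ends(2)[OF e1, of "a z" "b z"] by simp
    qed auto
    show "?A z = (if 1/2 \<le> p z then ?B z else ?C z)" if "z \<in> topspace Z" "1/2 = q z" for z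
      using that t0[of z] small[of z] aS[of z] bS[of z] join_pt_ends(1)[OF _ e2, of "a z" "b z"] by auto
  qed auto
  then show ?thesis
  proof (rule continuous_map_eq)
    fix z assume z: "z \<in> topspace Z"
    show "(if 1/2 \<le> q z then ?A z else if 1/2 \<le> p z then ?B z else ?C z) = guarded_pt (a z) (b z) (t z)"
    proof (cases "1/2 \<le> q z \<or> 1/2 \<le> p z")
      case True
      then show ?thesis using t0[OF z] t1[OF z] by (auto simp: guarded_pt_def)
    next
      case False
      then show ?thesis using guarded_pt_eq aS[OF z] bS[OF z] by simp
    qed
  qed
qed

section \<open>Maps in both directions between the join and the union of products\<close>

lemma W_halo: "w \<in> topspace W \<Longrightarrow> u1 (fst w) = 0 \<or> u2 (snd w) = 0"
  using halo1D(4) halo2D(4) by (auto simp: topspace_W)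

lemma C_in:
  "\<lbrakk>0 \<le> s; s \<le> 1; x \<in> topspace E1\<rbrakk> \<Longrightarrow> C1 s x \<in> topspace E1"
  "\<lbrakk>0 \<le> s; s \<le> 1; y \<in> topspace E2\<rbrakk> \<Longrightarrow> C2 s y \<in> topspace E2"
  using funcset_mem[OF C1[unfolded continuous_map_def, THEN conjunct1], of "(s, x)"]
    funcset_mem[OF C2[unfolded continuous_map_def, THEN conjunct1], of "(s, y)"] by auto

lemma D_in:
  "\<lbrakk>0 \<le> s; s \<le> 1; x \<in> topspace E1\<rbrakk> \<Longrightarrow> D1 s x \<in> topspace E1"
  "\<lbrakk>0 \<le> s; s \<le> 1; y \<in> topspace E2\<rbrakk> \<Longrightarrow> D2 s y \<in> topspace E2"
  using funcset_mem[OF halo1D(5)[unfolded continuous_map_def, THEN conjunct1], of "(s, x)"]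
    funcset_mem[OF halo2D(5)[unfolded continuous_map_def, THEN conjunct1], of "(s, y)"] by auto

text \<open>On \<open>W\<close> at least one of \<open>u1\<close>, \<open>u2\<close> is zero, so
  this is \<open>1/2\<close> plus or minus the other one, clamped. It saturates when that value
  reaches \<open>1/2\<close>, while the corresponding deformed coordinate remains in
  \<open>S1\<close> or \<open>S2\<close> up to value 1.\<close>

definition "\<tau> w = min 1 (max 0 (1/2 + u1 (fst w) - u2 (snd w)))"
definition "to_join w = guarded_pt (D1 1 (fst w)) (D2 1 (snd w)) (\<tau> w)"
text \<open>The join line is cut into thirds. \<open>ramp2\<close> contracts the second coordinate
  over the first third, \<open>ramp1\<close> the first coordinate over the last third, and on the
  middle third neither moves. \<open>stretch\<close> is constant exactly where a coordinate may be
  moving, which makes it an intermediate parameter between \<open>\<tau>\<close> and the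
  identity.\<close>

definition "stretch t = min 1 (max 0 (3 * t - 1))" for t :: real
definition "ramp1 t = max 0 (3 * t - 2)" for t :: real
definition "ramp2 t = max 0 (1 - 3 * t)" for t :: real
lemmas ramp_defs = ramp1_def ramp2_def stretch_def

lemma ramp_simps:
  "ramp1 0 = 0" "ramp1 1 = 1" "ramp2 0 = 1" "ramp2 1 = 0" "t \<le> 2/3 \<Longrightarrow> ramp1 t = 0" "1/3 \<le> t \<Longrightarrow> ramp2 t = 0"
  "t \<le> 1/3 \<Longrightarrow> stretch t = 0" "2/3 \<le> t \<Longrightarrow> stretch t = 1" "0 \<le> ramp1 t" "0 \<le> ramp2 t" "t \<le> 1 \<Longrightarrow> ramp1 t \<le> 1" "0 \<le> t \<Longrightarrow> ramp2 t \<le> 1"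
  "0 \<le> stretch t" "stretch t \<le> 1"
  by (auto simp: ramp_defs)

lemma continuous_ramp:
  assumes "continuous_map Z I01 t"
  shows "continuous_map Z I01 (\<lambda>z. ramp1 (t z))" "continuous_map Z I01 (\<lambda>z. ramp2 (t z))" "continuous_map Z I01 (\<lambda>z. stretch (t z))"
  using assms unfolding ramp_defs continuous_map_I01 by (intro conjI cont_real; auto)+

lemma continuous_W: "continuous_map W E1 fst" "continuous_map W E2 snd"
  unfolding W_def by (intro continuous_map_from_subtopology continuous_map_fst continuous_map_snd)+

lemma continuous_\<tau>:
  assumes "continuous_map Z E1 x" "continuous_map Z E2 y"
  shows "continuous_map Z I01 (\<lambda>z. \<tau> (x z, y z))"
  unfolding \<tau>_def continuous_map_I01 fst_conv snd_conv
  by (intro conjI cont_real continuous_map_comp[OF halo1D(2) assms(1)] continuous_map_comp[OF halo2D(2) assms(2)]) auto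

lemma \<tau>_range: "0 \<le> \<tau> w" "\<tau> w \<le> 1" by (auto simp: \<tau>_def)

text \<open>A parameter below \<open>1/2\<close> forces \<open>u2 (snd w) > 0\<close>, so the second
  coordinate is outside \<open>S2\<close> and membership in \<open>W\<close> puts the first into
  \<open>S1\<close>; symmetrically above \<open>1/2\<close>.\<close>

lemma \<tau>_less: "\<lbrakk>w \<in> topspace W; \<tau> w < 1/2\<rbrakk> \<Longrightarrow> fst w \<in> S1" and \<tau>_greater: "\<lbrakk>w \<in> topspace W; \<tau> w > 1/2\<rbrakk> \<Longrightarrow> snd w \<in> S2"
  using halo1D(3)[of "fst w"] halo2D(3)[of "snd w"] halo1D(4)[of "fst w"] halo2D(4)[of "snd w"]
  by (auto simp: topspace_W \<tau>_def min_def max_def split: if_splits)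

lemma \<tau>_0: "\<lbrakk>w \<in> topspace W; 1/2 \<le> u2 (snd w)\<rbrakk> \<Longrightarrow> \<tau> w = 0" and \<tau>_1: "\<lbrakk>w \<in> topspace W; 1/2 \<le> u1 (fst w)\<rbrakk> \<Longrightarrow> \<tau> w = 1"
  using W_halo[of w] by (auto simp: \<tau>_def)

lemma D1_S: "\<lbrakk>w \<in> topspace W; \<tau> w < 1\<rbrakk> \<Longrightarrow> D1 1 (fst w) \<in> S1"
  using halo1D(8)[of "fst w"] \<tau>_1[of w] by (cases "1/2 \<le> u1 (fst w)") (simp_all add: topspace_W)

lemma D2_S: "\<lbrakk>w \<in> topspace W; 0 < \<tau> w\<rbrakk> \<Longrightarrow> D2 1 (snd w) \<in> S2"
  using halo2D(8)[of "snd w"] \<tau>_0[of w] by (cases "1/2 \<le> u2 (snd w)") (simp_all add: topspace_W)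

lemma continuous_to_join: "continuous_map W J to_join"
  unfolding to_join_def
proof (rule continuous_map_guarded_pt[where p="\<lambda>w. u1 (fst w)" and q="\<lambda>w. u2 (snd w)"])
  show "continuous_map W E1 (\<lambda>w. D1 1 (fst w))" "continuous_map W E2 (\<lambda>w. D2 1 (snd w))"
    by (rule continuous_map_comp2[OF halo1D(5) _ continuous_W(1)] continuous_map_comp2[OF halo2D(5) _ continuous_W(2)]; simp)+
  show "continuous_map W I01 \<tau>" using continuous_\<tau>[OF continuous_W] by simp
  show "continuous_map W euclideanreal (\<lambda>w. u1 (fst w))" "continuous_map W euclideanreal (\<lambda>w. u2 (snd w))"
    by (rule continuous_map_comp[OF halo1D(2) continuous_W(1)] continuous_map_comp[OF halo2D(2) continuous_W(2)])+
qed (auto simp: halo1D(8) halo2D(8) \<tau>_0 \<tau>_1 topspace_W)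

text \<open>The coordinate to be forgotten has become the base point at \<open>t = 0\<close> or
  \<open>t = 1\<close>, so the formula descends to the join. At most one coordinate is being
  contracted at any time, so the pair stays in \<open>W\<close>.\<close>

definition "from_join g h t = (C1 (ramp1 t) g, C2 (ramp2 t) h)"

lemma from_join_in:
  assumes "g \<in> S1" "h \<in> S2" "0 \<le> t" "t \<le> 1"
  shows "from_join g h t \<in> topspace W"
proof -
  have "C1 (ramp1 t) g \<in> S1 \<or> C2 (ramp2 t) h \<in> S2"
    using assms C1_0[of g] C2_0[of h] halo1D(1) halo2D(1) ramp_simps(5,6)[of t] by (cases "t \<le> 1/2") auto
  then show ?thesis using assms halo1D(1) halo2D(1) by (auto simp: from_join_def topspace_W C_in ramp_simps)
qed

lemma from_join_cases:
  assumes "g \<in> S1" "h \<in> S2" "0 \<le> t" "t \<le> 1"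
  shows "t \<le> 2/3 \<Longrightarrow> fst (from_join g h t) = g" "1/3 \<le> t \<Longrightarrow> snd (from_join g h t) = h"
  using assms C1_0[of g] C2_0[of h] halo1D(1) halo2D(1) by (auto simp: from_join_def ramp_simps)

text \<open>The homotopy inverse is \<open>to_join\<close>. One composite is deformed by running the
  halo deformations and contractions together; the other needs two stages, since the halo
  deformations can be undone only after the join parameter has been replaced by
  \<open>stretch\<close>.\<close>

lemma join_homotopy_equivalence:
  obtains f where "homotopy_equivalence_map J W f" "f (join_pt G H e1 e2 0) = (e1, e2)"
proof -
  let ?X = "prod_topology G (prod_topology H I01)"
  let ?Y = "prod_topology I01 ?X"
  have ps: "continuous_map ?Y I01 (\<lambda>w. fst w)" by (rule continuous_map_proj)
  have pg: "continuous_map ?Y E1 (\<lambda>w. fst (snd w))"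
    by (rule continuous_map_into_fulltopology, rule continuous_map_fst_comp, rule continuous_map_proj)
  have ph: "continuous_map ?Y E2 (\<lambda>w. fst (snd (snd w)))"
    by (rule continuous_map_into_fulltopology, rule continuous_map_fst_comp, rule continuous_map_snd_comp, rule continuous_map_proj)
  have pt: "continuous_map ?Y I01 (\<lambda>w. snd (snd (snd w)))"
    by (rule continuous_map_snd_comp, rule continuous_map_snd_comp, rule continuous_map_proj)
  have px: "continuous_map ?Y E1 (\<lambda>w. C1 (ramp1 (snd (snd (snd w)))) (fst (snd w)))"
    by (rule continuous_map_comp2[OF C1 continuous_ramp(1)[OF pt] pg])
  have py: "continuous_map ?Y E2 (\<lambda>w. C2 (ramp2 (snd (snd (snd w)))) (fst (snd (snd w))))"
    by (rule continuous_map_comp2[OF C2 continuous_ramp(2)[OF pt] ph])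
  have Yd: "fst w \<in> {0..1} \<and> fst (snd w) \<in> S1 \<and> fst (snd (snd w)) \<in> S2 \<and> snd (snd (snd w)) \<in> {0..1}"
    if "w \<in> topspace ?Y" for w using that by auto
  have "continuous_map ?Y W (\<lambda>w. from_join (fst (snd w)) (fst (snd (snd w))) (snd (snd (snd w))))"
    unfolding W_def continuous_map_in_subtopology
  proof
    show "continuous_map ?Y (prod_topology E1 E2) (\<lambda>w. from_join (fst (snd w)) (fst (snd (snd w))) (snd (snd (snd w))))"
      unfolding from_join_def by (rule continuous_map_pairedI[OF px py])
    show "(\<lambda>w. from_join (fst (snd w)) (fst (snd (snd w))) (snd (snd (snd w)))) \<in> topspace ?Y \<rightarrow> {w. fst w \<in> S1 \<or> snd w \<in> S2}"
    proof
      fix w assume "w \<in> topspace ?Y"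
      then show "from_join (fst (snd w)) (fst (snd (snd w))) (snd (snd (snd w))) \<in> {w. fst w \<in> S1 \<or> snd w \<in> S2}"
        using from_join_in Yd[of w] topspace_W by auto
    qed
  qed
  \<comment> \<open>The lifting lemma is used with a homotopy that ignores its time, so that the
    slice at 0 is the desired map on the join.\<close>
  from this obtain f' where f': "continuous_map (prod_topology I01 J) W (\<lambda>w. f' (fst w) (snd w))"
    and f'_eq: "\<And>s g h t. \<lbrakk>0 \<le> s; s \<le> 1; g \<in> topspace G; h \<in> topspace H; 0 \<le> t; t \<le> 1\<rbrakk> \<Longrightarrow> f' s (join_pt G H g h t) = from_join g h t"
  proof (rule join_space_homotopy_lift[where F="\<lambda>_. from_join"])
    show "from_join g h 0 = from_join g h' 0" if "h \<in> topspace H" "h' \<in> topspace H" for g h h'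
      using that by (simp add: from_join_def ramp_simps C2_1)
    show "from_join g h 1 = from_join g' h 1" if "g \<in> topspace G" "g' \<in> topspace G" for g g' h
      using that by (simp add: from_join_def ramp_simps C1_1)
  qed (rule that)
  note f'_eq = f'_eq[unfolded topspace_GH]
  define f where "f = f' 0"
  have f_eq: "f (join_pt G H g h t) = from_join g h t" if "g \<in> S1" "h \<in> S2" "0 \<le> t" "t \<le> 1" for g h t
    unfolding f_def using f'_eq[of 0 g h t] that by simp
  have f: "continuous_map J W f"
    unfolding f_def by (rule continuous_map_comp2[OF f' _ continuous_map_self]) simp
  \<comment> \<open>The guards disappear: at parameter 0 or 1 the contraction has erased the very
    coordinate that a guard replaces.\<close>
  have fjp: "f (guarded_pt g h t) = (C1 (ramp1 t) g, C2 (ramp2 t) h)"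
    if "g \<in> topspace E1" "h \<in> topspace E2" "0 \<le> t" "t \<le> 1" "t < 1 \<Longrightarrow> g \<in> S1" "0 < t \<Longrightarrow> h \<in> S2" for g h t
    using that e1 e2 halo1D(1) halo2D(1) unfolding guarded_pt_def by (subst f_eq) (auto simp: from_join_def ramp_simps C1_1 C2_1)
  \<comment> \<open>Membership in \<open>W\<close> persists because \<open>\<tau>\<close> selects
    the safe coordinate. Below \<open>1/2\<close> the first coordinate lies in \<open>S1\<close>, is
    kept there by \<open>D1\<close>, and is not contracted since \<open>ramp1\<close> vanishes;
    above \<open>1/2\<close> the roles are exchanged, and at \<open>1/2\<close> neither ramp
    acts.\<close>
  have "homotopic_with (\<lambda>_. True) W W (\<lambda>w. w) (\<lambda>w. f (to_join w))"
  proof (rule homotopic_withI[where h="\<lambda>s w. (C1 (s * ramp1 (\<tau> w)) (D1 s (fst w)), C2 (s * ramp2 (\<tau> w)) (D2 s (snd w)))"])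
    let ?Z = "prod_topology I01 W"
    have x: "continuous_map ?Z E1 (\<lambda>w. fst (snd w))" and y: "continuous_map ?Z E2 (\<lambda>w. snd (snd w))"
      by (rule continuous_map_comp[OF continuous_W(1) continuous_map_proj(2)]
          continuous_map_comp[OF continuous_W(2) continuous_map_proj(2)])+
    have s: "continuous_map ?Z I01 (\<lambda>w. fst w)" by (rule continuous_map_proj)
    have t: "continuous_map ?Z I01 (\<lambda>w. \<tau> (snd w))" using continuous_\<tau>[OF x y] by simp
    have m: "continuous_map ?Z I01 (\<lambda>w. fst w * v w)" if "continuous_map ?Z I01 v" for v
      using s that unfolding continuous_map_I01 by (intro conjI cont_real) (auto simp: mult_le_one)
    show "continuous_map ?Z W (\<lambda>w. (C1 (fst w * ramp1 (\<tau> (snd w))) (D1 (fst w) (fst (snd w))),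
        C2 (fst w * ramp2 (\<tau> (snd w))) (D2 (fst w) (snd (snd w)))))" (is "continuous_map _ _ ?h")
      \<comment> \<open>Only the codomain is unfolded; the copy of \<open>W\<close> inside the
        domain stays folded.\<close>
      unfolding W_def[THEN arg_cong, of "\<lambda>W'. continuous_map ?Z W' ?h"] continuous_map_in_subtopology
    proof
      show "continuous_map ?Z (prod_topology E1 E2) ?h"
        by (rule continuous_map_pairedI[OF continuous_map_comp2[OF C1 m[OF continuous_ramp(1)[OF t]] continuous_map_comp2[OF halo1D(5) s x]]
            continuous_map_comp2[OF C2 m[OF continuous_ramp(2)[OF t]] continuous_map_comp2[OF halo2D(5) s y]]])
      show "?h \<in> topspace ?Z \<rightarrow> {w. fst w \<in> S1 \<or> snd w \<in> S2}"
      proof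
        fix z assume "z \<in> topspace ?Z"
        then obtain s w where z: "z = (s, w)" and s: "0 \<le> s" "s \<le> 1" and w: "w \<in> topspace W" by auto
        have D: "D1 s (fst w) \<in> topspace E1" "D2 s (snd w) \<in> topspace E2" using D_in s w by (auto simp: topspace_W)
        consider "\<tau> w < 1/2" | "\<tau> w > 1/2" | "\<tau> w = 1/2" by linarith
        then have "C1 (s * ramp1 (\<tau> w)) (D1 s (fst w)) \<in> S1 \<or> C2 (s * ramp2 (\<tau> w)) (D2 s (snd w)) \<in> S2"
        proof cases
          case 1
          then have "ramp1 (\<tau> w) = 0" by (simp add: ramp_simps)
          then show ?thesis using halo1D(7)[OF s \<tau>_less[OF w 1]] C1_0[OF D(1)] by simp
        next
          case 2
          then have "ramp2 (\<tau> w) = 0" by (simp add: ramp_simps)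
          then show ?thesis using halo2D(7)[OF s \<tau>_greater[OF w 2]] C2_0[OF D(2)] by simp
        next
          case 3
          then have "ramp1 (\<tau> w) = 0" "ramp2 (\<tau> w) = 0" by (simp_all add: ramp_simps)
          then show ?thesis using halo1D(7)[OF s, of "fst w"] halo2D(7)[OF s, of "snd w"] C1_0[OF D(1)] C2_0[OF D(2)] w
            by (auto simp: topspace_W)
        qed
        then show "?h z \<in> {w. fst w \<in> S1 \<or> snd w \<in> S2}" by (simp add: z)
      qed
    qed
    fix w assume w: "w \<in> topspace W"
    show "(C1 (0 * ramp1 (\<tau> w)) (D1 0 (fst w)), C2 (0 * ramp2 (\<tau> w)) (D2 0 (snd w))) = w"
      using w by (simp add: topspace_W halo1D(6) halo2D(6) C1_0 C2_0)
    show "(C1 (1 * ramp1 (\<tau> w)) (D1 1 (fst w)), C2 (1 * ramp2 (\<tau> w)) (D2 1 (snd w))) = f (to_join w)"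
      unfolding to_join_def by (subst fjp) (use w in \<open>auto simp: topspace_W D_in \<tau>_range D1_S D2_S\<close>)
  qed
  then have fk: "homotopic_with (\<lambda>_. True) W W (\<lambda>w. f (to_join w)) (\<lambda>w. w)" by (rule homotopic_with_symD)
  \<comment> \<open>\<open>hA\<close> moves only the join parameter, from
    \<open>\<tau> (from_join g h t)\<close> to \<open>stretch t\<close>. If \<open>u2\<close> of the
    second coordinate is at least \<open>1/2\<close>, then \<open>t < 1/3\<close> and both
    parameters are 0; likewise both are 1 on the other side.\<close>
  define hA where "hA s g h t = guarded_pt (D1 1 (fst (from_join g h t))) (D2 1 (snd (from_join g h t))) ((1 - s) * \<tau> (from_join g h t) + s * stretch t)" for s g h t
  \<comment> \<open>\<open>hB\<close> works on the original \<open>g\<close> and \<open>h\<close>,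
    undoing the halo deformations while \<open>stretch\<close> relaxes to the identity.\<close>
  define hB where "hB s g h t = guarded_pt (D1 (1 - s) g) (D2 (1 - s) h) ((1 - s) * stretch t + s * t)" for s g h t
  have pf: "continuous_map ?Y E1 (\<lambda>w. fst (from_join (fst (snd w)) (fst (snd (snd w))) (snd (snd (snd w)))))"
    "continuous_map ?Y E2 (\<lambda>w. snd (from_join (fst (snd w)) (fst (snd (snd w))) (snd (snd (snd w)))))"
    using px py by (simp_all add: from_join_def)
  have one: "continuous_map ?Y I01 (\<lambda>_. 1)" by simp
  have p\<tau>: "continuous_map ?Y I01 (\<lambda>w. \<tau> (from_join (fst (snd w)) (fst (snd (snd w))) (snd (snd (snd w)))))"
    using continuous_\<tau>[OF pf] by simp
  have "continuous_map ?Y J (\<lambda>w. hA (fst w) (fst (snd w)) (fst (snd (snd w))) (snd (snd (snd w))))"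
    unfolding hA_def
  proof (rule continuous_map_guarded_pt[OF continuous_map_comp2[OF halo1D(5) one pf(1)] continuous_map_comp2[OF halo2D(5) one pf(2)]
        continuous_map_I01_convex[OF ps p\<tau> continuous_ramp(3)[OF pt]] continuous_map_comp[OF halo1D(2) pf(1)] continuous_map_comp[OF halo2D(2) pf(2)]])
    fix w assume w: "w \<in> topspace ?Y"
    obtain s g h t where wd: "w = (s, g, h, t)" by (metis prod_cases4)
    have gh: "g \<in> S1" "h \<in> S2" "0 \<le> t" "t \<le> 1" using Yd[OF w] by (auto simp: wd)
    have W: "from_join g h t \<in> topspace W" by (rule from_join_in[OF gh])
    let ?from_join = "from_join (fst (snd w)) (fst (snd (snd w))) (snd (snd (snd w)))"
    show "D1 1 (fst ?from_join) \<in> S1" if "u1 (fst ?from_join) < 1" using that halo1D(8) W by (auto simp: wd topspace_W)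
    show "D2 1 (snd ?from_join) \<in> S2" if "u2 (snd ?from_join) < 1" using that halo2D(8) W by (auto simp: wd topspace_W)
    show "(1 - fst w) * \<tau> ?from_join + fst w * stretch (snd (snd (snd w))) = 0" if u: "1/2 \<le> u2 (snd ?from_join)"
    proof -
      have "\<not> 1/3 \<le> t" using from_join_cases(2)[OF gh] u halo2D(4)[OF gh(2)] by (auto simp: wd)
      then have "stretch t = 0" by (simp add: ramp_simps)
      then show ?thesis using \<tau>_0[OF W] u by (simp add: wd)
    qed
    show "(1 - fst w) * \<tau> ?from_join + fst w * stretch (snd (snd (snd w))) = 1" if u: "1/2 \<le> u1 (fst ?from_join)"
    proof -
      have "\<not> t \<le> 2/3" using from_join_cases(1)[OF gh] u halo1D(4)[OF gh(1)] by (auto simp: wd)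
      then have "stretch t = 1" by (simp add: ramp_simps)
      then show ?thesis using \<tau>_1[OF W] u by (simp add: wd)
    qed
  qed
  then obtain A where A: "continuous_map (prod_topology I01 J) J (\<lambda>w. A (fst w) (snd w))"
    and A_eq: "\<And>s g h t. \<lbrakk>0 \<le> s; s \<le> 1; g \<in> topspace G; h \<in> topspace H; 0 \<le> t; t \<le> 1\<rbrakk> \<Longrightarrow> A s (join_pt G H g h t) = hA s g h t"
  proof (rule join_space_homotopy_lift)
    show "hA s g h 0 = hA s g h' 0" if "h \<in> topspace H" "h' \<in> topspace H" for s g h h'
      using that by (simp add: hA_def from_join_def ramp_simps C2_1)
    show "hA s g h 1 = hA s g' h 1" if "g \<in> topspace G" "g' \<in> topspace G" for s g g' h
      using that by (simp add: hA_def from_join_def ramp_simps C1_1)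
  qed (rule that)
  note A_eq = A_eq[unfolded topspace_GH]
  have ms: "continuous_map ?Y I01 (\<lambda>w. 1 - fst w)"
    unfolding continuous_map_I01 by (intro conjI cont_real) auto
  have "continuous_map ?Y J (\<lambda>w. hB (fst w) (fst (snd w)) (fst (snd (snd w))) (snd (snd (snd w))))"
    unfolding hB_def
    \<comment> \<open>Here both coordinates stay in \<open>S1\<close> and \<open>S2\<close>
      throughout, so the control functions can be 0.\<close>
    by (rule continuous_map_guarded_pt[OF continuous_map_comp2[OF halo1D(5) ms pg] continuous_map_comp2[OF halo2D(5) ms ph]
        continuous_map_I01_convex[OF ps continuous_ramp(3)[OF pt] pt], of "\<lambda>_. 0" "\<lambda>_. 0"])
      (auto simp: halo1D(7) halo2D(7))
  then obtain B where B: "continuous_map (prod_topology I01 J) J (\<lambda>w. B (fst w) (snd w))"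
    and B_eq: "\<And>s g h t. \<lbrakk>0 \<le> s; s \<le> 1; g \<in> topspace G; h \<in> topspace H; 0 \<le> t; t \<le> 1\<rbrakk> \<Longrightarrow> B s (join_pt G H g h t) = hB s g h t"
  proof (rule join_space_homotopy_lift)
    show "hB s g h 0 = hB s g h' 0" for s g h h' by (simp add: hB_def ramp_simps guarded_pt_def)
    show "hB s g h 1 = hB s g' h 1" for s g g' h by (simp add: hB_def ramp_simps guarded_pt_def)
  qed (rule that)
  note B_eq = B_eq[unfolded topspace_GH]
  have J: "\<exists>g h t. x = join_pt G H g h t \<and> g \<in> S1 \<and> h \<in> S2 \<and> 0 \<le> t \<and> t \<le> 1" if "x \<in> topspace J" for x
    using that unfolding topspace_join_space topspace_GH by auto
  have "homotopic_with (\<lambda>_. True) J J (\<lambda>x. to_join (f x)) (A 1)"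
  proof (rule homotopic_withI[OF A])
    fix x assume "x \<in> topspace J"
    from J[OF this] obtain g h t where "x = join_pt G H g h t" "g \<in> S1" "h \<in> S2" "0 \<le> t" "t \<le> 1" by auto
    then show "A 0 x = to_join (f x)" by (simp add: A_eq hA_def f_eq to_join_def)
  qed auto
  moreover have "homotopic_with (\<lambda>_. True) J J (A 1) (\<lambda>x. x)"
  proof (rule homotopic_withI[OF B])
    fix x assume "x \<in> topspace J"
    from J[OF this] obtain g h t where x: "x = join_pt G H g h t" and gh: "g \<in> S1" "h \<in> S2" "0 \<le> t" "t \<le> 1" by auto
    consider "t < 1/3" | "1/3 \<le> t" "t \<le> 2/3" | "2/3 < t" by linarith
    \<comment> \<open>\<open>from_join g h t\<close> differs from \<open>(g, h)\<close> only in a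
      coordinate that the guard discards at the value 0 or 1 of \<open>stretch t\<close>.\<close>
    then have "hB 0 g h t = hA 1 g h t"
      by cases (use from_join_cases[OF gh] in \<open>auto simp: hA_def hB_def ramp_simps guarded_pt_def\<close>)
    then show "B 0 x = A 1 x" using gh by (simp add: x A_eq B_eq)
    show "B 1 x = x" using gh halo1D(1) halo2D(1) by (simp add: x B_eq hB_def halo1D(6) halo2D(6) subset_iff guarded_pt_eq)
  qed
  ultimately have kf: "homotopic_with (\<lambda>_. True) J J (\<lambda>x. to_join (f x)) (\<lambda>x. x)" by (rule homotopic_with_trans)
  show ?thesis
  proof (rule that)
    show "homotopy_equivalence_map J W f"
      by (rule homotopy_equivalence_mapI[where f=f and g=to_join, OF f continuous_to_join kf fk])
    show "f (join_pt G H e1 e2 0) = (e1, e2)"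
      using e1 e2 halo1D(1) halo2D(1) by (subst f_eq) (auto simp: from_join_def ramp_simps C1_0 C2_1)
  qed
qed

end

section \<open>Halos of subcomplexes of CW complexes\<close>

lemma RN_euclidean: "RN = euclidean"
  by (simp add: RN_def euclidean_product_topology)

section \<open>Discs and the radial projection of a cylinder\<close>

lemma continuous_coordinate: "continuous_on S (\<lambda>x. x i)" for S :: "(nat \<Rightarrow> real) set"
  by (rule continuous_on_product_then_coordinatewise) (rule continuous_on_id)

text \<open>The disc sits in an infinite product, so compactness comes from Tychonoff: it is a
  closed subset of the cube with sides \<open>{-1..1}\<close>.\<close>

lemma compact_disc: "compact (disc n)"
proof -
  have "compactin (product_topology (\<lambda>_. euclideanreal) UNIV) (PiE UNIV (\<lambda>_::nat. {-1..1}))"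
    by (simp add: compactin_PiE)
  then have "compact (PiE UNIV (\<lambda>_::nat. {-1..1::real}))"
    by (simp add: euclidean_product_topology)
  moreover have "closed (disc n)"
    unfolding disc_def
    by (intro closed_Collect_conj closed_Collect_all closed_Collect_imp closed_Collect_le closed_Collect_eq
        open_Collect_const continuous_intros continuous_coordinate)
  moreover have "disc n \<subseteq> PiE UNIV (\<lambda>_. {-1..1})"
  proof
    fix x assume x: "x \<in> disc n"
    have "\<bar>x i\<bar> \<le> 1" for i
    proof (cases "i < n")
      case True
      have "(x i)\<^sup>2 \<le> (\<Sum>i<n. (x i)\<^sup>2)" by (rule member_le_sum) (use True in auto)
      then have "(x i)\<^sup>2 \<le> 1" using x by (simp add: disc_def)
      then show ?thesis by (simp add: abs_square_le_1)
    qed (use x in \<open>simp add: disc_def\<close>)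
    then show "x \<in> PiE UNIV (\<lambda>_. {-1..1})" by (auto simp: abs_le_iff minus_le_iff)
  qed
  ultimately show ?thesis by (metis compact_Int_closed inf.absorb_iff2)
qed

definition rad :: "nat \<Rightarrow> (nat \<Rightarrow> real) \<Rightarrow> real" where
  "rad n x = sqrt (\<Sum>i<n. (x i)\<^sup>2)"

text \<open>Radial projection of the cylinder \<open>disc n \<times> [0,1]\<close> from the point at height 2 above its
  centre, onto bottom and side.\<close>
definition rscale :: "nat \<Rightarrow> (nat \<Rightarrow> real) \<Rightarrow> real \<Rightarrow> real" where
  "rscale n x t = max (rad n x) (1 - t / 2)"

text \<open>The ray from the apex through \<open>(x, t)\<close> consists of the points with position
  \<open>c * x\<close> and height \<open>2 - c * (2 - t)\<close>. It meets the side at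
  \<open>c = 1 / rad n x\<close> and the bottom at \<open>c = 1 / (1 - t / 2)\<close>; the smaller
  value is \<open>1 / rscale n x t\<close>. At the centre the side is never met.\<close>

definition rpt :: "nat \<Rightarrow> (nat \<Rightarrow> real) \<Rightarrow> real \<Rightarrow> nat \<Rightarrow> real" where
  "rpt n x t = (\<lambda>i. x i / rscale n x t)"

definition rht :: "nat \<Rightarrow> (nat \<Rightarrow> real) \<Rightarrow> real \<Rightarrow> real" where
  "rht n x t = 2 - (2 - t) / rscale n x t"

lemma disc_rad: "x \<in> disc n \<longleftrightarrow> (\<forall>i\<ge>n. x i = 0) \<and> rad n x \<le> 1"
  and sphere_rad: "x \<in> sphere_bd n \<longleftrightarrow> (\<forall>i\<ge>n. x i = 0) \<and> rad n x = 1"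
  by (auto simp: disc_def sphere_bd_def rad_def)

lemma sphere_disc: "sphere_bd n \<subseteq> disc n"
  by (auto simp: disc_rad sphere_rad)

lemma rad_scale: "0 \<le> c \<Longrightarrow> rad n (\<lambda>i. c * x i) = c * rad n x"
  by (simp add: rad_def power_mult_distrib sum_distrib_left[symmetric] real_sqrt_mult)

lemma scale_disc: "\<lbrakk>z \<in> disc n; 0 \<le> t; t \<le> 1\<rbrakk> \<Longrightarrow> (\<lambda>i. t * z i) \<in> disc n"
  unfolding disc_rad by (auto simp: rad_scale intro!: mult_le_one) (simp add: rad_def sum_nonneg)

lemma rscale_bounds:
  assumes "x \<in> disc n" "0 \<le> t" "t \<le> 1"
  shows "1/2 \<le> rscale n x t" "rscale n x t \<le> 1" "rad n x \<le> rscale n x t" "1 - t / 2 \<le> rscale n x t"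
proof -
  have "1/2 \<le> 1 - t / 2" using assms by simp
  then show "1/2 \<le> rscale n x t" by (simp add: rscale_def le_max_iff_disj)
qed (use assms in \<open>auto simp: rscale_def disc_rad\<close>)

lemma rad_rpt:
  assumes "x \<in> disc n" "0 \<le> t" "t \<le> 1"
  shows "rad n (rpt n x t) = rad n x / rscale n x t"
  using rad_scale[of "1 / rscale n x t" n x] rscale_bounds[OF assms] by (simp add: rpt_def)

lemma rpt_disc:
  assumes "x \<in> disc n" "0 \<le> t" "t \<le> 1"
  shows "rpt n x t \<in> disc n"
  using rscale_bounds[OF assms] assms(1) unfolding disc_rad rad_rpt[OF assms] by (auto simp: rpt_def)

lemma rht_range:
  assumes "x \<in> disc n" "0 \<le> t" "t \<le> 1"
  shows "0 \<le> rht n x t" "rht n x t \<le> 1"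
proof -
  note b = rscale_bounds[OF assms]
  have "(2 - t) / rscale n x t \<le> 2" using b by (simp add: divide_le_eq)
  then show "0 \<le> rht n x t" by (simp add: rht_def)
  have "1 \<le> (2 - t) / rscale n x t" using b assms by (simp add: le_divide_eq)
  then show "rht n x t \<le> 1" by (simp add: rht_def)
qed

text \<open>A ray that leaves through the bottom ends at height 0, so any other exit point lies on
  the side.\<close>

lemma rpt_sphere:
  assumes "x \<in> disc n" "0 \<le> t" "t \<le> 1" "rht n x t \<noteq> 0"
  shows "rpt n x t \<in> sphere_bd n"
proof -
  note b = rscale_bounds[OF assms(1-3)]
  have "rscale n x t = rad n x"
  proof (rule ccontr)
    assume "rscale n x t \<noteq> rad n x"
    then have e: "rscale n x t = 1 - t / 2" by (auto simp: rscale_def max_def split: if_splits)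
    have "rht n x t = 0" unfolding rht_def e using assms(2,3) by (simp add: field_simps)
    then show False using assms(4) by simp
  qed
  then have "rad n (rpt n x t) = 1" using rad_rpt[OF assms(1-3)] b by simp
  then show ?thesis using assms(1) by (simp add: sphere_rad disc_rad rpt_def)
qed

lemma rproj_fixed:
  assumes "x \<in> disc n" "0 \<le> t" "t \<le> 1" "x \<in> sphere_bd n \<or> t = 0"
  shows "rpt n x t = x" "rht n x t = t"
proof -
  have "rscale n x t = 1" using assms by (auto simp: rscale_def sphere_rad disc_rad max_def)
  then show "rpt n x t = x" "rht n x t = t" by (simp_all add: rpt_def rht_def)
qed

lemma continuous_rproj:
  shows "continuous_map (prod_topology (subtopology RN (disc n)) I01) (subtopology RN (disc n)) (\<lambda>w. rpt n (fst w) (snd w))"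
    and "continuous_map (prod_topology (subtopology RN (disc n)) I01) I01 (\<lambda>w. rht n (fst w) (snd w))"
proof -
  have co: "continuous_on (disc n \<times> {0..1}) (\<lambda>w. fst w i)" for i
    by (rule continuous_on_product_then_coordinatewise) (intro continuous_intros)
  have m: "continuous_on (disc n \<times> {0..1}) (\<lambda>w. rscale n (fst w) (snd w))"
    unfolding rscale_def rad_def by (intro continuous_intros co) auto
  have nz: "rscale n (fst w) (snd w) \<noteq> 0" if "w \<in> disc n \<times> {0..1}" for w
    using rscale_bounds(1)[of "fst w" n "snd w"] that by auto
  have "continuous_on (disc n \<times> {0..1}) (\<lambda>w. rpt n (fst w) (snd w))"
    unfolding rpt_def by (rule continuous_on_coordinatewise_then_product) (intro continuous_intros co m ballI nz)
  then show "continuous_map (prod_topology (subtopology RN (disc n)) I01) (subtopology RN (disc n)) (\<lambda>w. rpt n (fst w) (snd w))"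
    unfolding RN_euclidean by (auto simp: rpt_disc)
  have "continuous_on (disc n \<times> {0..1}) (\<lambda>w. rht n (fst w) (snd w))"
    unfolding rht_def by (intro continuous_intros m ballI nz)
  then show "continuous_map (prod_topology (subtopology RN (disc n)) I01) I01 (\<lambda>w. rht n (fst w) (snd w))"
    unfolding RN_euclidean by (auto simp: rht_range)
qed

locale cw_pair =
  fixes X :: "'a topology" and C :: "'a set set" and d \<phi> and D :: "'a set set"
  assumes cw: "cw_structure X C d \<phi>" and DC: "D \<subseteq> C" and closed_sub: "closedin X (\<Union>D)"
begin

abbreviation "A \<equiv> \<Union>D"
definition "cl c = \<phi> c ` disc (d c)"

lemma
  shows hausdorff: "Hausdorff_space X"
    and char_map: "\<And>c. c \<in> C \<Longrightarrow> continuous_map (subtopology RN (disc (d c))) X (\<phi> c)"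
    and char_open: "\<And>c. c \<in> C \<Longrightarrow> \<phi> c ` (disc (d c) - sphere_bd (d c)) = c"
    and char_homeo: "\<And>c. c \<in> C \<Longrightarrow> homeomorphic_map (subtopology RN (disc (d c) - sphere_bd (d c))) (subtopology X c) (\<phi> c)"
    and cells_disjoint: "\<And>c c'. \<lbrakk>c \<in> C; c' \<in> C; c \<noteq> c'\<rbrakk> \<Longrightarrow> c \<inter> c' = {}"
    and cells_cover: "\<Union>C = topspace X"
    and char_boundary: "\<And>c. c \<in> C \<Longrightarrow> \<phi> c ` sphere_bd (d c) \<subseteq> \<Union>{c'\<in>C. d c' < d c}"
    and closure_finite: "\<And>c. c \<in> C \<Longrightarrow> finite {c'\<in>C. c' \<inter> cl c \<noteq> {}}"
    and weak: "\<And>S. S \<subseteq> topspace X \<Longrightarrow> closedin X S \<longleftrightarrow> (\<forall>c\<in>C. closedin (subtopology X (cl c)) (S \<inter> cl c))"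
  using cw unfolding cw_structure_def cl_def by simp_all

lemma char_in: "\<lbrakk>c \<in> C; z \<in> disc (d c)\<rbrakk> \<Longrightarrow> \<phi> c z \<in> topspace X"
  using funcset_mem[OF char_map[unfolded continuous_map_def, THEN conjunct1]] by (simp add: RN_euclidean)

lemma compact_space_disc: "compact_space (subtopology RN (disc n))"
  by (simp add: RN_euclidean compact_space_subtopology compact_disc)

lemma cell_in_cl: "c \<in> C \<Longrightarrow> c \<subseteq> cl c"
  using char_open[of c] by (auto simp: cl_def)

lemma closed_cl: "c \<in> C \<Longrightarrow> closedin X (cl c)"
proof -
  assume c: "c \<in> C"
  have "compactin (subtopology RN (disc (d c))) (disc (d c))"
    using compact_space_disc[of "d c"] by (simp add: compact_space_def RN_euclidean)
  then have "compactin X (cl c)" unfolding cl_def by (rule image_compactin[OF _ char_map[OF c]])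
  then show ?thesis by (rule compactin_imp_closedin[OF hausdorff])
qed

text \<open>A continuous surjection from a compact space onto a Hausdorff space is a quotient map;
  continuity on a closed cell can therefore be tested on its disc.\<close>

lemma quotient_char: "c \<in> C \<Longrightarrow> quotient_map (subtopology RN (disc (d c))) (subtopology X (cl c)) (\<phi> c)"
  by (rule T1_Spaces.continuous_imp_quotient_map)
    (use char_map char_in hausdorff compact_space_disc in
      \<open>auto simp: cl_def continuous_map_in_subtopology Hausdorff_space_subtopology RN_euclidean\<close>)

text \<open>Along a radius all points before the end lie in the open cell, hence in
  \<open>A\<close>; closedness of \<open>A\<close> adds the end point. Thus a closed union of cells
  contains the boundaries of its cells.\<close>

lemma sub_cl: "c \<in> D \<Longrightarrow> cl c \<subseteq> A"
proof
  fix x assume c: "c \<in> D" and x: "x \<in> cl c"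
  then have cC: "c \<in> C" using DC by auto
  obtain z where z: "z \<in> disc (d c)" "x = \<phi> c z" using x by (auto simp: cl_def)
  have in_open: "\<phi> c y \<in> A" if "y \<in> disc (d c) - sphere_bd (d c)" for y
    using char_open[OF cC] c that by blast
  let ?g = "\<lambda>t. \<phi> c (\<lambda>i. t * z i)"
  have "continuous_map I01 (subtopology RN (disc (d c))) (\<lambda>t i. t * z i)"
    unfolding RN_euclidean using z(1)
    by (auto simp: scale_disc intro!: continuous_on_coordinatewise_then_product continuous_intros)
  then have "continuous_map I01 X ?g" by (rule continuous_map_comp[OF char_map[OF cC]])
  then have cl: "closedin I01 {t \<in> topspace I01. ?g t \<in> A}"
    by (rule closedin_continuous_map_preimage[OF _ closed_sub])
  have "?g t \<in> A" if "0 \<le> t" "t < 1" for t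
  proof (rule in_open)
    have "t * rad (d c) z \<le> t * 1" using z(1) that by (intro mult_left_mono) (auto simp: disc_rad)
    then show "(\<lambda>i. t * z i) \<in> disc (d c) - sphere_bd (d c)"
      using z(1) that by (auto simp: disc_rad sphere_rad rad_scale)
  qed
  then have sub: "{0..<1} \<subseteq> {t \<in> topspace I01. ?g t \<in> A}" by auto
  have "closed {t \<in> topspace I01. ?g t \<in> A}" using cl closedin_closed_trans by blast
  then have "closure {0..<1::real} \<subseteq> {t \<in> topspace I01. ?g t \<in> A}" using sub closure_minimal by blast
  then have "1 \<in> {t \<in> topspace I01. ?g t \<in> A}" by (rule subsetD) simp
  then have "?g 1 \<in> A" by simp
  then show "x \<in> A" using z by simp
qed

section \<open>The retraction of the cylinder over a CW complex\<close>

definition "cell x = (THE c. c \<in> C \<and> x \<in> c)"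

lemma cell_eq: "\<lbrakk>c \<in> C; x \<in> c\<rbrakk> \<Longrightarrow> cell x = c"
  unfolding cell_def using cells_disjoint by (intro the_equality) blast+

lemma cell_in: "x \<in> topspace X \<Longrightarrow> cell x \<in> C \<and> x \<in> cell x"
  using cells_cover cell_eq by (metis UnionE)

text \<open>The set \<open>X \<times> 0 \<union> A \<times> I\<close>, onto which the cylinder over
  \<open>X\<close> is to be retracted.\<close>

definition fixed :: "'a \<times> real \<Rightarrow> bool" where "fixed p \<longleftrightarrow> fst p \<in> A \<or> snd p = 0"

text \<open>One step of the retraction: over an open cell outside \<open>A\<close>, the cylinder is
  projected radially onto its bottom and side, in the coordinates of the characteristic map.\<close>

definition push :: "'a \<times> real \<Rightarrow> 'a \<times> real" where
  "push p = (if fixed p then p else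
     (let c = cell (fst p); z = inv_into (disc (d c) - sphere_bd (d c)) (\<phi> c) (fst p)
      in (\<phi> c (rpt (d c) z (snd p)), rht (d c) z (snd p))))"

lemma push_char:
  assumes c: "c \<in> C - D" and z: "z \<in> disc (d c) - sphere_bd (d c)" and t: "t \<noteq> 0"
  shows "push (\<phi> c z, t) = (\<phi> c (rpt (d c) z t), rht (d c) z t)"
proof -
  have zc: "\<phi> c z \<in> c" using char_open[of c] c z by blast
  have "\<phi> c z \<notin> A"
  proof
    assume "\<phi> c z \<in> A"
    then obtain c' where "c' \<in> D" "\<phi> c z \<in> c'" by blast
    then show False using cells_disjoint[of c c'] c zc DC by blast
  qed
  then have nf: "\<not> fixed (\<phi> c z, t)" using t by (simp add: fixed_def)
  have "inj_on (\<phi> c) (disc (d c) - sphere_bd (d c))"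
    using homeomorphic_imp_injective_map[OF char_homeo[of c]] c by (simp add: RN_euclidean)
  then have "inv_into (disc (d c) - sphere_bd (d c)) (\<phi> c) (\<phi> c z) = z" using z by (rule inv_into_f_f)
  moreover have "cell (\<phi> c z) = c" using c zc by (intro cell_eq) auto
  ultimately show ?thesis using nf by (simp add: push_def Let_def)
qed

lemma push_fixed: "fixed p \<Longrightarrow> (push ^^ k) p = p"
  by (induction k) (auto simp: push_def)

text \<open>Pushing each point until it is fixed takes the place of a limit over skeleta. The number
  of pushes depends on the point, so the dimension of \<open>X\<close> may be infinite.\<close>

definition "retr p = (push ^^ (LEAST k. fixed ((push ^^ k) p))) p"

lemma retr_eq: "fixed ((push ^^ k) p) \<Longrightarrow> retr p = (push ^^ k) p"
proof -
  assume k: "fixed ((push ^^ k) p)"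
  define j where "j = (LEAST k. fixed ((push ^^ k) p))"
  have j: "fixed ((push ^^ j) p)" "j \<le> k" unfolding j_def using k by (auto intro: LeastI Least_le)
  have "(push ^^ k) p = (push ^^ (k - j)) ((push ^^ j) p)"
    using j(2) by (simp flip: funpow_add[THEN fun_cong, unfolded o_apply])
  then show ?thesis using push_fixed[OF j(1)] by (simp add: retr_def j_def)
qed

text \<open>A push that does not stop at height 0 ends over the boundary sphere of its cell, hence
  in a cell of smaller dimension.\<close>

lemma push_terminates:
  assumes "x \<in> topspace X" "0 \<le> t" "t \<le> 1"
  shows "\<exists>k. fixed ((push ^^ k) (x, t)) \<and> (push ^^ k) (x, t) \<in> topspace X \<times> {0..1}"
  using assms
proof (induction "d (cell x)" arbitrary: x t rule: less_induct)
  case less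
  show ?case
  proof (cases "fixed (x, t)")
    case True
    then show ?thesis using less.prems by (intro exI[of _ 0]) auto
  next
    case False
    define c where "c = cell x"
    have c: "c \<in> C" "x \<in> c" using cell_in[OF less.prems(1)] by (auto simp: c_def)
    have cD: "c \<in> C - D" using False c by (auto simp: fixed_def)
    obtain z where z: "z \<in> disc (d c) - sphere_bd (d c)" "x = \<phi> c z" using char_open[OF c(1)] c(2) by blast
    have zd: "z \<in> disc (d c)" using z by auto
    let ?y = "rpt (d c) z t" and ?s = "rht (d c) z t"
    have y: "?y \<in> disc (d c)" by (rule rpt_disc[OF zd less.prems(2,3)])
    note s = rht_range[OF zd less.prems(2,3)]
    have p: "push (x, t) = (\<phi> c ?y, ?s)"
      unfolding z(2) by (rule push_char[OF cD z(1)]) (use False in \<open>auto simp: fixed_def\<close>)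
    show ?thesis
    proof (cases "?s = 0")
      case True
      then show ?thesis using p char_in[OF c(1) y] by (intro exI[of _ 1]) (auto simp: fixed_def)
    next
      case False
      then have "?y \<in> sphere_bd (d c)" by (rule rpt_sphere[OF zd less.prems(2,3)])
      then obtain c' where c': "c' \<in> C" "d c' < d c" "\<phi> c ?y \<in> c'" using char_boundary[OF c(1)] by blast
      then have "d (cell (\<phi> c ?y)) < d (cell x)" using cell_eq[OF c'(1,3)] by (simp add: c_def)
      from less.hyps[OF this char_in[OF c(1) y] s]
      obtain k where "fixed ((push ^^ k) (\<phi> c ?y, ?s))" "(push ^^ k) (\<phi> c ?y, ?s) \<in> topspace X \<times> {0..1}"
        by (elim exE conjE) (rule that)
      then show ?thesis by (intro exI[of _ "Suc k"]) (simp add: p funpow_Suc_right del: funpow.simps)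
    qed
  qed
qed

lemma retr_in:
  assumes "x \<in> topspace X" "0 \<le> t" "t \<le> 1"
  shows "fixed (retr (x, t))" "retr (x, t) \<in> topspace X \<times> {0..1}"
  using push_terminates[OF assms] retr_eq by metis+

lemma retr_fixed: "fixed p \<Longrightarrow> retr p = p"
  using retr_eq[of 0 p] by simp

text \<open>The equation covers the closed disc, since the radial projection is the identity on the
  side and the bottom. So over the whole cylinder of a cell \<open>retr\<close> factors through a
  continuous projection, although \<open>push\<close> is defined by cases.\<close>

lemma retr_char:
  assumes c: "c \<in> C - D" and z: "z \<in> disc (d c)" and t: "0 \<le> t" "t \<le> 1"
  shows "retr (\<phi> c z, t) = retr (\<phi> c (rpt (d c) z t), rht (d c) z t)"
proof (cases "z \<in> sphere_bd (d c) \<or> t = 0")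
  case True
  then show ?thesis using rproj_fixed[OF z t] by simp
next
  case False
  then have p: "push (\<phi> c z, t) = (\<phi> c (rpt (d c) z t), rht (d c) z t)" using z by (intro push_char[OF c]) auto
  have "rpt (d c) z t \<in> disc (d c)" by (rule rpt_disc[OF z t])
  then obtain k where k: "fixed ((push ^^ k) (push (\<phi> c z, t)))"
    unfolding p using push_terminates[OF char_in rht_range[OF z t]] c by blast
  have "retr (push (\<phi> c z, t)) = (push ^^ k) (push (\<phi> c z, t))" by (rule retr_eq[OF k])
  also have "\<dots> = (push ^^ Suc k) (\<phi> c z, t)" by (simp add: funpow_Suc_right del: funpow.simps)
  also have "\<dots> = retr (\<phi> c z, t)"
    by (rule retr_eq[symmetric]) (use k in \<open>simp add: funpow_Suc_right del: funpow.simps\<close>)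
  finally show ?thesis by (simp add: p)
qed

text \<open>As a map on \<open>X\<close> alone, the curried retraction can be tested on closed cells
  through the weak topology.\<close>

definition "tracks x = restrict (\<lambda>t. retr (x, t)) {0..1}"

abbreviation "P \<equiv> path_space (prod_topology X I01)"

text \<open>Induction on the dimension of the cell. After radial projection only the bottom and the
  side of the cylinder matter: the bottom is fixed, and the side maps into finitely many closed
  cells of lower dimension.\<close>

lemma continuous_tracks_cl: "c \<in> C \<Longrightarrow> continuous_map (subtopology X (cl c)) P tracks"
proof (induction "d c" arbitrary: c rule: less_induct)
  case less
  show ?case
  proof (cases "c \<in> D")
    case True
    have "continuous_map (subtopology X (cl c)) P (\<lambda>x. restrict (\<lambda>t. (x, t)) {0..1})"
      by (rule continuous_map_path_curry) (intro continuous_map_pairedI continuous_map_proj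
          continuous_map_into_fulltopology[OF continuous_map_proj(1)])
    then show ?thesis
    proof (rule continuous_map_eq)
      fix x assume "x \<in> topspace (subtopology X (cl c))"
      then have "fixed (x, t)" for t using sub_cl[OF True] by (auto simp: fixed_def)
      then show "restrict (\<lambda>t. (x, t)) {0..1} = tracks x" by (simp add: tracks_def retr_fixed)
    qed
  next
    case False
    then have c: "c \<in> C - D" "c \<in> C" using less.prems by auto
    let ?B = "subtopology RN (disc (d c))"
    \<comment> \<open>Closure finiteness makes this family finite, so the tracks on its closed cells
      paste to a continuous map; these closed cells cover the image of the boundary sphere.\<close>
    define F where "F = {c' \<in> C. c' \<inter> cl c \<noteq> {} \<and> d c' < d c}"
    have fin: "finite F" using finite_subset[OF _ closure_finite[OF c(2)], of F] by (auto simp: F_def)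
    have tF: "continuous_map (subtopology X (\<Union>(cl ` F))) P tracks"
    proof (rule pasting_lemma_closed[OF fin, where T=cl and f="\<lambda>_. tracks"])
      fix c' assume c': "c' \<in> F"
      then have "subtopology (subtopology X (\<Union>(cl ` F))) (cl c') = subtopology X (cl c')"
        by (auto simp: subtopology_subtopology Int_absorb1 UN_upper)
      then show "continuous_map (subtopology (subtopology X (\<Union>(cl ` F))) (cl c')) P tracks"
        using less.hyps[of c'] c' by (simp add: F_def)
      show "closedin (subtopology X (\<Union>(cl ` F))) (cl c')"
        using closed_cl[of c'] c' by (auto simp: F_def intro!: closedin_subset_topspace)
    qed auto
    have bdF: "\<phi> c y \<in> \<Union>(cl ` F)" if y: "y \<in> sphere_bd (d c)" for y
    proof -
      obtain c' where c': "c' \<in> C" "d c' < d c" "\<phi> c y \<in> c'" using char_boundary[OF c(2)] y by blast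
      have "\<phi> c y \<in> cl c" using y sphere_disc by (auto simp: cl_def)
      then have "c' \<in> F" using c' by (auto simp: F_def)
      then show ?thesis using cell_in_cl[OF c'(1)] c'(3) by blast
    qed
    let ?K = "subtopology (prod_topology ?B I01) {w. fst w \<in> sphere_bd (d c) \<or> snd w = 0}"
    have Kd: "fst w \<in> disc (d c) \<and> 0 \<le> snd w \<and> snd w \<le> 1 \<and> (fst w \<in> sphere_bd (d c) \<or> snd w = 0)"
      if "w \<in> topspace ?K" for w using that by (auto simp: RN_euclidean)
    have fK: "continuous_map ?K ?B fst" and sK: "continuous_map ?K I01 snd"
      by (intro continuous_map_from_subtopology continuous_map_fst continuous_map_snd)+
    have phK: "continuous_map ?K X (\<lambda>w. \<phi> c (fst w))" by (rule continuous_map_comp[OF char_map[OF c(2)] fK])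
    have sq: "continuous_map ?K euclideanreal (\<lambda>w. 1 - (\<Sum>i<d c. (fst w i)\<^sup>2))"
    proof -
      have "continuous_map ?B euclideanreal (\<lambda>x. 1 - (\<Sum>i<d c. (x i)\<^sup>2))"
        unfolding RN_euclidean by (auto intro!: continuous_intros continuous_coordinate)
      from continuous_map_comp[OF this fK] show ?thesis .
    qed
    have sq0: "0 \<le> 1 - (\<Sum>i<d c. (fst w i)\<^sup>2)" "1 - (\<Sum>i<d c. (fst w i)\<^sup>2) \<le> 0 \<longleftrightarrow> fst w \<in> sphere_bd (d c)"
      if "w \<in> topspace ?K" for w
      using Kd[OF that] by (auto simp: disc_def sphere_bd_def)
    \<comment> \<open>On \<open>?K\<close> either the height or
      \<open>1 - (\<Sum>i<d c. (fst w i)\<^sup>2)\<close> is 0, and both are nonnegative. Comparing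
      them separates the bottom from the side by closed conditions, and where they agree the height
      is 0.\<close>
    have "continuous_map ?K (prod_topology X I01)
      (\<lambda>w. if snd w \<le> 1 - (\<Sum>i<d c. (fst w i)\<^sup>2) then (\<phi> c (fst w), 0) else tracks (\<phi> c (fst w)) (snd w))"
    proof (rule continuous_map_cases_le[OF continuous_map_I01D[OF sK] sq])
      show "continuous_map (subtopology ?K {w \<in> topspace ?K. snd w \<le> 1 - (\<Sum>i<d c. (fst w i)\<^sup>2)}) (prod_topology X I01)
          (\<lambda>w. (\<phi> c (fst w), 0))"
        by (intro continuous_map_pairedI continuous_map_from_subtopology[OF phK]) auto
      let ?L = "subtopology ?K {w \<in> topspace ?K. 1 - (\<Sum>i<d c. (fst w i)\<^sup>2) \<le> snd w}"
      have Ls: "fst w \<in> sphere_bd (d c)" if "w \<in> topspace ?L" for w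
      proof -
        have w: "w \<in> topspace ?K" "1 - (\<Sum>i<d c. (fst w i)\<^sup>2) \<le> snd w" using that by auto
        then show ?thesis using Kd[OF w(1)] sq0[OF w(1)] by auto
      qed
      have "continuous_map ?L (subtopology X (\<Union>(cl ` F))) (\<lambda>w. \<phi> c (fst w))"
        unfolding continuous_map_in_subtopology
        by (rule conjI[OF continuous_map_from_subtopology[OF phK]], rule funcsetI, rule bdF, erule Ls)
      from continuous_map_path_app[OF continuous_map_comp[OF tF this] continuous_map_from_subtopology[OF sK]]
      show "continuous_map ?L (prod_topology X I01) (\<lambda>w. tracks (\<phi> c (fst w)) (snd w))" .
      fix w assume w: "w \<in> topspace ?K" "snd w = 1 - (\<Sum>i<d c. (fst w i)\<^sup>2)"
      then have "snd w = 0" using Kd[OF w(1)] sq0[OF w(1)] by auto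
      then show "(\<phi> c (fst w), 0) = tracks (\<phi> c (fst w)) (snd w)" by (simp add: tracks_def retr_fixed fixed_def)
    qed
    then have g: "continuous_map ?K (prod_topology X I01) (\<lambda>w. retr (\<phi> c (fst w), snd w))"
    proof (rule continuous_map_eq)
      fix w assume w: "w \<in> topspace ?K"
      show "(if snd w \<le> 1 - (\<Sum>i<d c. (fst w i)\<^sup>2) then (\<phi> c (fst w), 0) else tracks (\<phi> c (fst w)) (snd w)) = retr (\<phi> c (fst w), snd w)"
        using Kd[OF w] sq0[OF w] by (auto simp: tracks_def retr_fixed fixed_def)
    qed
    have r: "continuous_map (prod_topology ?B I01) ?K (\<lambda>w. (rpt (d c) (fst w) (snd w), rht (d c) (fst w) (snd w)))"
      unfolding continuous_map_in_subtopology
    proof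
      show "continuous_map (prod_topology ?B I01) (prod_topology ?B I01) (\<lambda>w. (rpt (d c) (fst w) (snd w), rht (d c) (fst w) (snd w)))"
        by (rule continuous_map_pairedI[OF continuous_rproj])
      show "(\<lambda>w. (rpt (d c) (fst w) (snd w), rht (d c) (fst w) (snd w))) \<in> topspace (prod_topology ?B I01)
          \<rightarrow> {w. fst w \<in> sphere_bd (d c) \<or> snd w = 0}"
        using rpt_sphere[of _ "d c"] by (auto simp: RN_euclidean)
    qed
    have "continuous_map (prod_topology ?B I01) (prod_topology X I01) (\<lambda>w. retr (\<phi> c (fst w), snd w))"
    proof (rule continuous_map_eq[OF continuous_map_comp[OF g r]])
      fix w assume "w \<in> topspace (prod_topology ?B I01)"
      then have "fst w \<in> disc (d c)" "0 \<le> snd w" "snd w \<le> 1" by (auto simp: RN_euclidean)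
      from retr_char[OF c(1) this] show "retr (\<phi> c (fst (rpt (d c) (fst w) (snd w), rht (d c) (fst w) (snd w))),
          snd (rpt (d c) (fst w) (snd w), rht (d c) (fst w) (snd w))) = retr (\<phi> c (fst w), snd w)" by simp
    qed
    then have "continuous_map ?B P (\<lambda>z. restrict (\<lambda>t. retr (\<phi> c z, t)) {0..1})"
      by (rule continuous_map_path_curry)
    then have "continuous_map ?B P (tracks \<circ> \<phi> c)" by (simp add: tracks_def o_def)
    then show ?thesis by (rule continuous_compose_quotient_map[OF quotient_char[OF c(2)]])
  qed
qed

lemma continuous_tracks: "continuous_map X P tracks"
  unfolding continuous_map_closedin
proof (intro conjI allI impI)
  have ct: "tracks x \<in> topspace P" if "x \<in> topspace X" for x
  proof -
    have "x \<in> topspace (subtopology X (cl (cell x)))" using that cell_in[OF that] cell_in_cl by auto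
    then show ?thesis
      using funcset_mem[OF continuous_tracks_cl[of "cell x", unfolded continuous_map_def, THEN conjunct1]] cell_in[OF that] by blast
  qed
  then show "tracks \<in> topspace X \<rightarrow> topspace P" by auto
  fix Q assume Q: "closedin P Q"
  show "closedin X {x \<in> topspace X. tracks x \<in> Q}"
  proof (subst weak, blast, rule ballI)
    fix c assume c: "c \<in> C"
    have "closedin (subtopology X (cl c)) {x \<in> topspace (subtopology X (cl c)). tracks x \<in> Q}"
      by (rule closedin_continuous_map_preimage[OF continuous_tracks_cl[OF c] Q])
    moreover have "{x \<in> topspace (subtopology X (cl c)). tracks x \<in> Q} = {x \<in> topspace X. tracks x \<in> Q} \<inter> cl c" by auto
    ultimately show "closedin (subtopology X (cl c)) ({x \<in> topspace X. tracks x \<in> Q} \<inter> cl c)" by simp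
  qed
qed

text \<open>The retraction of \<open>(x, 1)\<close> ends either at height 0 or over
  \<open>A\<close>. One minus its height is therefore below 1 only if the deformed point lies in
  \<open>A\<close>, while points of \<open>A\<close> keep height 1.\<close>

lemma cw_halo: "halo_deformation X A (\<lambda>x. 1 - snd (retr (x, 1))) (\<lambda>s x. fst (retr (x, s)))"
proof -
  have "continuous_map (prod_topology X I01) (prod_topology X I01) (\<lambda>w. tracks (fst w) (snd w))"
    by (rule continuous_map_path_app[OF continuous_map_comp[OF continuous_tracks continuous_map_proj(1)] continuous_map_proj(2)])
  then have R: "continuous_map (prod_topology X I01) (prod_topology X I01) (\<lambda>w. retr (fst w, snd w))"
    by (rule continuous_map_eq) (auto simp: tracks_def)
  have "continuous_map X (prod_topology X I01) (\<lambda>x. retr (x, 1))"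
    using continuous_map_comp2[of X I01 _ "\<lambda>x t. retr (x, t)" X "\<lambda>x. x" "\<lambda>_. 1"] R continuous_map_self by auto
  then have u: "continuous_map X euclideanreal (\<lambda>x. 1 - snd (retr (x, 1)))"
    by (intro continuous_map_diff continuous_map_I01D[OF continuous_map_snd_comp]) auto
  have "continuous_map (prod_topology I01 X) (prod_topology X I01) (\<lambda>w. retr (snd w, fst w))"
    using continuous_map_comp2[of X I01 _ "\<lambda>x t. retr (x, t)" "prod_topology I01 X" snd fst] R
    by (auto intro: continuous_map_fst continuous_map_snd)
  then have "continuous_map (prod_topology I01 X) X (\<lambda>w. fst (retr (snd w, fst w)))"
    by (rule continuous_map_fst_comp)
  moreover have "A \<subseteq> topspace X" using closedin_subset[OF closed_sub] .
  moreover have "fst (retr (x, 1)) \<in> A" if "x \<in> topspace X" "1 - snd (retr (x, 1)) < 1" for x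
    using retr_in(1)[OF that(1), of 1] that(2) by (simp add: fixed_def)
  moreover have "snd (retr (x, 1)) \<le> 1" if "x \<in> topspace X" for x
    using retr_in(2)[OF that, of 1] by (simp add: mem_Times_iff)
  ultimately show ?thesis
    unfolding halo_deformation_def using u by (auto simp: retr_fixed fixed_def)
qed

end

lemma pointed_cw_pair_halo:
  assumes "pointed_cw_pair X A a"
  obtains u D where "halo_deformation X A u D"
proof -
  from assms obtain C d \<phi> D where "cw_structure X C d \<phi>" "D \<subseteq> C" "A = \<Union>D" "closedin X A"
    unfolding pointed_cw_pair_def by blast
  then interpret cw_pair X C d \<phi> D by unfold_locales auto
  from that cw_halo \<open>A = \<Union>D\<close> show ?thesis by simp
qed

lemma pointed_cw_pair_point: "pointed_cw_pair X A a \<Longrightarrow> a \<in> A"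
  unfolding pointed_cw_pair_def by blast

section \<open>Polyhedral products\<close>

lemma topspace_polyhedral_product:
  assumes "\<And>v. v \<in> V \<Longrightarrow> A v \<subseteq> topspace (X v)"
  shows "x \<in> topspace (polyhedral_product V K X A) \<longleftrightarrow> x \<in> extensional V \<and>
    (\<exists>\<sigma>\<in>K. \<forall>v\<in>V. x v \<in> topspace (X v) \<and> (v \<notin> \<sigma> \<longrightarrow> x v \<in> A v))"
proof -
  have "x \<in> PiE V (\<lambda>v. if v \<in> \<sigma> then topspace (X v) else A v) \<longleftrightarrow>
      x \<in> extensional V \<and> (\<forall>v\<in>V. x v \<in> topspace (X v) \<and> (v \<notin> \<sigma> \<longrightarrow> x v \<in> A v))" for \<sigma>
    using assms by (auto simp: PiE_iff subset_iff split: if_splits)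
  then show ?thesis
    unfolding polyhedral_product_def by (auto simp: PiE_iff)
qed

lemma polyhedral_product_subtopology:
  assumes "\<And>v. v \<in> V \<Longrightarrow> A v \<subseteq> topspace (X v)" "N \<subseteq> M"
  shows "polyhedral_product V N X A = subtopology (polyhedral_product V M X A) (topspace (polyhedral_product V N X A))"
proof -
  have top: "x \<in> topspace (polyhedral_product V K X A) \<longleftrightarrow> x \<in> extensional V \<and>
    (\<exists>\<sigma>\<in>K. \<forall>v\<in>V. x v \<in> topspace (X v) \<and> (v \<notin> \<sigma> \<longrightarrow> x v \<in> A v))" for x K
    by (rule topspace_polyhedral_product) (rule assms(1))
  have "topspace (polyhedral_product V N X A) \<subseteq> topspace (polyhedral_product V M X A)"
    using assms(2) unfolding subset_iff top by blast
  moreover have "polyhedral_product V N X A = subtopology (product_topology X V) (topspace (polyhedral_product V N X A))"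
    unfolding polyhedral_product_def by (simp only: topspace_subtopology subtopology_restrict)
  moreover have "polyhedral_product V M X A = subtopology (product_topology X V) (topspace (polyhedral_product V M X A))"
    unfolding polyhedral_product_def by (simp only: topspace_subtopology subtopology_restrict)
  ultimately show ?thesis by (metis inf.absorb2 subtopology_subtopology)
qed

lemma continuous_map_polyhedral_proj: "v \<in> V \<Longrightarrow> continuous_map (polyhedral_product V K X A) (X v) (\<lambda>x. x v)"
  unfolding polyhedral_product_def
  by (intro continuous_map_from_subtopology continuous_map_product_projection)

lemma continuous_map_into_polyhedral:
  assumes "\<And>v. v \<in> V \<Longrightarrow> continuous_map Z (X v) (\<lambda>z. f z v)"
    and "\<And>z. z \<in> topspace Z \<Longrightarrow> f z \<in> topspace (polyhedral_product V K X A)"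
  shows "continuous_map Z (polyhedral_product V K X A) f"
  using assms(2) unfolding polyhedral_product_def continuous_map_in_subtopology continuous_map_componentwise
  by (auto simp: assms(1) PiE_iff)

text \<open>In \<open>u\<close> the sum over the vertices outside a face plays the part of "and",
  the product over the faces that of "or". A product below 1 has a factor below 1; all its
  nonnegative summands are then below 1, so the coordinates outside that face are moved into
  \<open>A v\<close>. Acting coordinatewise, the deformation preserves every polyhedral
  product.\<close>

lemma polyhedral_halo:
  assumes V: "finite V" and N: "N \<subseteq> Pow V" "N \<subseteq> M"
    and halo: "\<And>v. v \<in> V \<Longrightarrow> halo_deformation (X v) (A v) (u v) (D v)"
  shows "halo_deformation (polyhedral_product V M X A) (topspace (polyhedral_product V N X A))
     (\<lambda>x. \<Prod>\<sigma>\<in>N. \<Sum>v\<in>V - \<sigma>. u v (x v)) (\<lambda>s x. restrict (\<lambda>v. D v s (x v)) V)"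
proof -
  note h = halo_deformationD[OF halo]
  have AX: "A v \<subseteq> topspace (X v)" if "v \<in> V" for v using h(1)[OF that] .
  have top: "x \<in> topspace (polyhedral_product V K X A) \<longleftrightarrow> x \<in> extensional V \<and>
    (\<exists>\<sigma>\<in>K. \<forall>v\<in>V. x v \<in> topspace (X v) \<and> (v \<notin> \<sigma> \<longrightarrow> x v \<in> A v))" for x K
    by (rule topspace_polyhedral_product) (rule AX)
  have fN: "finite N" using finite_subset[OF N(1)] V by simp
  let ?P = "\<lambda>K. polyhedral_product V K X A"
  have D_in: "D v s y \<in> topspace (X v)" if "v \<in> V" "0 \<le> s" "s \<le> 1" "y \<in> topspace (X v)" for v s y
    using funcset_mem[OF h(5)[unfolded continuous_map_def, THEN conjunct1], of v "(s, y)"] that by auto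
  have DP: "restrict (\<lambda>v. D v s (x v)) V \<in> topspace (?P K)" if "x \<in> topspace (?P K)" "0 \<le> s" "s \<le> 1" for x s K
  proof -
    from that(1) obtain \<sigma> where s: "\<sigma> \<in> K" "\<And>v. v \<in> V \<Longrightarrow> x v \<in> topspace (X v) \<and> (v \<notin> \<sigma> \<longrightarrow> x v \<in> A v)"
      unfolding top by blast
    then have "\<forall>v\<in>V. D v s (x v) \<in> topspace (X v) \<and> (v \<notin> \<sigma> \<longrightarrow> D v s (x v) \<in> A v)"
      using D_in h(7) that(2,3) by blast
    then show ?thesis unfolding top using s(1) by auto
  qed
  have x_in: "x v \<in> topspace (X v)" if "x \<in> topspace (?P K)" "v \<in> V" for x v K
    using that unfolding top by blast
  have nonneg: "0 \<le> (\<Sum>v\<in>V - \<sigma>. u v (x v))" if "x \<in> topspace (?P M)" for x \<sigma>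
    by (rule sum_nonneg) (use h(3) x_in[OF that] in auto)
  show ?thesis
    unfolding halo_deformation_def
  proof (intro conjI ballI impI)
    show "topspace (?P N) \<subseteq> topspace (?P M)" using N(2) unfolding subset_iff top by blast
    show "continuous_map (?P M) euclideanreal (\<lambda>x. \<Prod>\<sigma>\<in>N. \<Sum>v\<in>V - \<sigma>. u v (x v))"
      using V fN by (auto intro!: continuous_map_prod continuous_map_sum continuous_map_comp[OF h(2)] continuous_map_polyhedral_proj)
    show "0 \<le> (\<Prod>\<sigma>\<in>N. \<Sum>v\<in>V - \<sigma>. u v (x v))" if "x \<in> topspace (?P M)" for x
      by (rule prod_nonneg) (use nonneg[OF that] in auto)
    show "(\<Prod>\<sigma>\<in>N. \<Sum>v\<in>V - \<sigma>. u v (x v)) = 0" if "x \<in> topspace (?P N)" for x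
    proof -
      from that obtain \<sigma> where s: "\<sigma> \<in> N" "\<And>v. v \<in> V \<Longrightarrow> v \<notin> \<sigma> \<Longrightarrow> x v \<in> A v"
        unfolding top by blast
      then have "(\<Sum>v\<in>V - \<sigma>. u v (x v)) = 0" using h(4) by (intro sum.neutral) auto
      then show ?thesis using s(1) fN by (auto intro!: prod_zero)
    qed
    show "continuous_map (prod_topology I01 (?P M)) (?P M) (\<lambda>w. restrict (\<lambda>v. D v (fst w) (snd w v)) V)"
    proof (rule continuous_map_into_polyhedral)
      fix v assume v: "v \<in> V"
      have "continuous_map (prod_topology I01 (?P M)) (X v) (\<lambda>w. snd w v)"
        by (rule continuous_map_comp[OF continuous_map_polyhedral_proj[OF v] continuous_map_proj(2)])
      then have "continuous_map (prod_topology I01 (?P M)) (X v) (\<lambda>w. D v (fst w) (snd w v))"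
        by (rule continuous_map_comp2[OF h(5)[OF v] continuous_map_proj(1)])
      then show "continuous_map (prod_topology I01 (?P M)) (X v) (\<lambda>w. restrict (\<lambda>v. D v (fst w) (snd w v)) V v)"
        using v by simp
    qed (auto intro: DP)
    show "restrict (\<lambda>v. D v 0 (x v)) V = x" if "x \<in> topspace (?P M)" for x
    proof (rule extensionalityI[of _ V])
      show "x \<in> extensional V" using that unfolding top by blast
      show "restrict (\<lambda>v. D v 0 (x v)) V v = x v" if "v \<in> V" for v
        using that h(6)[OF that x_in[OF \<open>x \<in> topspace (?P M)\<close> that]] by simp
    qed simp
    show "restrict (\<lambda>v. D v s (x v)) V \<in> topspace (?P N)" if "s \<in> {0..1}" "x \<in> topspace (?P N)" for s x
      using that by (auto intro: DP)
    show "restrict (\<lambda>v. D v 1 (x v)) V \<in> topspace (?P N)"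
      if x: "x \<in> topspace (?P M)" and less: "(\<Prod>\<sigma>\<in>N. \<Sum>v\<in>V - \<sigma>. u v (x v)) < 1" for x
    proof -
      have "\<exists>\<sigma>\<in>N. (\<Sum>v\<in>V - \<sigma>. u v (x v)) < 1"
      proof (rule ccontr)
        assume "\<not> ?thesis"
        then have "1 \<le> (\<Prod>\<sigma>\<in>N. \<Sum>v\<in>V - \<sigma>. u v (x v))" by (intro prod_ge_1) auto
        then show False using less by simp
      qed
      then obtain \<sigma> where s: "\<sigma> \<in> N" "(\<Sum>v\<in>V - \<sigma>. u v (x v)) < 1" by blast
      have "u v (x v) < 1" if "v \<in> V" "v \<notin> \<sigma>" for v
      proof -
        have "u v (x v) \<le> (\<Sum>v\<in>V - \<sigma>. u v (x v))"
          using that V h(3) x_in[OF x] by (intro member_le_sum[of _ _ "\<lambda>v. u v (x v)"]) auto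
        then show ?thesis using s(2) by simp
      qed
      then have "\<forall>v\<in>V. D v 1 (x v) \<in> topspace (X v) \<and> (v \<notin> \<sigma> \<longrightarrow> D v 1 (x v) \<in> A v)"
        using h(8) D_in[of _ 1] x_in[OF x] by auto
      then show ?thesis unfolding top using s(1) by auto
    qed
  qed
qed

section \<open>Halos and contractions of spaces of paths with fixed end\<close>

lemma hofib_id_in:
  "e \<in> topspace (hofib X X id b) \<longleftrightarrow> fst e \<in> topspace X \<and> snd e \<in> topspace (path_space X) \<and> snd e 0 = fst e \<and> snd e 1 = b"
  by (simp add: topspace_hofib)

text \<open>The start of a path is moved by \<open>D\<close>, and the track of this motion, run
  backwards over \<open>[0, s/2]\<close>, is put in front of the old path, which is squeezed into
  \<open>[s/2, 1]\<close>. The end at \<open>b\<close> is untouched. The denominator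
  \<open>2 - s\<close> is at least 1.\<close>

lemma path_halo:
  fixes b :: 'a
  assumes halo: "halo_deformation X S u D"
  defines "E \<equiv> hofib X X id b"
  shows "halo_deformation E {e \<in> topspace E. fst e \<in> S} (\<lambda>e. u (fst e))
    (\<lambda>s e. (D s (fst e), restrict (\<lambda>t. if 2 * t \<le> s then D (max 0 (s - 2 * t)) (fst e)
        else snd e (max 0 ((2 * t - s) / (2 - s)))) {0..1}))"
proof -
  note h = halo_deformationD[OF halo]
  note inE = hofib_id_in[of _ X b, folded E_def]
  have f: "continuous_map E X fst" and g: "continuous_map E (path_space X) snd"
    using continuous_map_from_hofib[OF continuous_map_self[of "hofib X X id b"]] unfolding E_def by auto
  have Dc: "continuous_map (prod_topology I01 E) E (\<lambda>w. (D (fst w) (fst (snd w)),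
      restrict (\<lambda>t. if 2 * t \<le> fst w then D (max 0 (fst w - 2 * t)) (fst (snd w))
        else snd (snd w) (max 0 ((2 * t - fst w) / (2 - fst w)))) {0..1}))"
    unfolding E_def
  proof (rule continuous_map_into_hofib, fold E_def)
    let ?Z = "prod_topology I01 E" let ?W = "prod_topology ?Z I01"
    show "continuous_map ?Z X (\<lambda>w. D (fst w) (fst (snd w)))"
      by (rule continuous_map_comp2[OF h(5) continuous_map_proj(1) continuous_map_comp[OF f continuous_map_proj(2)]])
    have "continuous_map ?W X (\<lambda>w. if 2 * snd w \<le> fst (fst w) then D (max 0 (fst (fst w) - 2 * snd w)) (fst (snd (fst w)))
        else snd (snd (fst w)) (max 0 ((2 * snd w - fst (fst w)) / (2 - fst (fst w)))))"
    proof (rule continuous_map_glue)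
      have m: "continuous_map ?W I01 (\<lambda>w. max 0 (fst (fst w) - 2 * snd w))"
        unfolding continuous_map_I01 by (intro conjI cont_real) auto
      show "continuous_map ?W X (\<lambda>w. D (max 0 (fst (fst w) - 2 * snd w)) (fst (snd (fst w))))"
        by (rule continuous_map_comp2[OF h(5) m continuous_map_comp[OF f continuous_map_proj(4)]])
      have q: "continuous_map ?W I01 (\<lambda>w. max 0 ((2 * snd w - fst (fst w)) / (2 - fst (fst w))))"
        unfolding continuous_map_I01 by (intro conjI cont_real continuous_map_real_divide) (auto simp: divide_le_eq)
      show "continuous_map ?W X (\<lambda>w. snd (snd (fst w)) (max 0 ((2 * snd w - fst (fst w)) / (2 - fst (fst w)))))"
        by (rule continuous_map_path_app[OF continuous_map_comp[OF g continuous_map_proj(4)] q])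
      fix w assume w: "w \<in> topspace ?W" "2 * snd w = fst (fst w)"
      then have "snd (fst w) \<in> topspace E" by auto
      then show "D (max 0 (fst (fst w) - 2 * snd w)) (fst (snd (fst w))) =
          snd (snd (fst w)) (max 0 ((2 * snd w - fst (fst w)) / (2 - fst (fst w))))"
        using w(2) h(6) by (simp add: inE)
    qed (intro cont_real; simp)+
    then show "continuous_map ?Z (path_space X) (\<lambda>w. restrict (\<lambda>t. if 2 * t \<le> fst w then D (max 0 (fst w - 2 * t)) (fst (snd w))
        else snd (snd w) (max 0 ((2 * t - fst w) / (2 - fst w)))) {0..1})"
      by (rule continuous_map_path_curry)
    fix w assume "w \<in> topspace ?Z"
    then have "0 \<le> fst w" "fst w \<le> 1" "snd w \<in> topspace E" by auto
    then show "restrict (\<lambda>t. if 2 * t \<le> fst w then D (max 0 (fst w - 2 * t)) (fst (snd w))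
        else snd (snd w) (max 0 ((2 * t - fst w) / (2 - fst w)))) {0..1} 0 = id (D (fst w) (fst (snd w))) \<and>
      restrict (\<lambda>t. if 2 * t \<le> fst w then D (max 0 (fst w - 2 * t)) (fst (snd w))
        else snd (snd w) (max 0 ((2 * t - fst w) / (2 - fst w)))) {0..1} 1 = b"
      by (simp add: inE)
  qed
  have Din: "(D s (fst e), restrict (\<lambda>t. if 2 * t \<le> s then D (max 0 (s - 2 * t)) (fst e)
        else snd e (max 0 ((2 * t - s) / (2 - s)))) {0..1}) \<in> topspace E" if "0 \<le> s" "s \<le> 1" "e \<in> topspace E" for s e
  proof -
    have "(s, e) \<in> topspace (prod_topology I01 E)" using that by simp
    from funcset_mem[OF Dc[unfolded continuous_map_def, THEN conjunct1] this] show ?thesis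
      unfolding fst_conv snd_conv .
  qed
  show ?thesis
    unfolding halo_deformation_def
  proof (intro conjI ballI impI)
    show "continuous_map E euclideanreal (\<lambda>e. u (fst e))" by (rule continuous_map_comp[OF h(2) f])
    show "(D 0 (fst e), restrict (\<lambda>t. if 2 * t \<le> 0 then D (max 0 (0 - 2 * t)) (fst e)
        else snd e (max 0 ((2 * t - 0) / (2 - 0)))) {0..1}) = e" if "e \<in> topspace E" for e
    proof -
      have e: "snd e 0 = fst e" "fst e \<in> topspace X" "snd e \<in> extensional {0..1}"
        using that by (auto simp: inE path_space_extensional)
      have "restrict (\<lambda>t. if 2 * t \<le> 0 then D (max 0 (0 - 2 * t)) (fst e)
        else snd e (max 0 ((2 * t - 0) / (2 - 0)))) {0..1} = snd e"
      proof (rule path_space_fun_eq)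
        fix t :: real assume "0 \<le> t" "t \<le> 1"
        then show "restrict (\<lambda>t. if 2 * t \<le> 0 then D (max 0 (0 - 2 * t)) (fst e)
          else snd e (max 0 ((2 * t - 0) / (2 - 0)))) {0..1} t = snd e t"
          using h(6)[OF e(2)] e(1) by (cases "t = 0") auto
      qed (use e(3) in auto)
      then show ?thesis using h(6)[OF e(2)] by (simp add: prod_eq_iff)
    qed
    show "(D s (fst e), restrict (\<lambda>t. if 2 * t \<le> s then D (max 0 (s - 2 * t)) (fst e)
        else snd e (max 0 ((2 * t - s) / (2 - s)))) {0..1}) \<in> {e \<in> topspace E. fst e \<in> S}"
      if "s \<in> {0..1}" "e \<in> {e \<in> topspace E. fst e \<in> S}" for s e
      using Din[of s e] h(7)[of s "fst e"] that by simp
    show "(D 1 (fst e), restrict (\<lambda>t. if 2 * t \<le> 1 then D (max 0 (1 - 2 * t)) (fst e)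
        else snd e (max 0 ((2 * t - 1) / (2 - 1)))) {0..1}) \<in> {e \<in> topspace E. fst e \<in> S}"
      if "e \<in> topspace E" "u (fst e) < 1" for e
      using Din[of 1 e] h(8)[of "fst e"] that inE[of e] by simp
  qed (use h(3,4) inE in \<open>auto intro: Dc\<close>)
qed

text \<open>The initial segment up to \<open>s\<close> is dropped and the path waits at its end. The
  start travels along the path, so a path starting in a given subspace need not keep starting
  there.\<close>

definition path_contract :: "real \<Rightarrow> 'a \<times> (real \<Rightarrow> 'a) \<Rightarrow> 'a \<times> (real \<Rightarrow> 'a)" where
  "path_contract s e = (snd e s, restrict (\<lambda>t. snd e (min 1 (s + t))) {0..1})"

lemma continuous_map_path_contract:
  "continuous_map (prod_topology I01 (hofib X X id b)) (hofib X X id b) (\<lambda>w. path_contract (fst w) (snd w))"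
  unfolding path_contract_def
proof (rule continuous_map_into_hofib)
  let ?E = "hofib X X id b" let ?Z = "prod_topology I01 ?E" let ?W = "prod_topology ?Z I01"
  have g: "continuous_map ?E (path_space X) snd"
    using continuous_map_from_hofib(2)[OF continuous_map_self[of ?E]] .
  show "continuous_map ?Z X (\<lambda>w. snd (snd w) (fst w))"
    by (rule continuous_map_path_app[OF continuous_map_comp[OF g continuous_map_proj(2)] continuous_map_proj(1)])
  have "continuous_map ?W I01 (\<lambda>w. min 1 (fst (fst w) + snd w))"
    unfolding continuous_map_I01 by (intro conjI cont_real) auto
  then have "continuous_map ?W X (\<lambda>w. snd (snd (fst w)) (min 1 (fst (fst w) + snd w)))"
    by (rule continuous_map_path_app[OF continuous_map_comp[OF g continuous_map_proj(4)]])
  then show "continuous_map ?Z (path_space X) (\<lambda>w. restrict (\<lambda>t. snd (snd w) (min 1 (fst w + t))) {0..1})"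
    by (rule continuous_map_path_curry)
qed (auto simp: hofib_id_in)

lemma path_contract_0: "e \<in> topspace (hofib X X id b) \<Longrightarrow> path_contract 0 e = e"
  by (auto simp: path_contract_def prod_eq_iff hofib_id_in path_space_extensional intro!: path_space_fun_eq)

lemma path_contract_1: "e \<in> topspace (hofib X X id b) \<Longrightarrow> path_contract 1 e = hofib_base b b"
  by (auto simp: path_contract_def hofib_base_def hofib_id_in intro!: path_space_fun_eq)

lemma hofib_base_in: "b \<in> topspace X \<Longrightarrow> hofib_base b b \<in> topspace (hofib X X id b)"
  by (simp add: hofib_id_in hofib_base_def topspace_path_space)

text \<open>Identifies the homotopy fibre of an inclusion with a subspace of the contractible path
  space, topology included, so that the abstract comparison of a join with a union of products
  applies to it.\<close>

lemma hofib_subtopology: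
  assumes "S \<subseteq> topspace X"
  shows "hofib (subtopology X S) X id b = subtopology (hofib X X id b) {e \<in> topspace (hofib X X id b). fst e \<in> S}"
proof -
  have "{(e, \<gamma>). e \<in> topspace X \<and> \<gamma> \<in> topspace (path_space X) \<and> \<gamma> 0 = id e \<and> \<gamma> 1 = b} \<inter>
      {e \<in> topspace (hofib X X id b). fst e \<in> S} =
    (S \<times> topspace (path_space X)) \<inter> {(e, \<gamma>). e \<in> topspace (subtopology X S) \<and> \<gamma> \<in> topspace (path_space X) \<and> \<gamma> 0 = id e \<and> \<gamma> 1 = b}"
    using assms by (auto simp: hofib_id_in)
  then show ?thesis
    unfolding hofib_def[of "subtopology X S"] hofib_def[of X X id b, THEN arg_cong, of "\<lambda>T. subtopology T _"]
      prod_topology_subtopology(1) subtopology_subtopology by simp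
qed

section \<open>Products, loops on products, and polyhedral products of joins\<close>

lemma homotopy_equivalent_space_prod:
  assumes "Y homotopy_equivalent_space Y'"
  shows "prod_topology X Y homotopy_equivalent_space prod_topology X Y'"
proof -
  have lift: "homotopic_with (\<lambda>_. True) (prod_topology X Y) (prod_topology X Y) (\<lambda>w. (fst w, f (snd w))) (\<lambda>w. w)"
    if hom: "homotopic_with (\<lambda>_. True) Y Y f id" for Y :: "'z topology" and f
  proof -
    obtain h where h: "continuous_map (prod_topology I01 Y) Y (\<lambda>w. h (fst w) (snd w))" "\<And>y. h 0 y = f y" "\<And>y. h 1 y = id y"
      by (rule homotopic_withD[OF hom], rule that)
    show ?thesis
    proof (rule homotopic_withI[where h="\<lambda>s w. (fst w, h s (snd w))"])
      show "continuous_map (prod_topology I01 (prod_topology X Y)) (prod_topology X Y) (\<lambda>w. (fst (snd w), h (fst w) (snd (snd w))))"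
        by (rule continuous_map_pairedI[OF continuous_map_fst_comp[OF continuous_map_proj(2)]
            continuous_map_comp2[OF h(1) continuous_map_proj(1) continuous_map_snd_comp[OF continuous_map_proj(2)]]])
    qed (auto simp: h)
  qed
  obtain f g where f: "continuous_map Y Y' f" and g: "continuous_map Y' Y g"
    and gf: "homotopic_with (\<lambda>_. True) Y Y (g \<circ> f) id" and fg: "homotopic_with (\<lambda>_. True) Y' Y' (f \<circ> g) id"
    using assms unfolding homotopy_equivalent_space_def by blast
  have "homotopy_equivalence_map (prod_topology X Y) (prod_topology X Y') (\<lambda>w. (fst w, f (snd w)))"
    by (rule homotopy_equivalence_mapI[where g="\<lambda>w. (fst w, g (snd w))"])
      (use lift[OF gf] lift[OF fg] in \<open>auto intro!: continuous_map_pairedI continuous_map_proj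
        continuous_map_comp[OF f continuous_map_proj(2)] continuous_map_comp[OF g continuous_map_proj(2)]\<close>)
  then show ?thesis by (rule homotopy_equivalence_map_imp_space)
qed

lemma loop_space_prod:
  "prod_topology (loop_space (prod_topology B1 B2) (b1, b2)) Z homeomorphic_space
   prod_topology (loop_space B1 b1) (prod_topology (loop_space B2 b2) Z)"
  unfolding homeomorphic_space_def homeomorphic_maps_def
proof (intro exI conjI ballI)
  let ?L = "loop_space (prod_topology B1 B2) (b1, b2)"
  let ?f = "\<lambda>w. (restrict (\<lambda>t. fst (fst w t)) {0..1}, restrict (\<lambda>t. snd (fst w t)) {0..1}, snd w)"
  let ?g = "\<lambda>w. (restrict (\<lambda>t. (fst w t, fst (snd w) t)) {0..1}, snd (snd w))"
  have l: "continuous_map (loop_space B b) (path_space B) (\<lambda>\<epsilon>. \<epsilon>)" for B :: "'z topology" and b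
    unfolding loop_space_def by (rule continuous_map_path_space_inclusion)
  have ev: "continuous_map (prod_topology (prod_topology ?L Z) I01) (prod_topology B1 B2) (\<lambda>w. fst (fst w) (snd w))"
    by (rule continuous_map_path_app[OF continuous_map_comp[OF l continuous_map_proj(3)] continuous_map_proj(2)])
  show "continuous_map (prod_topology ?L Z) (prod_topology (loop_space B1 b1) (prod_topology (loop_space B2 b2) Z)) ?f"
    by (intro continuous_map_pairedI continuous_map_proj continuous_map_loop_space[THEN iffD2] conjI continuous_map_path_curry
        continuous_map_fst_comp[OF ev] continuous_map_snd_comp[OF ev]) (auto simp: topspace_loop_space)
  let ?P = "prod_topology (loop_space B1 b1) (prod_topology (loop_space B2 b2) Z)"
  have e1: "continuous_map (prod_topology ?P I01) B1 (\<lambda>w. fst (fst w) (snd w))"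
    by (rule continuous_map_path_app[OF continuous_map_comp[OF l continuous_map_proj(3)] continuous_map_proj(2)])
  have e2: "continuous_map (prod_topology ?P I01) B2 (\<lambda>w. fst (snd (fst w)) (snd w))"
    by (rule continuous_map_path_app[OF continuous_map_comp[OF l continuous_map_fst_comp[OF continuous_map_proj(4)]] continuous_map_proj(2)])
  show "continuous_map ?P (prod_topology ?L Z) ?g"
    by (intro continuous_map_pairedI continuous_map_snd_comp[OF continuous_map_proj(2)] continuous_map_loop_space[THEN iffD2] conjI
        continuous_map_path_curry e1 e2) (auto simp: topspace_loop_space)
  show "?g (?f w) = w" if "w \<in> topspace (prod_topology ?L Z)" for w
    using that by (auto simp: topspace_loop_space path_space_extensional prod_eq_iff intro!: path_space_fun_eq)
  show "?f (?g w) = w" if "w \<in> topspace ?P" for w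
    using that by (auto simp: topspace_loop_space path_space_extensional prod_eq_iff intro!: path_space_fun_eq)
qed

text \<open>Faces of one complex have no vertices in the other vertex set, so the condition imposed
  by \<open>\<sigma> \<union> \<tau>\<close> splits into one for \<open>\<sigma>\<close> on
  \<open>V1\<close> and one for \<open>\<tau>\<close> on \<open>V2\<close>.\<close>

lemma join_complex_polyhedral:
  assumes V: "V1 \<inter> V2 = {}" and K: "K1 \<subseteq> Pow V1" "K2 \<subseteq> Pow V2"
    and AX: "\<And>v. v \<in> V1 \<union> V2 \<Longrightarrow> A v \<subseteq> topspace (X v)"
  shows "x \<in> topspace (polyhedral_product (V1 \<union> V2) (join_complex K1 K2) X A) \<longleftrightarrow>
    x \<in> extensional (V1 \<union> V2) \<and> restrict x V1 \<in> topspace (polyhedral_product V1 K1 X A) \<and>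
    restrict x V2 \<in> topspace (polyhedral_product V2 K2 X A)" (is "?l \<longleftrightarrow> ?r")
proof -
  have top: "x \<in> topspace (polyhedral_product V K X A) \<longleftrightarrow> x \<in> extensional V \<and>
    (\<exists>\<sigma>\<in>K. \<forall>v\<in>V. x v \<in> topspace (X v) \<and> (v \<notin> \<sigma> \<longrightarrow> x v \<in> A v))" if "V \<subseteq> V1 \<union> V2" for x V K
    by (rule topspace_polyhedral_product) (use that AX in auto)
  note top = top[OF subset_refl] top[OF Un_upper1] top[OF Un_upper2]
  show ?thesis
  proof
    assume ?l
    then obtain \<sigma> \<tau> where x: "x \<in> extensional (V1 \<union> V2)" and st: "\<sigma> \<in> K1" "\<tau> \<in> K2"
      and a: "\<forall>v\<in>V1 \<union> V2. x v \<in> topspace (X v) \<and> (v \<notin> \<sigma> \<union> \<tau> \<longrightarrow> x v \<in> A v)"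
      unfolding top join_complex_def by blast
    have "\<sigma> \<subseteq> V1" "\<tau> \<subseteq> V2" using st K by auto
    then have disj: "v \<in> V1 \<Longrightarrow> v \<notin> \<tau>" "v \<in> V2 \<Longrightarrow> v \<notin> \<sigma>" for v using V by auto
    have "\<forall>v\<in>V1. restrict x V1 v \<in> topspace (X v) \<and> (v \<notin> \<sigma> \<longrightarrow> restrict x V1 v \<in> A v)"
      using a disj by auto
    moreover have "\<forall>v\<in>V2. restrict x V2 v \<in> topspace (X v) \<and> (v \<notin> \<tau> \<longrightarrow> restrict x V2 v \<in> A v)"
      using a disj by auto
    ultimately show ?r unfolding top using x st restrict_extensional by blast
  next
    assume ?r
    then obtain \<sigma> \<tau> where x: "x \<in> extensional (V1 \<union> V2)" and st: "\<sigma> \<in> K1" "\<tau> \<in> K2"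
      and a: "\<forall>v\<in>V1. restrict x V1 v \<in> topspace (X v) \<and> (v \<notin> \<sigma> \<longrightarrow> restrict x V1 v \<in> A v)"
        "\<forall>v\<in>V2. restrict x V2 v \<in> topspace (X v) \<and> (v \<notin> \<tau> \<longrightarrow> restrict x V2 v \<in> A v)"
      unfolding top by blast
    then have "\<forall>v\<in>V1 \<union> V2. x v \<in> topspace (X v) \<and> (v \<notin> \<sigma> \<union> \<tau> \<longrightarrow> x v \<in> A v)" by auto
    moreover have "\<sigma> \<union> \<tau> \<in> join_complex K1 K2" using st unfolding join_complex_def by blast
    ultimately show ?l unfolding top using x by blast
  qed
qed

section \<open>The homotopy fibration\<close>

locale polyhedral_fibration =
  fixes Vm Vk :: "'v set" and M N K L :: "'v set set"
    and X :: "'v \<Rightarrow> 'a topology" and A :: "'v \<Rightarrow> 'a set" and a :: "'v \<Rightarrow> 'a"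
  assumes disj: "Vm \<inter> Vk = {}"
    and M: "simplicial_complex Vm M" and N: "simplicial_complex Vm N" and NM: "N \<subseteq> M"
    and K: "simplicial_complex Vk K" and L: "simplicial_complex Vk L" and LK: "L \<subseteq> K"
    and cw: "\<And>v. v \<in> Vm \<union> Vk \<Longrightarrow> pointed_cw_pair (X v) (A v) (a v)"
begin

abbreviation "PM \<equiv> polyhedral_product Vm M X A"
abbreviation "PN \<equiv> polyhedral_product Vm N X A"
abbreviation "PK \<equiv> polyhedral_product Vk K X A"
abbreviation "PL \<equiv> polyhedral_product Vk L X A"
abbreviation "PQ \<equiv> polyhedral_product (Vm \<union> Vk) (join_complex M L \<union> join_complex N K) X A"
abbreviation "bM \<equiv> restrict a Vm"
abbreviation "bK \<equiv> restrict a Vk"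
abbreviation "bQ \<equiv> restrict a (Vm \<union> Vk)"
abbreviation "p \<equiv> (\<lambda>x. (restrict x Vm, restrict x Vk))"
abbreviation "B \<equiv> prod_topology PM PK"
abbreviation "FQ \<equiv> hofib PQ B p (bM, bK)"
abbreviation "E1 \<equiv> hofib PM PM id bM"
abbreviation "E2 \<equiv> hofib PK PK id bK"
abbreviation "S1 \<equiv> {e \<in> topspace E1. fst e \<in> topspace PN}"
abbreviation "S2 \<equiv> {e \<in> topspace E2. fst e \<in> topspace PL}"
abbreviation "W \<equiv> subtopology (prod_topology E1 E2) {w. fst w \<in> S1 \<or> snd w \<in> S2}"

lemma faces: "M \<subseteq> Pow Vm" "N \<subseteq> Pow Vm" "K \<subseteq> Pow Vk" "L \<subseteq> Pow Vk"
  using M N K L unfolding simplicial_complex_def by auto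

lemma fin: "finite Vm" "finite Vk"
  using M K unfolding simplicial_complex_def by auto

lemma halo: obtains u D where "\<And>v. v \<in> Vm \<union> Vk \<Longrightarrow> halo_deformation (X v) (A v) (u v) (D v)"
proof -
  have "\<forall>v\<in>Vm \<union> Vk. \<exists>u D. halo_deformation (X v) (A v) u D"
    using pointed_cw_pair_halo[OF cw] by metis
  then obtain u D where "\<forall>v\<in>Vm \<union> Vk. halo_deformation (X v) (A v) (u v) (D v)" by metis
  then show ?thesis using that by blast
qed

lemma AX: "v \<in> Vm \<union> Vk \<Longrightarrow> A v \<subseteq> topspace (X v)"
  using halo halo_deformationD(1) by metis

lemma base_in:
  assumes "V \<subseteq> Vm \<union> Vk" "{} \<in> J"
  shows "restrict a V \<in> topspace (polyhedral_product V J X A)"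
proof -
  have "A v \<subseteq> topspace (X v)" "a v \<in> A v" if "v \<in> V" for v
    using AX pointed_cw_pair_point[OF cw] assms(1) that by blast+
  then show ?thesis
    using assms(2) by (subst topspace_polyhedral_product) auto
qed

lemma bases: "bM \<in> topspace PM" "bM \<in> topspace PN" "bK \<in> topspace PK" "bK \<in> topspace PL" "bQ \<in> topspace PQ"
  using M N K L by (auto simp: simplicial_complex_def join_complex_def intro!: base_in)

lemma sub: "PN = subtopology PM (topspace PN)" "PL = subtopology PK (topspace PL)"
  by (rule polyhedral_product_subtopology; use AX NM LK in auto)+

lemma sub_top: "topspace PN \<subseteq> topspace PM" "topspace PL \<subseteq> topspace PK"
  by (subst sub, simp)+

text \<open>The two joins making up the complex become the two alternatives in the last clause; this
  disjunction is what turns the homotopy fibre into a union of two products.\<close>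

lemma topspace_PQ:
  "x \<in> topspace PQ \<longleftrightarrow> x \<in> extensional (Vm \<union> Vk) \<and> restrict x Vm \<in> topspace PM \<and> restrict x Vk \<in> topspace PK \<and>
    (restrict x Vm \<in> topspace PN \<or> restrict x Vk \<in> topspace PL)"
proof -
  have "x \<in> topspace PQ \<longleftrightarrow> x \<in> topspace (polyhedral_product (Vm \<union> Vk) (join_complex M L) X A) \<or>
      x \<in> topspace (polyhedral_product (Vm \<union> Vk) (join_complex N K) X A)"
    by (auto simp: polyhedral_product_def)
  moreover have "x \<in> topspace (polyhedral_product (Vm \<union> Vk) (join_complex J1 J2) X A) \<longleftrightarrow>
      x \<in> extensional (Vm \<union> Vk) \<and> restrict x Vm \<in> topspace (polyhedral_product Vm J1 X A) \<and>
      restrict x Vk \<in> topspace (polyhedral_product Vk J2 X A)" if "J1 \<subseteq> Pow Vm" "J2 \<subseteq> Pow Vk" for J1 J2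
    by (rule join_complex_polyhedral[OF disj that]) (rule AX)
  ultimately show ?thesis
    using sub_top faces by blast
qed

lemma continuous_p: "continuous_map PQ B p"
  by (intro continuous_map_pairedI continuous_map_into_polyhedral)
    (auto simp: topspace_PQ intro: continuous_map_polyhedral_proj)

text \<open>A function on the disjoint vertex set is a pair of functions and a path in a product is
  a pair of paths; \<open>glue\<close> and \<open>unglue\<close> are the resulting mutually inverse
  homeomorphisms between \<open>W\<close> and the homotopy fibre.\<close>

definition "glue w = (restrict (\<lambda>v. if v \<in> Vm then fst (fst w) v else fst (snd w) v) (Vm \<union> Vk),
    restrict (\<lambda>t. (snd (fst w) t, snd (snd w) t)) {0..1})"

definition "unglue e = ((restrict (fst e) Vm, restrict (\<lambda>t. fst (snd e t)) {0..1}),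
    (restrict (fst e) Vk, restrict (\<lambda>t. snd (snd e t)) {0..1}))"

lemma ext: "x \<in> topspace (polyhedral_product V J X A) \<Longrightarrow> x \<in> extensional V"
  by (auto simp: polyhedral_product_def PiE_iff)

lemma merge:
  assumes "x \<in> extensional Vm" "y \<in> extensional Vk"
  shows "restrict (restrict (\<lambda>v. if v \<in> Vm then x v else y v) (Vm \<union> Vk)) Vm = x"
    "restrict (restrict (\<lambda>v. if v \<in> Vm then x v else y v) (Vm \<union> Vk)) Vk = y"
  by (rule extensionalityI[of _ Vm]; use assms disj in auto) (rule extensionalityI[of _ Vk]; use assms disj in auto)

lemma topspace_W:
  "w \<in> topspace W \<longleftrightarrow> fst w \<in> topspace E1 \<and> snd w \<in> topspace E2 \<and>
    (fst (fst w) \<in> topspace PN \<or> fst (snd w) \<in> topspace PL)"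
  by (cases w) auto

lemma W_maps:
  "continuous_map W PM (\<lambda>w. fst (fst w))" "continuous_map W (path_space PM) (\<lambda>w. snd (fst w))"
  "continuous_map W PK (\<lambda>w. fst (snd w))" "continuous_map W (path_space PK) (\<lambda>w. snd (snd w))"
  by (rule continuous_map_from_hofib(1,2)[OF continuous_map_from_subtopology[OF continuous_map_proj(1)]]
      continuous_map_from_hofib(1,2)[OF continuous_map_from_subtopology[OF continuous_map_proj(2)]])+

lemma continuous_glue: "continuous_map W FQ glue"
  unfolding glue_def
proof (rule continuous_map_into_hofib)
  show "continuous_map W PQ (\<lambda>w. restrict (\<lambda>v. if v \<in> Vm then fst (fst w) v else fst (snd w) v) (Vm \<union> Vk))"
  proof (rule continuous_map_into_polyhedral)
    fix v assume v: "v \<in> Vm \<union> Vk"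
    show "continuous_map W (X v) (\<lambda>w. restrict (\<lambda>v. if v \<in> Vm then fst (fst w) v else fst (snd w) v) (Vm \<union> Vk) v)"
    proof (cases "v \<in> Vm")
      case True
      then show ?thesis using continuous_map_comp[OF continuous_map_polyhedral_proj W_maps(1), of v] by simp
    next
      case False
      then show ?thesis using v continuous_map_comp[OF continuous_map_polyhedral_proj W_maps(3), of v] by simp
    qed
  next
    fix w assume "w \<in> topspace W"
    then have "fst w \<in> topspace E1" "snd w \<in> topspace E2" and N: "fst (fst w) \<in> topspace PN \<or> fst (snd w) \<in> topspace PL"
      unfolding topspace_W by blast+
    then have w: "fst (fst w) \<in> topspace PM" "fst (snd w) \<in> topspace PK"
      unfolding hofib_id_in by blast+
    with N show "restrict (\<lambda>v. if v \<in> Vm then fst (fst w) v else fst (snd w) v) (Vm \<union> Vk) \<in> topspace PQ"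
      unfolding topspace_PQ merge[OF ext[OF w(1)] ext[OF w(2)]] by simp
  qed
  let ?Z = "prod_topology W I01"
  show "continuous_map W (path_space B) (\<lambda>w. restrict (\<lambda>t. (snd (fst w) t, snd (snd w) t)) {0..1})"
    by (rule continuous_map_path_curry, rule continuous_map_pairedI;
        rule continuous_map_path_app[OF continuous_map_comp[OF W_maps(2) continuous_map_proj(1)] continuous_map_proj(2)]
          continuous_map_path_app[OF continuous_map_comp[OF W_maps(4) continuous_map_proj(1)] continuous_map_proj(2)])
  fix w assume "w \<in> topspace W"
  then have w: "fst w \<in> topspace E1" "snd w \<in> topspace E2" unfolding topspace_W by auto
  have e: "fst (fst w) \<in> extensional Vm" "fst (snd w) \<in> extensional Vk"
    using w unfolding hofib_id_in by (auto intro: ext)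
  show "restrict (\<lambda>t. (snd (fst w) t, snd (snd w) t)) {0..1} 0 =
      (restrict (restrict (\<lambda>v. if v \<in> Vm then fst (fst w) v else fst (snd w) v) (Vm \<union> Vk)) Vm,
       restrict (restrict (\<lambda>v. if v \<in> Vm then fst (fst w) v else fst (snd w) v) (Vm \<union> Vk)) Vk) \<and>
    restrict (\<lambda>t. (snd (fst w) t, snd (snd w) t)) {0..1} 1 = (bM, bK)"
    unfolding merge[OF e] using w unfolding hofib_id_in by simp
qed

lemma continuous_unglue: "continuous_map FQ W unglue"
  unfolding continuous_map_in_subtopology
proof
  note FQ = continuous_map_from_hofib[OF continuous_map_self[of FQ]]
  have pc: "continuous_map (prod_topology FQ I01) B (\<lambda>w. snd (fst w) (snd w))"
    by (rule continuous_map_path_app[OF continuous_map_comp[OF FQ(2) continuous_map_proj(1)] continuous_map_proj(2)])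
  note P = continuous_map_comp[OF continuous_p FQ(1)]
  show "continuous_map FQ (prod_topology E1 E2) unglue"
    unfolding unglue_def
  proof (intro continuous_map_pairedI continuous_map_into_hofib)
    show "continuous_map FQ PM (\<lambda>e. restrict (fst e) Vm)" "continuous_map FQ PK (\<lambda>e. restrict (fst e) Vk)"
      using continuous_map_fst_comp[OF P] continuous_map_snd_comp[OF P] by simp_all
    show "continuous_map FQ (path_space PM) (\<lambda>e. restrict (\<lambda>t. fst (snd e t)) {0..1})"
      "continuous_map FQ (path_space PK) (\<lambda>e. restrict (\<lambda>t. snd (snd e t)) {0..1})"
      by (rule continuous_map_path_curry, rule continuous_map_fst_comp[OF pc] continuous_map_snd_comp[OF pc])+
  qed (auto simp: topspace_hofib)
  show "unglue \<in> topspace FQ \<rightarrow> {w. fst w \<in> S1 \<or> snd w \<in> S2}"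
  proof
    fix e assume e: "e \<in> topspace FQ"
    then have "unglue e \<in> topspace (prod_topology E1 E2)"
      using funcset_mem[OF \<open>continuous_map FQ (prod_topology E1 E2) unglue\<close>[unfolded continuous_map_def, THEN conjunct1]] by blast
    moreover have "restrict (fst e) Vm \<in> topspace PN \<or> restrict (fst e) Vk \<in> topspace PL"
      using e unfolding topspace_hofib topspace_PQ by blast
    ultimately show "unglue e \<in> {w. fst w \<in> S1 \<or> snd w \<in> S2}"
      by (auto simp: unglue_def)
  qed
qed

lemma unglue_glue: "w \<in> topspace W \<Longrightarrow> unglue (glue w) = w"
proof -
  assume "w \<in> topspace W"
  then have w: "fst w \<in> topspace E1" "snd w \<in> topspace E2" unfolding topspace_W by auto
  have e: "fst (fst w) \<in> extensional Vm" "fst (snd w) \<in> extensional Vk"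
    "snd (fst w) \<in> extensional {0..1}" "snd (snd w) \<in> extensional {0..1}"
    using w unfolding hofib_id_in by (auto intro: ext path_space_extensional)
  have "restrict (\<lambda>t. fst (restrict (\<lambda>t. (snd (fst w) t, snd (snd w) t)) {0..1} t)) {0..1} = snd (fst w)"
    "restrict (\<lambda>t. snd (restrict (\<lambda>t. (snd (fst w) t, snd (snd w) t)) {0..1} t)) {0..1} = snd (snd w)"
    by (rule path_space_fun_eq; use e in simp)+
  then show ?thesis unfolding glue_def unglue_def fst_conv snd_conv merge[OF e(1,2)] by simp
qed

lemma glue_unglue: "e \<in> topspace FQ \<Longrightarrow> glue (unglue e) = e"
proof -
  assume "e \<in> topspace FQ"
  then have e: "fst e \<in> extensional (Vm \<union> Vk)" "snd e \<in> extensional {0..1}"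
    unfolding topspace_hofib topspace_PQ by (auto intro: path_space_extensional)
  have "restrict (\<lambda>v. if v \<in> Vm then restrict (fst e) Vm v else restrict (fst e) Vk v) (Vm \<union> Vk) = fst e"
    by (rule extensionalityI[of _ "Vm \<union> Vk"]) (use e in auto)
  moreover have "restrict (\<lambda>t. (restrict (\<lambda>t. fst (snd e t)) {0..1} t, restrict (\<lambda>t. snd (snd e t)) {0..1} t)) {0..1} = snd e"
    by (rule path_space_fun_eq; use e in simp)
  ultimately show ?thesis unfolding glue_def unglue_def fst_conv snd_conv by (simp only: prod.collapse)
qed

lemma homotopy_equivalence_glue: "homotopy_equivalence_map W FQ glue"
proof (rule homotopy_equivalence_mapI[OF continuous_glue continuous_unglue])
  show "homotopic_with (\<lambda>_. True) W W (\<lambda>w. unglue (glue w)) (\<lambda>w. w)"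
    by (rule homotopic_with_equal[OF _ _ continuous_map_comp[OF continuous_unglue continuous_glue]]) (auto simp: unglue_glue)
  show "homotopic_with (\<lambda>_. True) FQ FQ (\<lambda>e. glue (unglue e)) (\<lambda>e. e)"
    by (rule homotopic_with_equal[OF _ _ continuous_map_comp[OF continuous_glue continuous_unglue]]) (auto simp: glue_unglue)
qed

lemma glue_base: "glue (hofib_base bM bM, hofib_base bK bK) = hofib_base bQ (bM, bK)"
  by (auto simp: glue_def hofib_base_def fun_eq_iff)

text \<open>Contract the two coordinates of a loop one after the other; the start of the other
  coordinate stays at the base point, which lies in \<open>PL\<close> respectively \<open>PN\<close>.\<close>
definition "loop_null \<omega> s = glue
   (path_contract (min 1 (2 * s)) (bM, restrict (\<lambda>t. fst (\<omega> t)) {0..1}),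
    path_contract (max 0 (2 * s - 1)) (bK, restrict (\<lambda>t. snd (\<omega> t)) {0..1}))"

lemma loop_coords:
  assumes "\<omega> \<in> topspace (loop_space B (bM, bK))"
  shows "(bM, restrict (\<lambda>t. fst (\<omega> t)) {0..1}) \<in> topspace E1" "(bK, restrict (\<lambda>t. snd (\<omega> t)) {0..1}) \<in> topspace E2"
proof -
  have c: "continuous_map I01 B \<omega>" "\<omega> 0 = (bM, bK)" "\<omega> 1 = (bM, bK)"
    using assms by (auto simp: topspace_loop_space topspace_path_space)
  show "(bM, restrict (\<lambda>t. fst (\<omega> t)) {0..1}) \<in> topspace E1" "(bK, restrict (\<lambda>t. snd (\<omega> t)) {0..1}) \<in> topspace E2"
    unfolding hofib_id_in using c(2,3) bases continuous_map_fst_comp[OF c(1)] continuous_map_snd_comp[OF c(1)]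
    by (auto simp: topspace_path_space)
qed

sublocale fibre_nullhomotopy PQ B p bQ "(bM, bK)" loop_null
proof
  show "continuous_map PQ B p" by (rule continuous_p)
  show "bQ \<in> topspace PQ" by (rule bases)
  show "p bQ = (bM, bK)" by (auto simp: fun_eq_iff)
  let ?O = "loop_space B (bM, bK)" let ?Z = "prod_topology ?O I01"
  show "continuous_map ?Z FQ (\<lambda>w. loop_null (fst w) (snd w))"
    unfolding loop_null_def
  proof (rule continuous_map_comp[OF continuous_glue], unfold continuous_map_in_subtopology, rule conjI)
    have ev: "continuous_map (prod_topology ?O I01) B (\<lambda>w. fst w (snd w))"
      by (rule continuous_map_path_app[OF continuous_map_comp[OF _ continuous_map_proj(1)] continuous_map_proj(2)])
        (simp add: loop_space_def continuous_map_path_space_inclusion)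
    have "continuous_map ?O E1 (\<lambda>\<omega>. (bM, restrict (\<lambda>t. fst (\<omega> t)) {0..1}))"
      by (rule continuous_map_into_hofib[OF _ continuous_map_path_curry[OF continuous_map_fst_comp[OF ev]]])
        (use bases in \<open>auto simp: topspace_loop_space\<close>)
    note e1 = continuous_map_comp[OF this continuous_map_proj(1)]
    have "continuous_map ?O E2 (\<lambda>\<omega>. (bK, restrict (\<lambda>t. snd (\<omega> t)) {0..1}))"
      by (rule continuous_map_into_hofib[OF _ continuous_map_path_curry[OF continuous_map_snd_comp[OF ev]]])
        (use bases in \<open>auto simp: topspace_loop_space\<close>)
    note e2 = continuous_map_comp[OF this continuous_map_proj(1)]
    have s1: "continuous_map ?Z I01 (\<lambda>w. min 1 (2 * snd w))" and s2: "continuous_map ?Z I01 (\<lambda>w. max 0 (2 * snd w - 1))"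
      unfolding continuous_map_I01 by (intro conjI cont_real; auto)+
    show "continuous_map ?Z (prod_topology E1 E2) (\<lambda>w.
      (path_contract (min 1 (2 * snd w)) (bM, restrict (\<lambda>t. fst (fst w t)) {0..1}),
       path_contract (max 0 (2 * snd w - 1)) (bK, restrict (\<lambda>t. snd (fst w t)) {0..1})))" (is "continuous_map _ _ ?h")
      by (rule continuous_map_pairedI[OF continuous_map_comp2[OF continuous_map_path_contract s1 e1]
          continuous_map_comp2[OF continuous_map_path_contract s2 e2]])
    then have h: "?h w \<in> topspace (prod_topology E1 E2)" if "w \<in> topspace ?Z" for w
      using that unfolding continuous_map_def by blast
    show "?h \<in> topspace ?Z \<rightarrow> {w. fst w \<in> S1 \<or> snd w \<in> S2}"
    proof
      fix w assume w: "w \<in> topspace ?Z"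
      then have \<omega>: "fst w \<in> topspace ?O" by auto
      have "fst (fst (?h w)) \<in> topspace PN \<or> fst (snd (?h w)) \<in> topspace PL"
      proof (cases "snd w \<le> 1/2")
        case True
        then have "max 0 (2 * snd w - 1) = 0" by auto
        then show ?thesis using path_contract_0[OF loop_coords(2)[OF \<omega>]] bases by simp
      next
        case False
        then have "min 1 (2 * snd w) = 1" by auto
        then show ?thesis using path_contract_1[OF loop_coords(1)[OF \<omega>]] bases by (simp add: hofib_base_def)
      qed
      then show "?h w \<in> {w. fst w \<in> S1 \<or> snd w \<in> S2}" using h[OF w] by auto
    qed
  qed
  fix \<omega> assume \<omega>: "\<omega> \<in> topspace ?O"
  have "restrict (\<lambda>t. (restrict (\<lambda>t. fst (\<omega> t)) {0..1} t, restrict (\<lambda>t. snd (\<omega> t)) {0..1} t)) {0..1} = \<omega>"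
    by (rule path_space_fun_eq) (use \<omega> in \<open>auto simp: topspace_loop_space path_space_extensional\<close>)
  moreover have "restrict (\<lambda>v. if v \<in> Vm then bM v else bK v) (Vm \<union> Vk) = bQ" by (auto simp: fun_eq_iff)
  moreover have "loop_null \<omega> 0 = glue ((bM, restrict (\<lambda>t. fst (\<omega> t)) {0..1}), (bK, restrict (\<lambda>t. snd (\<omega> t)) {0..1}))"
    using path_contract_0[OF loop_coords(1)[OF \<omega>]] path_contract_0[OF loop_coords(2)[OF \<omega>]] by (simp add: loop_null_def)
  ultimately show "loop_null \<omega> 0 = (bQ, \<omega>)" unfolding glue_def fst_conv snd_conv by (simp only:)
  show "loop_null \<omega> 1 = hofib_base bQ (bM, bK)"
    using path_contract_1[OF loop_coords(1)[OF \<omega>]] path_contract_1[OF loop_coords(2)[OF \<omega>]]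
    by (simp add: loop_null_def glue_base)
qed

text \<open>The base point is followed along because the splitting produces loops on the fibre at
  \<open>hofib_base bQ (bM, bK)\<close>, and these have to be carried back to loops on the join at
  \<open>j0\<close>.\<close>

lemma join_fibre:
  defines "J \<equiv> join_space (hofib PN PM id bM) (hofib PL PK id bK)"
    and "j0 \<equiv> join_pt (hofib PN PM id bM) (hofib PL PK id bK) (hofib_base bM bM) (hofib_base bK bK) 0"
  obtains h where "homotopy_equivalence_map J FQ h" "h j0 = hofib_base bQ (bM, bK)" "j0 \<in> topspace J"
proof -
  obtain u D where halo: "\<And>v. v \<in> Vm \<union> Vk \<Longrightarrow> halo_deformation (X v) (A v) (u v) (D v)"
    by (rule halo) (rule that)
  obtain u1 D1 where h1: "halo_deformation PM (topspace PN) u1 D1"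
    using polyhedral_halo[OF fin(1) faces(2) NM, of X A u D] halo by blast
  obtain u2 D2 where h2: "halo_deformation PK (topspace PL) u2 D2"
    using polyhedral_halo[OF fin(2) faces(4) LK, of X A u D] halo by blast
  have G: "hofib PN PM id bM = subtopology E1 S1"
    using hofib_subtopology[OF sub_top(1)] sub(1) by simp
  have H: "hofib PL PK id bK = subtopology E2 S2"
    using hofib_subtopology[OF sub_top(2)] sub(2) by simp
  have e: "hofib_base bM bM \<in> S1" "hofib_base bK bK \<in> S2"
    using bases by (auto simp: hofib_base_in) (auto simp: hofib_base_def)
  interpret h: contractible_halos E1 S1 "\<lambda>e. u1 (fst e)" "\<lambda>s e. (D1 s (fst e),
      restrict (\<lambda>t. if 2 * t \<le> s then D1 (max 0 (s - 2 * t)) (fst e) else snd e (max 0 ((2 * t - s) / (2 - s)))) {0..1})"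
    path_contract "hofib_base bM bM" E2 S2 "\<lambda>e. u2 (fst e)" "\<lambda>s e. (D2 s (fst e),
      restrict (\<lambda>t. if 2 * t \<le> s then D2 (max 0 (s - 2 * t)) (fst e) else snd e (max 0 ((2 * t - s) / (2 - s)))) {0..1})"
    path_contract "hofib_base bK bK"
    by unfold_locales (rule path_halo[OF h1] path_halo[OF h2] e continuous_map_path_contract path_contract_0 path_contract_1; assumption?)+
  obtain f where f: "homotopy_equivalence_map J h.W f" "f j0 = (hofib_base bM bM, hofib_base bK bK)"
    unfolding J_def j0_def G H by (rule h.join_homotopy_equivalence)
  have "homotopy_equivalence_map J FQ (glue \<circ> f)"
    by (rule homotopy_equivalence_map_comp[OF f(1)[unfolded h.W_def] homotopy_equivalence_glue])
  moreover have "(glue \<circ> f) j0 = hofib_base bQ (bM, bK)" by (simp add: f(2) glue_base)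
  moreover have "j0 \<in> topspace J"
    unfolding J_def j0_def G H topspace_join_space h.topspace_GH
    by (rule CollectI, (rule exI)+, rule conjI[OF refl]) (use e in auto)
  ultimately show ?thesis by (rule that)
qed

end

theorem theorem4p3:
  fixes Vm Vk :: "'v set"
    and M N K L :: "'v set set"
    and X :: "'v \<Rightarrow> 'a topology" and A :: "'v \<Rightarrow> 'a set" and a :: "'v \<Rightarrow> 'a"
  assumes "Vm \<inter> Vk = {}"
    and "simplicial_complex Vm M" and "simplicial_complex Vm N" and "N \<subseteq> M"
    and "simplicial_complex Vk K" and "simplicial_complex Vk L" and "L \<subseteq> K"
    and "\<And>v. v \<in> Vm \<union> Vk \<Longrightarrow> pointed_cw_pair (X v) (A v) (a v)"
    and "Q = join_complex M L \<union> join_complex N K"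
    and "PQ = polyhedral_product (Vm \<union> Vk) Q X A"
    and "PM = polyhedral_product Vm M X A"
    and "PN = polyhedral_product Vm N X A"
    and "PK = polyhedral_product Vk K X A"
    and "PL = polyhedral_product Vk L X A"
    and "bQ = restrict a (Vm \<union> Vk)"
    and "bM = restrict a Vm"
    and "bK = restrict a Vk"
    and "G = hofib PN PM id bM"
    and "H = hofib PL PK id bK"
    and "gH = join_pt G H (hofib_base bM bM) (hofib_base bK bK) 0"
    and "p = (\<lambda>x. (restrict x Vm, restrict x Vk))"
  shows "(\<exists>j. homotopy_fibration (join_space G H) PQ (prod_topology PM PK) (bM, bK) j p)
    \<and> (\<exists>s. continuous_map (loop_space (prod_topology PM PK) (bM, bK)) (loop_space PQ bQ) s \<and>
           homotopic_with (\<lambda>_. True) (loop_space (prod_topology PM PK) (bM, bK))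
              (loop_space (prod_topology PM PK) (bM, bK)) (loop_map p \<circ> s) id)
    \<and> loop_space PQ bQ homotopy_equivalent_space
        prod_topology (loop_space PM bM)
          (prod_topology (loop_space PK bK) (loop_space (join_space G H) gH))"
proof -
  interpret pf: polyhedral_fibration Vm Vk M N K L X A a
    by unfold_locales (fact assms)+
  note eqs = assms(9-21)
  obtain h where h: "homotopy_equivalence_map (join_space G H) (hofib PQ (prod_topology PM PK) p (bM, bK)) h"
    "h gH = hofib_base bQ (bM, bK)" "gH \<in> topspace (join_space G H)"
    unfolding eqs by (rule pf.join_fibre)
  have fib: "homotopy_fibration (join_space G H) PQ (prod_topology PM PK) (bM, bK) (fst \<circ> h) p"
    unfolding homotopy_fibration_def using h(1) pf.continuous_p unfolding eqs by auto
  have sec: "continuous_map (loop_space (prod_topology PM PK) (bM, bK)) (loop_space PQ bQ) pf.loop_section"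
    "homotopic_with (\<lambda>_. True) (loop_space (prod_topology PM PK) (bM, bK))
        (loop_space (prod_topology PM PK) (bM, bK)) (loop_map p \<circ> pf.loop_section) id"
    unfolding eqs by (rule pf.continuous_map_loop_section pf.homotopic_loop_section)+
  have "loop_space PQ bQ homotopy_equivalent_space prod_topology (loop_space (prod_topology PM PK) (bM, bK))
      (loop_space (hofib PQ (prod_topology PM PK) p (bM, bK)) (h gH))"
    unfolding h(2) unfolding eqs by (rule pf.loop_space_split)
  \<comment> \<open>The equivalence \<open>h\<close> sends \<open>gH\<close> to the base point of
    the fibre, which suffices to compare loop spaces although its inverse need not respect base
    points.\<close>
  also have "\<dots> homotopy_equivalent_space prod_topology (loop_space (prod_topology PM PK) (bM, bK)) (loop_space (join_space G H) gH)"
    using loop_space_homotopy_equivalence[OF h(1,3)] homotopy_equivalent_space_sym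
    by (intro homotopy_equivalent_space_prod) blast
  also have "\<dots> homotopy_equivalent_space prod_topology (loop_space PM bM)
          (prod_topology (loop_space PK bK) (loop_space (join_space G H) gH))"
    by (rule homeomorphic_imp_homotopy_equivalent_space[OF loop_space_prod])
  finally show ?thesis using fib sec by blast
qed

end
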